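(* Let $d,N,m\ge1$ be integers with $N\ge m-1$. For $i\in\{1,\dots,d\}$ let $A_i=(\alpha_{jk}(i))_{j,k=1}^N\in\mathbb{R}^{N\times N}$ and let $D_i=\mathrm{diag}(d_1(i),\dots,d_N(i))\in\mathbb{R}^{N\times N}$ be diagonal, such that the coefficients $$\{\alpha_{jk}(i) ~|~ 1\le i\le d,\ 1\le j,k\le N\}\cup\{d_j(i) ~|~ 1\le i\le d,\ 1\le j\le N\}$$ are algebraically independent over $\mathbb{Q}$. Define $V_1,\dots,V_d:\mathbb{R}^N\to\mathbb{R}^N$ by $$V_i(x)=\exp(A_i\exp(D_ix)),\qquad x\in\mathbb{R}^N,$$ where $\exp$ is applied componentwise to vectors. Then the collection of tree-like vector fields $\{V_\tau ~|~ \tau\in\mathbb{T}_w,\ w\in\mathscr{W}_m\}$ is linearly independent, and consequently the operators $\{V_w:C^\infty(\mathbb{R}^N)\to C^\infty(\mathbb{R}^N) ~|~ w\in\mathscr{W}_m\}$ (a family indexed by the words $w\in\mathscr{W}_m$) are linearly independent.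
   Context: Algebraic independence of the listed coefficients means that they are pairwise distinct as an indexed family and no nonzero polynomial with rational coefficients vanishes at them. $\mathscr{W}_m$ is the set of words $w=(w_1,\dots,w_m)$ with letters $w_l\in\{1,\dots,d\}$. $C^\infty(\mathbb{R}^N)$ is the space of smooth functions $\mathbb{R}^N\to\mathbb{R}$. Linear independence is over $\mathbb{R}$. Iterated operators. For a letter $i$, a nonempty word $w$, $\phi\in C^\infty(\mathbb{R}^N)$ and $x\in\mathbb{R}^N$: $V_i\phi(x)=(\nabla\phi(x))^TV_i(x)$ and $V_{wi}\phi(x)=V_i(V_w\phi)(x)=(\nabla(V_w\phi)(x))^TV_i(x)$, where $wi$ is the word $w$ followed by the letter $i$. Trees. For $w\in\mathscr{W}_m$, $\mathbb{T}_w$ is the set of letter-labelled recursive trees of order $m$ with letter labels $w$: rooted trees on the vertex set $\{1,\dots,m\}$ with root $1$, in which each vertex $l\ge2$ is attached by an edge to a parent vertex in $\{1,\dots,l-1\}$, and vertex $l$ carries the letter $w_l$. The order of the branches at a vertex is ignored. $\bullet_i$ is the one-vertex tree with letter $i$, and $[\tau_1\cdots\tau_k]_{\bullet_i}$ is the tree obtained by attaching the roots of $\tau_1,\dots,\tau_k$ to a new root with letter $i$. Tree-like vector fields. To each tree $\tau$ associate $V_\tau:\mathbb{R}^N\to\mathbb{R}^N$ recursively by $V_{\bullet_i}(x)=V_i(x)$ and $$V_{[\tau_1\cdots\tau_k]_{\bullet_i}}(x)=\sum_{j_1,\dots,j_k=1}^N\frac{\partial^kV_i}{\partial x_{j_k}\cdots\partial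 x_{j_1}}(x)\cdot\pi_{j_1}(V_{\tau_1}(x))\cdots\pi_{j_k}(V_{\tau_k}(x)),$$ where $\pi_j:\mathbb{R}^N\to\mathbb{R}$ is the $j$-th coordinate projection. $V_\tau$ depends only on the underlying rooted tree with its letters, not on the numbering of the vertices. Linear independence of $\{V_\tau ~|~ \tau\in\mathbb{T}_w,\ w\in\mathscr{W}_m\}$ means linear independence of the family indexed by these trees, where trees (possibly belonging to different words) that are isomorphic as letter-labelled rooted trees (forgetting the numbering) are identified and counted once. *)

theory Defs
  imports "HOL-Analysis.Analysis" "HOL-Library.Poly_Mapping"
begin

text \<open>Multivariate polynomials over the rationals are finitely supported maps from monomials
  (finitely supported exponent maps) to coefficients.\<close>

definition mpoly_eval :: "('i \<Rightarrow> real) \<Rightarrow> (('i \<Rightarrow>\<^sub>0 nat) \<Rightarrow>\<^sub>0 rat) \<Rightarrow> real" where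
  "mpoly_eval a p =
     (\<Sum>mon\<in>Poly_Mapping.keys p. of_rat (Poly_Mapping.lookup p mon) *
        (\<Prod>v\<in>Poly_Mapping.keys mon. a v ^ Poly_Mapping.lookup mon v))"

definition alg_independent :: "'i set \<Rightarrow> ('i \<Rightarrow> real) \<Rightarrow> bool" where
  "alg_independent I a \<longleftrightarrow> inj_on a I \<and>
     (\<forall>p :: ('i \<Rightarrow>\<^sub>0 nat) \<Rightarrow>\<^sub>0 rat.
        (\<forall>mon\<in>Poly_Mapping.keys p. Poly_Mapping.keys mon \<subseteq> I) \<longrightarrow> mpoly_eval a p = 0 \<longrightarrow> p = 0)"

text \<open>Linear independence over the reals of a family of vector-valued functions with domain
  \<open>X\<close>, indexed by \<open>I\<close>; values outside \<open>X\<close> are irrelevant.\<close>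

definition lin_indep_family ::
    "'x set \<Rightarrow> 'i set \<Rightarrow> ('i \<Rightarrow> 'x \<Rightarrow> 'v::real_vector) \<Rightarrow> bool" where
  "lin_indep_family X I f \<longleftrightarrow>
     (\<forall>J c. finite J \<longrightarrow> J \<subseteq> I \<longrightarrow> (\<forall>x\<in>X. (\<Sum>i\<in>J. c i *\<^sub>R f i x) = 0) \<longrightarrow> (\<forall>i\<in>J. c i = 0))"

definition partial :: "'n::finite \<Rightarrow> (real^'n \<Rightarrow> 'b::real_normed_vector) \<Rightarrow> real^'n \<Rightarrow> 'b" where
  "partial j f x = vector_derivative (\<lambda>t. f (x + t *\<^sub>R axis j 1)) (at 0)"

text \<open>For \<open>js = [j\<^sub>1, \<dots>, j\<^sub>k]\<close> the derivative in direction \<open>j\<^sub>1\<close> is taken first.\<close>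

definition iter_partial ::
    "'n::finite list \<Rightarrow> (real^'n \<Rightarrow> 'b::real_normed_vector) \<Rightarrow> real^'n \<Rightarrow> 'b" where
  "iter_partial js f = fold partial js f"

definition gradient :: "(real^'n::finite \<Rightarrow> real) \<Rightarrow> real^'n \<Rightarrow> real^'n" where
  "gradient \<phi> x = (\<chi> j. partial j \<phi> x)"

definition smooth_functions :: "(real^'n::finite \<Rightarrow> real) set" where
  "smooth_functions = {\<phi>. \<forall>js x. iter_partial js \<phi> differentiable (at x)}"

text \<open>Letters are \<open>1, \<dots>, d\<close>; the \<open>l\<close>-th letter of a word \<open>w\<close> is \<open>w ! (l - 1)\<close>.\<close>

definition words :: "nat \<Rightarrow> nat \<Rightarrow> nat list set" where
  "words d m = {w. length w = m \<and> set w \<subseteq> {1..d}}"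

definition letter_op ::
    "(nat \<Rightarrow> real^'n::finite \<Rightarrow> real^'n) \<Rightarrow> nat \<Rightarrow> (real^'n \<Rightarrow> real) \<Rightarrow> real^'n \<Rightarrow> real" where
  "letter_op V i \<phi> x = gradient \<phi> x \<bullet> V i x"

text \<open>The first letter of the word acts first: \<open>word_op V (w @ [i]) \<phi>\<close> is
  \<open>letter_op V i (word_op V w \<phi>)\<close>.\<close>

definition word_op ::
    "(nat \<Rightarrow> real^'n::finite \<Rightarrow> real^'n) \<Rightarrow> nat list \<Rightarrow> (real^'n \<Rightarrow> real) \<Rightarrow> real^'n \<Rightarrow> real" where
  "word_op V w \<phi> = fold (letter_op V) w \<phi>"

text \<open>A recursive tree is a pair of its word of letters and its parent map.\<close>

type_synonym rec_tree = "nat list \<times> (nat \<Rightarrow> nat)"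

definition rec_trees :: "nat list \<Rightarrow> rec_tree set" where
  "rec_trees w = {w} \<times> (\<Pi>\<^sub>E l\<in>{2..length w}. {1..<l})"

definition tree_iso :: "rec_tree \<Rightarrow> rec_tree \<Rightarrow> bool" where
  "tree_iso = (\<lambda>(w, p) (w', p').
     length w = length w' \<and>
     (\<exists>\<sigma>. bij_betw \<sigma> {1..length w} {1..length w'} \<and> \<sigma> 1 = 1 \<and>
        (\<forall>l\<in>{2..length w}. \<sigma> (p l) = p' (\<sigma> l)) \<and>
        (\<forall>l\<in>{1..length w}. w ! (l - 1) = w' ! (\<sigma> l - 1))))"

definition representatives :: "rec_tree set \<Rightarrow> rec_tree set \<Rightarrow> bool" where
  "representatives T R \<longleftrightarrow> R \<subseteq> T \<and> (\<forall>\<tau>\<in>T. \<exists>!\<rho>. \<rho> \<in> R \<and> tree_iso \<tau> \<rho>)"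

text \<open>\<open>Node i [\<tau>\<^sub>1, \<dots>, \<tau>\<^sub>k]\<close> is the tree with root letter \<open>i\<close> and branches
  \<open>\<tau>\<^sub>1, \<dots>, \<tau>\<^sub>k\<close>, the order of the branches being only auxiliary.\<close>

datatype ltree = Node nat "ltree list"

function subtree :: "nat list \<Rightarrow> (nat \<Rightarrow> nat) \<Rightarrow> nat \<Rightarrow> ltree" where
  "subtree w p l =
     Node (w ! (l - 1)) (map (\<lambda>k. subtree w p k) (filter (\<lambda>k. p k = l) [l + 1..<length w + 1]))"
  by pat_completeness auto
termination
  by (relation "Wellfounded.measure (\<lambda>(w, p, l). length w + 1 - l)") auto

declare subtree.simps [simp del]

definition to_ltree :: "rec_tree \<Rightarrow> ltree" where
  "to_ltree = (\<lambda>(w, p). subtree w p 1)"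

text \<open>The list \<open>js\<close> of summation indices ranges over the finite set of lists of length \<open>k\<close>;
  for \<open>k = 0\<close> the sum has the single term \<open>V i x\<close>.\<close>

fun ltree_field ::
    "(nat \<Rightarrow> real^'n::finite \<Rightarrow> real^'n) \<Rightarrow> ltree \<Rightarrow> real^'n \<Rightarrow> real^'n" where
  "ltree_field V (Node i ts) x =
     (\<Sum>js | length js = length ts.
        (\<Prod>(j, v)\<leftarrow>zip js (map (\<lambda>t. ltree_field V t x) ts). v $ j) *\<^sub>R iter_partial js (V i) x)"

definition tree_field ::
    "(nat \<Rightarrow> real^'n::finite \<Rightarrow> real^'n) \<Rightarrow> rec_tree \<Rightarrow> real^'n \<Rightarrow> real^'n" where
  "tree_field V \<tau> = ltree_field V (to_ltree \<tau>)"

definition vexp :: "real^'n \<Rightarrow> real^'n" where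
  "vexp v = (\<chi> j. exp (v $ j))"

end

theory Submission
  imports Defs "HOL-Library.Multiset" "HOL-Library.List_Lexorder" "HOL-Library.Nat_Bijection"
    "HOL-Combinatorics.Permutations"
begin

text \<open>
  On the diagonal \<open>x = (t, \<dots>, t)\<close> a component of \<open>V_\<tau>\<close> is a sum over decorations of \<open>\<tau>\<close>: every
  vertex gets a coordinate as its label, and the children of a vertex are grouped into blocks of
  equal labels. The growth and the exponent of a summand are given by the multiset \<open>M\<close> of pairs
  (letter, label) of the vertices and the multiset \<open>F\<close> of pairs (letter of the parent, label) of the
  blocks. Different pairs \<open>(M, F)\<close> give linearly independent functions of \<open>t\<close>, so that a linear
  relation splits into one linear equation for each \<open>(M, F)\<close>, whose coefficients are polynomials in
  the \<open>\<alpha>\<close> and \<open>d\<close>. Since the scalars of the relation are arbitrary reals, algebraic independence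
  can only be applied to a determinant of this system.

  Number the vertices of each tree in breadth-first order so that the resulting word of vertex codes
  is lexicographically maximal, and let the vertex at position \<open>i\<close> open a single block with label
  \<open>i\<close>; only the \<open>m - 1\<close> first positions have children, hence \<open>N \<ge> m - 1\<close> labels suffice. In the
  determinant of the corresponding rows the product of the monomials of these decorations occurs for
  the identity permutation only: a permutation with this product cannot decrease any prefix of the
  words, hence preserves all of them, and then it cannot move any parent to an earlier position,
  while the sum of the positions of the parents is determined by the product. For the operators one
  uses the coordinate functions as test functions and chains in place of the canonical numberings.
\<close>

section \<open>Exponential sums\<close>

text \<open>The determinant controls only the product of the monomials of all rows. The factors
  \<alpha>, which record the block to which an internal vertex belongs, could therefore be exchanged
  between different trees, and no tree can be rebuilt from its own row. What a row (M, F) does give,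
  once every internal vertex opens a single block, is for each block label the letter of the vertex
  opening the block and the letters of its children. This is what a vertex code stores, so only the
  arrangement of the internal vertices is left open. Lexicographic maximality replaces the
  reconstruction by a monotone quantity. While the parents of the internal vertices agree, a
  breadth-first order of the other tree can imitate the canonical one; leaves open no block and are
  known by their letters only, so the imitation may have to use an internal vertex in place of a
  leaf of the same letter. Codes are chosen such that this enlarges the word. Chains serve the
  operators because a chain has a single recursive numbering: it occurs among the trees of one word
  only, whereas a branched tree may occur for several words.\<close>

definition expsum :: "real set \<Rightarrow> (real \<Rightarrow> real) \<Rightarrow> real \<Rightarrow> real" where
  "expsum A a t = (\<Sum>\<mu>\<in>A. a \<mu> * exp (\<mu> * t))"

definition expsums :: "(real \<Rightarrow> real) set" where
  "expsums = {f. \<exists>A a. finite A \<and> f = expsum A a}"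

lemma expsum_in_expsums: "finite A \<Longrightarrow> expsum A a \<in> expsums"
  by (auto simp: expsums_def)

lemma expsum_superset:
  assumes "finite B" "A \<subseteq> B"
  shows "expsum A a = expsum B (\<lambda>\<mu>. if \<mu> \<in> A then a \<mu> else 0)"
  unfolding expsum_def
  using assms by (intro ext sum.mono_neutral_cong_left) auto

lemma expsums_add:
  assumes "f \<in> expsums" "g \<in> expsums"
  shows "(\<lambda>t. f t + g t) \<in> expsums"
proof -
  obtain A a B b where f: "finite A" "f = expsum A a" and g: "finite B" "g = expsum B b"
    using assms by (auto simp: expsums_def)
  have fin: "finite (A \<union> B)" using f g by simp
  have "(\<lambda>t. f t + g t) = expsum (A \<union> B)
      (\<lambda>\<mu>. (if \<mu> \<in> A then a \<mu> else 0) + (if \<mu> \<in> B then b \<mu> else 0))"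
    unfolding f(2) g(2) expsum_superset[OF fin Un_upper1] expsum_superset[OF fin Un_upper2]
    by (simp add: expsum_def sum.distrib distrib_right fun_eq_iff)
  with expsum_in_expsums[OF fin] show ?thesis by simp
qed

lemma expsums_sum:
  "finite I \<Longrightarrow> (\<And>i. i \<in> I \<Longrightarrow> f i \<in> expsums) \<Longrightarrow> (\<lambda>t. \<Sum>i\<in>I. f i t) \<in> expsums"
proof (induction I rule: finite_induct)
  case empty
  have "(\<lambda>t. 0) = expsum {} (\<lambda>_. 0)" by (simp add: expsum_def fun_eq_iff)
  with expsum_in_expsums[of "{}" "\<lambda>_. 0"] show ?case by simp
next
  case (insert i I)
  then show ?case by (simp add: expsums_add)
qed

lemma expsums_monomial: "(\<lambda>t. c * exp (\<mu> * t)) \<in> expsums"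
proof -
  have "(\<lambda>t. c * exp (\<mu> * t)) = expsum {\<mu>} (\<lambda>_. c)"
    by (simp add: expsum_def fun_eq_iff)
  with expsum_in_expsums[of "{\<mu>}" "\<lambda>_. c"] show ?thesis by simp
qed

lemma expsums_mult:
  assumes "f \<in> expsums" "g \<in> expsums"
  shows "(\<lambda>t. f t * g t) \<in> expsums"
proof -
  obtain A a B b where f: "finite A" "f = expsum A a" and g: "finite B" "g = expsum B b"
    using assms by (auto simp: expsums_def)
  have "(\<lambda>t. f t * g t) = (\<lambda>t. \<Sum>\<mu>\<in>A. \<Sum>\<nu>\<in>B. (a \<mu> * b \<nu>) * exp ((\<mu> + \<nu>) * t))"
    by (simp add: f g expsum_def sum_product exp_add fun_eq_iff algebra_simps)
  also have "\<dots> \<in> expsums"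
    using f g by (intro expsums_sum expsums_monomial)
  finally show ?thesis .
qed

lemma expsum_deriv:
  "(expsum A a has_real_derivative expsum A (\<lambda>\<mu>. a \<mu> * \<mu>) t) (at t)"
  unfolding expsum_def
  by (auto intro!: derivative_eq_intros sum.cong simp: mult_ac)

lemma expsum_leading_term:
  assumes "finite A" "\<And>\<mu>. \<mu> \<in> A \<Longrightarrow> \<mu> \<le> \<kappa>" "\<kappa> \<in> A"
  shows "((\<lambda>t. expsum A a t * exp (- \<kappa> * t)) \<longlongrightarrow> a \<kappa>) at_top"
proof -
  have eq: "expsum A a t * exp (- \<kappa> * t) = (\<Sum>\<mu>\<in>A. a \<mu> * exp ((\<mu> - \<kappa>) * t))" for t
    unfolding expsum_def sum_distrib_right
    by (intro sum.cong) (simp_all flip: exp_add add: algebra_simps)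
  have "((\<lambda>t. \<Sum>\<mu>\<in>A. a \<mu> * exp ((\<mu> - \<kappa>) * t)) \<longlongrightarrow> (\<Sum>\<mu>\<in>A. if \<mu> = \<kappa> then a \<kappa> else 0)) at_top"
  proof (intro tendsto_sum)
    fix \<mu> assume "\<mu> \<in> A"
    show "((\<lambda>t. a \<mu> * exp ((\<mu> - \<kappa>) * t)) \<longlongrightarrow> (if \<mu> = \<kappa> then a \<kappa> else 0)) at_top"
    proof (cases "\<mu> = \<kappa>")
      case False
      with assms(2) \<open>\<mu> \<in> A\<close> have "\<mu> - \<kappa> < 0" by force
      then have "filterlim (\<lambda>t. (\<mu> - \<kappa>) * t) at_bot at_top"
        by (intro filterlim_tendsto_neg_mult_at_bot[OF tendsto_const _ filterlim_ident])
      then have "((\<lambda>t. exp ((\<mu> - \<kappa>) * t)) \<longlongrightarrow> 0) at_top"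
        by (rule filterlim_compose[OF exp_at_bot])
      then show ?thesis using False by (simp add: tendsto_mult_right_zero)
    qed simp
  qed
  then show ?thesis unfolding eq using assms by (simp add: sum.delta)
qed

lemma expsum_eq_0_imp_coeff_0:
  assumes "finite A" "\<And>t. expsum A a t = 0" "\<mu> \<in> A"
  shows "a \<mu> = 0"
proof (rule ccontr)
  assume "a \<mu> \<noteq> 0"
  define B where "B = {\<mu>\<in>A. a \<mu> \<noteq> 0}"
  have B: "finite B" "B \<noteq> {}" using assms \<open>a \<mu> \<noteq> 0\<close> by (auto simp: B_def)
  have "expsum A a = expsum B a"
    unfolding expsum_def using assms by (intro ext sum.mono_neutral_right) (auto simp: B_def)
  then have "((\<lambda>t::real. 0) \<longlongrightarrow> a (Max B)) at_top"
    using expsum_leading_term[of B "Max B" a] B assms(2) by simp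
  then have "a (Max B) = 0" by (simp add: tendsto_const_iff)
  moreover have "Max B \<in> B" using B by simp
  ultimately show False by (simp add: B_def)
qed

text \<open>Compare the growth at infinity: \<open>a\<close> and \<open>b\<close> belong to the same
  exponents, so the first summand is at most of order \<open>exp (\<kappa> * t)\<close>, while the
  top exponent \<delta> > 0 of \<open>c\<close> lifts the product to order
  \<open>exp ((\<kappa> + \<delta>) * t)\<close>, where nothing can cancel it.\<close>

lemma expsum_no_solution_pos:
  assumes "finite A" "A \<noteq> {}" "\<And>\<mu>. \<mu> \<in> A \<Longrightarrow> a \<mu> \<noteq> 0"
    and "finite C" "\<gamma> \<in> C" "\<gamma> > 0" "c \<gamma> \<noteq> 0"
    and eq: "\<And>t. expsum A b t + expsum C c t * expsum A a t = 0"
  shows False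
proof -
  define \<kappa> where "\<kappa> = Max A"
  define B where "B = {\<mu>\<in>C. c \<mu> \<noteq> 0}"
  define \<delta> where "\<delta> = Max B"
  have B: "finite B" "\<gamma> \<in> B" using assms by (auto simp: B_def)
  have CB: "expsum C c = expsum B c"
    unfolding expsum_def using assms by (intro ext sum.mono_neutral_right) (auto simp: B_def)
  have \<delta>: "\<delta> \<in> B" "\<delta> > 0" unfolding \<delta>_def using B \<open>\<gamma> > 0\<close>
    by (auto intro: Max_in less_le_trans[OF _ Max_ge])
  have \<kappa>: "\<kappa> \<in> A" using assms by (simp add: \<kappa>_def)
  have l1: "((\<lambda>t. expsum A a t * exp (- \<kappa> * t)) \<longlongrightarrow> a \<kappa>) at_top"
    using assms \<kappa> by (intro expsum_leading_term) (auto simp: \<kappa>_def)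
  have l2: "((\<lambda>t. expsum A b t * exp (- \<kappa> * t)) \<longlongrightarrow> b \<kappa>) at_top"
    using assms \<kappa> by (intro expsum_leading_term) (auto simp: \<kappa>_def)
  have l3: "((\<lambda>t. expsum B c t * exp (- \<delta> * t)) \<longlongrightarrow> c \<delta>) at_top"
    using B \<delta> by (intro expsum_leading_term) (auto simp: \<delta>_def)
  have "filterlim (\<lambda>t. (- \<delta>) * t) at_bot at_top"
    using \<delta> by (intro filterlim_tendsto_neg_mult_at_bot[OF tendsto_const _ filterlim_ident]) auto
  then have l4: "((\<lambda>t. exp (- \<delta> * t)) \<longlongrightarrow> 0) at_top"
    by (rule filterlim_compose[OF exp_at_bot])
  have "((\<lambda>t. (expsum A b t * exp (- \<kappa> * t)) * exp (- \<delta> * t) +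
       (expsum B c t * exp (- \<delta> * t)) * (expsum A a t * exp (- \<kappa> * t))) \<longlongrightarrow> b \<kappa> * 0 + c \<delta> * a \<kappa>) at_top"
    by (intro tendsto_add tendsto_mult l1 l2 l3 l4)
  moreover have "(expsum A b t * exp (- \<kappa> * t)) * exp (- \<delta> * t) +
       (expsum B c t * exp (- \<delta> * t)) * (expsum A a t * exp (- \<kappa> * t)) =
       (expsum A b t + expsum C c t * expsum A a t) * (exp (- \<kappa> * t) * exp (- \<delta> * t))" for t
    by (simp add: CB algebra_simps)
  ultimately have "c \<delta> * a \<kappa> = 0" by (simp add: eq tendsto_const_iff)
  then show False using \<kappa> \<delta> assms(3) by (auto simp: B_def)
qed

lemma expsum_reflect: "expsum A a (- t) = expsum (uminus ` A) (\<lambda>\<mu>. a (- \<mu>)) t"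
  unfolding expsum_def by (subst sum.reindex) (auto intro!: sum.cong simp: inj_on_def)

text \<open>A negative exponent becomes positive when \<open>t\<close> is replaced by
  \<open>- t\<close>.\<close>

lemma expsum_no_solution:
  assumes "finite A" "A \<noteq> {}" "\<And>\<mu>. \<mu> \<in> A \<Longrightarrow> a \<mu> \<noteq> 0"
    and "finite C" "\<gamma> \<in> C" "\<gamma> \<noteq> 0" "c \<gamma> \<noteq> 0"
    and eq: "\<And>t. expsum A b t + expsum C c t * expsum A a t = 0"
  shows False
proof (cases "\<gamma> > 0")
  case True
  then show False using expsum_no_solution_pos[of A a C \<gamma> c b] assms by blast
next
  case False
  show False
  proof (rule expsum_no_solution_pos)
    show "expsum (uminus ` A) (\<lambda>\<mu>. b (- \<mu>)) t +
        expsum (uminus ` C) (\<lambda>\<mu>. c (- \<mu>)) t * expsum (uminus ` A) (\<lambda>\<mu>. a (- \<mu>)) t = 0" for t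
      using eq[of "- t"] by (simp add: expsum_reflect)
    show "- \<gamma> \<in> uminus ` C" "- \<gamma> > 0" "c (- (- \<gamma>)) \<noteq> 0" using assms False by auto
  qed (use assms in auto)
qed

text \<open>Divide the relation by one of the exponentials and by \<open>exp (\<mu> * t)\<close>, where \<open>\<mu>\<close> is an
  exponent of its coefficient, and differentiate: that coefficient loses a term, and no other
  nonzero coefficient can disappear by \<open>expsum_no_solution\<close>.\<close>

lemma exp_expsum_independent:
  assumes "finite L" "finite S" "0 \<notin> S"
    and "\<And>l l'. l \<in> L \<Longrightarrow> l' \<in> L \<Longrightarrow> l \<noteq> l' \<Longrightarrow> \<exists>s\<in>S. \<beta> l s \<noteq> \<beta> l' s"
    and "\<And>l. l \<in> L \<Longrightarrow> p l \<in> expsums"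
    and "\<And>t. (\<Sum>l\<in>L. p l t * exp (expsum S (\<beta> l) t)) = 0"
  shows "\<forall>l\<in>L. \<forall>t. p l t = 0"
  using assms(1,4-)
proof (induction L arbitrary: p rule: finite_induct)
  case (insert l0 L)
  let ?h = "\<lambda>l. expsum S (\<lambda>s. (\<beta> l s - \<beta> l0 s) * s)"
  \<comment> \<open>Second induction, on the exponents \<open>B\<close> in the coefficient of
    \<open>l0\<close>. Each round removes one of them; when none is left, \<open>l0\<close> drops
    out of the relation and the outer hypothesis applies.\<close>
  have inner: "\<forall>l\<in>insert l0 L. \<forall>t. p l t = 0"
    if "finite B" "p l0 = expsum B b" "\<And>l. l \<in> L \<Longrightarrow> p l \<in> expsums"
      "\<And>t. (\<Sum>l\<in>insert l0 L. p l t * exp (expsum S (\<beta> l) t)) = 0" for B b p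
    using that
  proof (induction B arbitrary: p b rule: finite_induct)
    case empty
    then have p0: "p l0 t = 0" for t by (simp add: expsum_def)
    have "\<forall>l\<in>L. \<forall>t. p l t = 0"
    proof (rule insert.IH)
      show "(\<Sum>l\<in>L. p l t * exp (expsum S (\<beta> l) t)) = 0" for t
        using empty(3)[of t] insert.hyps by (simp add: p0)
    qed (use insert.prems empty in auto)
    then show ?case using p0 by simp
  next
    case (insert \<mu> B)
    note B = insert.hyps and IH = insert.IH and pl0 = insert.prems(1)
      and pE = insert.prems(2) and rel = insert.prems(3)
    have "\<forall>l\<in>L. \<exists>A a. finite A \<and> p l = expsum A a"
      using pE by (auto simp: expsums_def)
    then obtain A a where Aa: "\<And>l. l \<in> L \<Longrightarrow> finite (A l) \<and> p l = expsum (A l) (a l)"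
      by metis
    \<comment> \<open>The coefficients after dividing by
      \<open>exp (expsum S (\<beta> l0) t + \<mu> * t)\<close> and differentiating. For
      \<open>l0\<close> only the factor \<open>exp (- \<mu> * t)\<close> remains, so a term with
      exponent \<nu> is multiplied by \<nu> - \<mu>, which removes the exponent \<mu>.\<close>
    define q where "q = (\<lambda>l. if l = l0 then expsum B (\<lambda>\<nu>. b \<nu> * (\<nu> - \<mu>))
      else (\<lambda>t. expsum (A l) (\<lambda>\<nu>. a l \<nu> * \<nu>) t + (?h l t - \<mu>) * p l t))"
    let ?u = "\<lambda>t. \<Sum>l\<in>insert l0 L. p l t * exp (expsum S (\<lambda>s. \<beta> l s - \<beta> l0 s) t - \<mu> * t)"
    have u0: "?u t = 0" for t
    proof -
      have "?u t = (\<Sum>l\<in>insert l0 L. p l t * exp (expsum S (\<beta> l) t)) * exp (- expsum S (\<beta> l0) t - \<mu> * t)"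
        unfolding sum_distrib_right
        by (intro sum.cong)
          (simp_all add: expsum_def left_diff_distrib sum_subtractf mult.assoc flip: exp_add)
      then show ?thesis by (simp add: rel)
    qed
    have deriv: "((\<lambda>t. p l t * exp (expsum S (\<lambda>s. \<beta> l s - \<beta> l0 s) t - \<mu> * t)) has_real_derivative
        q l t * exp (expsum S (\<lambda>s. \<beta> l s - \<beta> l0 s) t - \<mu> * t)) (at t)"
      if "l \<in> insert l0 L" for l t
    proof -
      obtain A' a' where p': "p l = expsum A' a'" and
        q': "q l = (\<lambda>t. expsum A' (\<lambda>\<nu>. a' \<nu> * \<nu>) t + (?h l t - \<mu>) * p l t)"
      proof (cases "l = l0")
        case True
        have "q l = (\<lambda>t. expsum (insert \<mu> B) (\<lambda>\<nu>. b \<nu> * \<nu>) t + (?h l t - \<mu>) * p l t)"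
        proof
          fix t
          have "expsum B (\<lambda>\<nu>. b \<nu> * (\<nu> - \<mu>)) t = expsum B (\<lambda>\<nu>. b \<nu> * \<nu>) t - \<mu> * expsum B b t"
            by (simp add: expsum_def algebra_simps sum_subtractf sum_distrib_left)
          moreover have "expsum (insert \<mu> B) (\<lambda>\<nu>. b \<nu> * \<nu>) t = b \<mu> * \<mu> * exp (\<mu> * t) + expsum B (\<lambda>\<nu>. b \<nu> * \<nu>) t"
            "expsum (insert \<mu> B) b t = b \<mu> * exp (\<mu> * t) + expsum B b t"
            using B by (simp_all add: expsum_def)
          moreover have "?h l0 t = 0" by (simp add: expsum_def)
          ultimately show "q l t = expsum (insert \<mu> B) (\<lambda>\<nu>. b \<nu> * \<nu>) t + (?h l t - \<mu>) * p l t"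
            by (simp add: True q_def pl0 algebra_simps)
        qed
        then show ?thesis using that[of "insert \<mu> B" b] by (simp add: True pl0)
      next
        case False
        then show ?thesis using that[of "A l" "a l"] Aa[of l] \<open>l \<in> insert l0 L\<close> by (simp add: q_def)
      qed
      show ?thesis
        unfolding q' unfolding p'
        by (rule derivative_eq_intros expsum_deriv refl)+ (simp add: algebra_simps)
    qed
    have "(?u has_real_derivative (\<Sum>l\<in>insert l0 L. q l t * exp (expsum S (\<lambda>s. \<beta> l s - \<beta> l0 s) t - \<mu> * t))) (at t)" for t
      by (intro DERIV_sum deriv)
    then have sum0: "(\<Sum>l\<in>insert l0 L. q l t * exp (expsum S (\<lambda>s. \<beta> l s - \<beta> l0 s) t - \<mu> * t)) = 0" for t
      unfolding u0 using DERIV_unique[OF _ DERIV_const] by blast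
    have "\<forall>l\<in>insert l0 L. \<forall>t. q l t = 0"
    proof (rule IH)
      show "q l0 = expsum B (\<lambda>\<nu>. b \<nu> * (\<nu> - \<mu>))" by (simp add: q_def)
      show "q l \<in> expsums" if "l \<in> L" for l
      proof -
        have "l \<noteq> l0" using that \<open>l0 \<notin> L\<close> by auto
        have "(\<lambda>t. ?h l t + - \<mu> * exp (0 * t)) \<in> expsums"
          using \<open>finite S\<close> by (intro expsums_add expsum_in_expsums expsums_monomial)
        then have "(\<lambda>t. (?h l t + - \<mu> * exp (0 * t)) * p l t) \<in> expsums"
          using pE[OF that] by (rule expsums_mult)
        then have "(\<lambda>t. expsum (A l) (\<lambda>\<nu>. a l \<nu> * \<nu>) t + (?h l t + - \<mu> * exp (0 * t)) * p l t) \<in> expsums"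
          using Aa[OF that] by (intro expsums_add expsum_in_expsums) auto
        then show ?thesis using \<open>l \<noteq> l0\<close> by (simp add: q_def)
      qed
      show "(\<Sum>l\<in>insert l0 L. q l t * exp (expsum S (\<beta> l) t)) = 0" for t
      proof -
        have "(\<Sum>l\<in>insert l0 L. q l t * exp (expsum S (\<beta> l) t)) =
          (\<Sum>l\<in>insert l0 L. q l t * exp (expsum S (\<lambda>s. \<beta> l s - \<beta> l0 s) t - \<mu> * t)) * exp (expsum S (\<beta> l0) t + \<mu> * t)"
          unfolding sum_distrib_right
          by (intro sum.cong)
            (simp_all add: expsum_def left_diff_distrib sum_subtractf mult.assoc flip: exp_add)
        then show ?thesis by (simp add: sum0)
      qed
    qed
    note q0 = this
    \<comment> \<open>For \<open>l\<close> in \<open>L\<close> the equation \<open>q l = 0\<close>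
      reads \<open>p' + (h - \<mu>) * p = 0\<close>. In \<open>h\<close> a term with exponent
      \<open>s\<close> survives, because \<open>\<beta> l s \<noteq> \<beta> l0 s\<close> and
      \<open>s \<noteq> 0\<close>, so a nonzero \<open>p\<close> contradicts
      \<open>expsum_no_solution\<close>.\<close>
    have pL: "\<forall>l\<in>L. \<forall>t. p l t = 0"
    proof (rule ccontr)
      assume "\<not> ?thesis"
      then obtain l t0 where l: "l \<in> L" "p l t0 \<noteq> 0" by blast
      then have "l \<noteq> l0" using \<open>l0 \<notin> L\<close> by auto
      define A' where "A' = {\<nu>\<in>A l. a l \<nu> \<noteq> 0}"
      have A': "finite A'" using Aa[OF l(1)] by (simp add: A'_def)
      have pA': "p l t = expsum A' (a l) t" for t
        unfolding Aa[OF l(1), THEN conjunct2] expsum_def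
        using Aa[OF l(1)] by (intro sum.mono_neutral_right) (auto simp: A'_def)
      have dA': "expsum (A l) (\<lambda>\<nu>. a l \<nu> * \<nu>) t = expsum A' (\<lambda>\<nu>. a l \<nu> * \<nu>) t" for t
        unfolding expsum_def
        using Aa[OF l(1)] by (intro sum.mono_neutral_right) (auto simp: A'_def)
      obtain s where s: "s \<in> S" "\<beta> l s \<noteq> \<beta> l0 s"
        using insert.prems(1) \<open>l \<noteq> l0\<close> l \<open>\<And>l l'. l \<in> insert l0 L \<Longrightarrow> l' \<in> insert l0 L \<Longrightarrow> l \<noteq> l' \<Longrightarrow> \<exists>s\<in>S. \<beta> l s \<noteq> \<beta> l' s\<close>
        by blast
      show False
      proof (rule expsum_no_solution[where A = A' and a = "a l" and C = S and \<gamma> = s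
            and c = "\<lambda>s. (\<beta> l s - \<beta> l0 s) * s" and b = "\<lambda>\<nu>. a l \<nu> * (\<nu> - \<mu>)"])
        show "finite A'" "finite S" "s \<in> S" by fact+
        show "A' \<noteq> {}" using l(2) by (auto simp: pA' expsum_def)
        show "s \<noteq> 0" using s \<open>0 \<notin> S\<close> by auto
        then show "(\<beta> l s - \<beta> l0 s) * s \<noteq> 0" using s by simp
        show "expsum A' (\<lambda>\<nu>. a l \<nu> * (\<nu> - \<mu>)) t + ?h l t * expsum A' (a l) t = 0" for t
        proof -
          have "expsum A' (\<lambda>\<nu>. a l \<nu> * \<nu>) t + (?h l t - \<mu>) * expsum A' (a l) t = 0"
            using q0 l(1) \<open>l \<noteq> l0\<close> by (auto simp: q_def pA' dA')
          moreover have "expsum A' (\<lambda>\<nu>. a l \<nu> * (\<nu> - \<mu>)) t = expsum A' (\<lambda>\<nu>. a l \<nu> * \<nu>) t - \<mu> * expsum A' (a l) t"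
            by (simp add: expsum_def algebra_simps sum_subtractf sum_distrib_left)
          ultimately show ?thesis by (simp add: algebra_simps)
        qed
      qed (simp add: A'_def)
    qed
    moreover have "p l0 t = 0" for t
      using rel[of t] pL \<open>l0 \<notin> L\<close> \<open>finite L\<close> by simp
    ultimately show ?case by simp
  qed
  obtain B b where "finite B" "p l0 = expsum B b"
    using insert.prems(2)[of l0] by (auto simp: expsums_def)
  then show ?case using inner[of B p b] insert.prems by simp
qed simp

section \<open>Algebraic independence and determinants\<close>

text \<open>Several \<open>k\<close> may carry the same monomial, so independence makes only the
  collected coefficient of each monomial \<open>E\<close> vanish. Monomials are multisets of
  variables because they arise as products of factors read off from the vertices of a tree.\<close>

lemma alg_independent_imp_coeff_sum_0:
  fixes a :: "'i \<Rightarrow> real" and q :: "'k \<Rightarrow> rat" and e :: "'k \<Rightarrow> 'i multiset"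
  assumes alg: "alg_independent I a" and K: "finite K"
    and I: "\<And>k. k \<in> K \<Longrightarrow> set_mset (e k) \<subseteq> I"
    and zero: "(\<Sum>k\<in>K. of_rat (q k) * (\<Prod>v\<in>#e k. a v)) = 0"
  shows "(\<Sum>k | k \<in> K \<and> e k = E. q k) = 0"
proof -
  define mon where "mon = (\<lambda>M :: 'i multiset. Abs_poly_mapping (count M))"
  have lookup: "Poly_Mapping.lookup (mon M) = count M" for M
    unfolding mon_def by (intro Poly_Mapping.lookup_Abs_poly_mapping) (simp add: set_mset_def[symmetric])
  have keys: "Poly_Mapping.keys (mon M) = set_mset M" for M
    by (auto simp: in_keys_iff lookup)
  have inj: "mon M = mon M' \<longleftrightarrow> M = M'" for M M'
    by (metis lookup multiset_eqI)
  define p where "p = (\<Sum>k\<in>K. Poly_Mapping.single (mon (e k)) (q k))"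
  have lp: "Poly_Mapping.lookup p m = (\<Sum>k\<in>K. if mon (e k) = m then q k else 0)" for m
    by (simp add: p_def lookup_sum lookup_single when_def)
  let ?S = "mon ` e ` K"
  have keys_p: "Poly_Mapping.keys p \<subseteq> ?S"
  proof
    fix m assume "m \<in> Poly_Mapping.keys p"
    then have "(\<Sum>k\<in>K. if mon (e k) = m then q k else 0) \<noteq> 0"
      by (simp add: in_keys_iff lp)
    then obtain k where "k \<in> K" "(if mon (e k) = m then q k else 0) \<noteq> 0"
      by (rule sum.not_neutral_contains_not_neutral)
    then show "m \<in> ?S" by (auto split: if_splits)
  qed
  let ?mono = "\<lambda>m. \<Prod>v\<in>Poly_Mapping.keys m. a v ^ Poly_Mapping.lookup m v"
  have mono: "?mono (mon M) = (\<Prod>v\<in>#M. a v)" for M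
    by (simp add: keys lookup image_prod_mset_multiplicity)
  have "mpoly_eval a p = (\<Sum>m\<in>?S. of_rat (Poly_Mapping.lookup p m) * ?mono m)"
    unfolding mpoly_eval_def using K keys_p
    by (intro sum.mono_neutral_left) (auto simp: in_keys_iff)
  also have "\<dots> = (\<Sum>m\<in>?S. \<Sum>k\<in>K. if mon (e k) = m then of_rat (q k) * ?mono m else 0)"
    unfolding lp of_rat_sum sum_distrib_right by (intro sum.cong refl) auto
  also have "\<dots> = (\<Sum>k\<in>K. \<Sum>m\<in>?S. if mon (e k) = m then of_rat (q k) * ?mono m else 0)"
    by (rule sum.swap)
  also have "\<dots> = (\<Sum>k\<in>K. of_rat (q k) * (\<Prod>v\<in>#e k. a v))"
    using K by (intro sum.cong refl) (simp add: sum.delta' mono)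
  also have "\<dots> = 0" by (rule zero)
  finally have "mpoly_eval a p = 0" .
  moreover have "\<forall>m\<in>Poly_Mapping.keys p. Poly_Mapping.keys m \<subseteq> I"
    using keys_p I by (fastforce simp: keys)
  ultimately have "p = 0"
    using alg unfolding alg_independent_def by blast
  then have "(\<Sum>k\<in>K. if mon (e k) = mon E then q k else 0) = 0"
    unfolding lp[symmetric] by simp
  then show ?thesis
    using K by (simp add: inj sum.inter_filter)
qed

text \<open>Cramer's argument: replacing column \<open>t0\<close> by the vanishing combination of
  all columns with scalars \<open>c\<close> multiplies the determinant by \<open>c t0\<close>, since
  every other column contributes a determinant with a repeated column. The Leibniz form allows an
  arbitrary finite index set.\<close>

lemma leibniz_sum_eq_0:
  fixes M :: "'t \<Rightarrow> 't \<Rightarrow> real"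
  assumes T: "finite T" and rel: "\<And>r. r \<in> T \<Longrightarrow> (\<Sum>t\<in>T. c t * M r t) = 0"
    and t0: "t0 \<in> T" "c t0 \<noteq> 0"
  shows "(\<Sum>\<pi> | \<pi> permutes T. of_int (sign \<pi>) * (\<Prod>r\<in>T. M r (\<pi> r))) = 0"
proof -
  define g where "g = (\<lambda>s t. if t = t0 then s else t)"
  \<comment> \<open>The determinant with column \<open>t0\<close> replaced by column
    \<open>s\<close>.\<close>
  define N where "N = (\<lambda>s. \<Sum>\<pi> | \<pi> permutes T. of_int (sign \<pi>) * (\<Prod>r\<in>T. M r (g s (\<pi> r))))"
  have N0: "N s = 0" if "s \<in> T" "s \<noteq> t0" for s
  proof -
    let ?\<tau> = "Transposition.transpose t0 s"
    have \<tau>: "?\<tau> permutes T" using t0 that by (simp add: permutes_swap_id)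
    have g: "g s (?\<tau> t) = g s t" for t
      by (auto simp: g_def Transposition.transpose_def)
    have "N s = (\<Sum>\<pi> | \<pi> permutes T. of_int (sign (?\<tau> \<circ> \<pi>)) * (\<Prod>r\<in>T. M r (g s ((?\<tau> \<circ> \<pi>) r))))"
      unfolding N_def by (rule setum_permutations_compose_left[OF \<tau>])
    also have "\<dots> = (\<Sum>\<pi> | \<pi> permutes T. - (of_int (sign \<pi>) * (\<Prod>r\<in>T. M r (g s (\<pi> r)))))"
    proof (intro sum.cong refl)
      fix \<pi> assume "\<pi> \<in> {\<pi>. \<pi> permutes T}"
      then have "sign (?\<tau> \<circ> \<pi>) = - sign \<pi>"
        using T \<tau> that by (subst sign_compose) (auto simp: permutation_permutes sign_swap_id)
      then show "of_int (sign (?\<tau> \<circ> \<pi>)) * (\<Prod>r\<in>T. M r (g s ((?\<tau> \<circ> \<pi>) r))) =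
          - (of_int (sign \<pi>) * (\<Prod>r\<in>T. M r (g s (\<pi> r))))"
        by (simp add: g)
    qed
    also have "\<dots> = - N s" by (simp add: N_def sum_negf)
    finally show ?thesis by simp
  qed
  have "c t0 * N t0 = (\<Sum>s\<in>T. c s * N s)"
    using T t0 N0 by (simp add: sum.remove[of T t0])
  also have "\<dots> = (\<Sum>\<pi> | \<pi> permutes T. \<Sum>s\<in>T. c s * (of_int (sign \<pi>) * (\<Prod>r\<in>T. M r (g s (\<pi> r)))))"
    unfolding N_def sum_distrib_left by (rule sum.swap)
  also have "\<dots> = 0"
  proof (rule sum.neutral, rule ballI)
    fix \<pi> assume "\<pi> \<in> {\<pi>. \<pi> permutes T}"
    then have \<pi>: "\<pi> permutes T" by simp
    define r0 where "r0 = inv \<pi> t0"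
    have r0: "r0 \<in> T" "\<pi> r0 = t0"
      using \<pi> t0 by (simp_all add: r0_def permutes_in_image permutes_inv permutes_inverses)
    have *: "(\<Prod>r\<in>T. M r (g s (\<pi> r))) = M r0 s * (\<Prod>r\<in>T - {r0}. M r (\<pi> r))" for s
    proof -
      have "\<pi> r \<noteq> t0" if "r \<noteq> r0" for r
        using that r0 permutes_inj[OF \<pi>] by (auto dest: injD)
      then show ?thesis
        using T r0 by (simp add: prod.remove[of T r0] g_def)
    qed
    have "(\<Sum>s\<in>T. c s * (of_int (sign \<pi>) * (\<Prod>r\<in>T. M r (g s (\<pi> r))))) =
        of_int (sign \<pi>) * (\<Prod>r\<in>T - {r0}. M r (\<pi> r)) * (\<Sum>s\<in>T. c s * M r0 s)"
      unfolding * sum_distrib_left by (simp add: mult_ac)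
    then show "(\<Sum>s\<in>T. c s * (of_int (sign \<pi>) * (\<Prod>r\<in>T. M r (g s (\<pi> r))))) = 0"
      using rel[OF r0(1)] by simp
  qed
  finally have "N t0 = 0" using t0 by simp
  moreover have "g t0 t = t" for t by (simp add: g_def)
  ultimately show ?thesis by (simp add: N_def)
qed

text \<open>The square system with rows \<open>cls (can t)\<close> has a nonzero determinant: after expanding it into
  monomials in \<open>a\<close>, the product of the monomials of the \<open>can t\<close> occurs only for the identity
  permutation, hence with a positive coefficient.\<close>

lemma independent_if_unique_monomial:
  fixes a :: "'i \<Rightarrow> real" and ex :: "'l \<Rightarrow> 'i multiset" and cnt :: "'l \<Rightarrow> nat"
    and T :: "'t set"
  assumes alg: "alg_independent I a" and T: "finite T"
    and Lab: "\<And>t. t \<in> T \<Longrightarrow> finite (Lab t)"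
    and ex: "\<And>t l. t \<in> T \<Longrightarrow> l \<in> Lab t \<Longrightarrow> set_mset (ex l) \<subseteq> I"
    and can: "\<And>t. t \<in> T \<Longrightarrow> can t \<in> Lab t" "\<And>t. t \<in> T \<Longrightarrow> cnt (can t) > 0"
    and unique: "\<And>\<pi> g t. \<pi> permutes T \<Longrightarrow> (\<And>t. t \<in> T \<Longrightarrow> g t \<in> Lab (\<pi> t)) \<Longrightarrow>
        (\<And>t. t \<in> T \<Longrightarrow> cls (g t) = cls (can t)) \<Longrightarrow>
        (\<Sum>t\<in>T. ex (g t)) = (\<Sum>t\<in>T. ex (can t)) \<Longrightarrow> t \<in> T \<Longrightarrow> \<pi> t = t"
    and rel: "\<And>r. (\<Sum>t\<in>T. c t * (\<Sum>l | l \<in> Lab t \<and> cls l = r. real (cnt l) * (\<Prod>v\<in>#ex l. a v))) = 0"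
    and t: "t \<in> T"
  shows "c t = 0"
proof (rule ccontr)
  assume c: "c t \<noteq> 0"
  define Y where "Y = (\<lambda>\<pi> t. {l. l \<in> Lab (\<pi> t) \<and> cls l = cls (can t)})"
  \<comment> \<open>A term of the expanded determinant: a permutation together with the choice of
    one label from the entry in row \<open>t\<close> and column \<open>\<pi> t\<close>, for every
    \<open>t\<close>.\<close>
  define K where "K = (SIGMA \<pi>:{\<pi>. \<pi> permutes T}. PiE T (Y \<pi>))"
  define q :: "('t \<Rightarrow> 't) \<times> ('t \<Rightarrow> 'l) \<Rightarrow> rat" where
    "q = (\<lambda>(\<pi>, g). of_int (sign \<pi>) * (\<Prod>t\<in>T. of_nat (cnt (g t))))"
  define e where "e = (\<lambda>(\<pi> :: 't \<Rightarrow> 't, g). \<Sum>t\<in>T. ex (g t))"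
  have finY: "finite (Y \<pi> t)" if "\<pi> permutes T" "t \<in> T" for \<pi> t
    using Lab[of "\<pi> t"] that by (simp add: Y_def permutes_in_image)
  have finK: "finite K"
    unfolding K_def using T finY by (auto intro!: finite_SigmaI finite_PiE finite_permutations)
  have exp: "(\<Prod>v\<in>#(\<Sum>t\<in>T. ex (g t)). a v) = (\<Prod>t\<in>T. \<Prod>v\<in>#ex (g t). a v)" for g
    using T by (induction T rule: finite_induct) auto
  have "0 = (\<Sum>\<pi> | \<pi> permutes T. of_int (sign \<pi>) *
      (\<Prod>r\<in>T. \<Sum>l\<in>Y \<pi> r. real (cnt l) * (\<Prod>v\<in>#ex l. a v)))"
    using leibniz_sum_eq_0[OF T, of c "\<lambda>r t. \<Sum>l | l \<in> Lab t \<and> cls l = cls (can r).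
        real (cnt l) * (\<Prod>v\<in>#ex l. a v)" t] rel t c by (simp add: Y_def)
  also have "\<dots> = (\<Sum>\<pi> | \<pi> permutes T. \<Sum>g\<in>PiE T (Y \<pi>). of_rat (q (\<pi>, g)) * (\<Prod>v\<in>#e (\<pi>, g). a v))"
  proof (intro sum.cong refl)
    fix \<pi> assume "\<pi> \<in> {\<pi>. \<pi> permutes T}"
    then have "(\<Prod>r\<in>T. \<Sum>l\<in>Y \<pi> r. real (cnt l) * (\<Prod>v\<in>#ex l. a v)) =
        (\<Sum>g\<in>PiE T (Y \<pi>). \<Prod>r\<in>T. real (cnt (g r)) * (\<Prod>v\<in>#ex (g r). a v))"
      using T finY by (intro prod_sum_PiE) auto
    then show "of_int (sign \<pi>) * (\<Prod>r\<in>T. \<Sum>l\<in>Y \<pi> r. real (cnt l) * (\<Prod>v\<in>#ex l. a v)) =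
        (\<Sum>g\<in>PiE T (Y \<pi>). of_rat (q (\<pi>, g)) * (\<Prod>v\<in>#e (\<pi>, g). a v))"
      by (simp add: sum_distrib_left q_def e_def exp of_rat_mult of_rat_prod prod.distrib mult.assoc)
  qed
  also have "\<dots> = (\<Sum>k\<in>K. of_rat (q k) * (\<Prod>v\<in>#e k. a v))"
  proof -
    have "\<forall>\<pi>\<in>{\<pi>. \<pi> permutes T}. finite (PiE T (Y \<pi>))"
      using T finY by (auto intro!: finite_PiE)
    then show ?thesis
      unfolding K_def using T by (simp add: sum.Sigma finite_permutations case_prod_unfold)
  qed
  finally have zero: "(\<Sum>k\<in>K. of_rat (q k) * (\<Prod>v\<in>#e k. a v)) = 0" by (rule sym)
  define E where "E = (\<Sum>t\<in>T. ex (can t))"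
  have "set_mset (e k) \<subseteq> I" if kK: "k \<in> K" for k
  proof -
    obtain \<pi> g where k: "k = (\<pi>, g)" "\<pi> permutes T" "g \<in> PiE T (Y \<pi>)" using kK by (cases k) (auto simp: K_def)
    have "set_mset (\<Sum>t\<in>T. ex (g t)) = (\<Union>t\<in>T. set_mset (ex (g t)))"
      using T by (induction T rule: finite_induct) auto
    moreover have "set_mset (ex (g t)) \<subseteq> I" if "t \<in> T" for t
      using ex[of "\<pi> t" "g t"] k that by (auto simp: Y_def permutes_in_image dest!: PiE_mem)
    ultimately show ?thesis using k by (auto simp: e_def)
  qed
  then have sum0: "(\<Sum>k | k \<in> K \<and> e k = E. q k) = 0"
    using alg_independent_imp_coeff_sum_0[OF alg finK _ zero] by blast
  have nonneg: "q k \<ge> 0" if kK: "k \<in> K" "e k = E" for k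
  proof -
    obtain \<pi> g where k: "k = (\<pi>, g)" "\<pi> permutes T" "g \<in> PiE T (Y \<pi>)" using kK by (cases k) (auto simp: K_def)
    have "\<pi> t = t" if "t \<in> T" for t
    proof (rule unique[OF k(2) _ _ _ that, of g])
      show "(\<Sum>t\<in>T. ex (g t)) = (\<Sum>t\<in>T. ex (can t))"
        using \<open>e k = E\<close> by (simp add: k e_def E_def)
    qed (use k in \<open>auto simp: Y_def dest!: PiE_mem\<close>)
    then have "\<pi> = id"
      using k(2) by (metis eq_id_iff permutes_not_in)
    then show ?thesis by (simp add: k q_def prod_nonneg)
  qed
  have mem: "(id, restrict can T) \<in> K"
    using can(1) by (auto simp: K_def Y_def permutes_id)
  have eE: "e (id, restrict can T) = E"
    by (simp add: e_def E_def)
  have pos: "q (id, restrict can T) > 0"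
    using can(2) by (auto simp: q_def intro!: prod_pos)
  have "(\<Sum>k | k \<in> K \<and> e k = E. q k) > 0"
    by (rule sum_pos2[of _ "(id, restrict can T)"]) (use finK mem eE pos nonneg in auto)
  then show False using sum0 by simp
qed

section \<open>Expanding tree-like vector fields\<close>

definition kids :: "nat \<Rightarrow> (nat \<Rightarrow> nat) \<Rightarrow> nat \<Rightarrow> nat list" where
  "kids m p v = filter (\<lambda>k. p k = v) [v + 1..<m + 1]"

definition labelings :: "nat \<Rightarrow> 'n \<Rightarrow> (nat \<Rightarrow> 'n) set" where
  "labelings m j = (\<Pi>\<^sub>E v\<in>{1..m}. if v = 1 then {j} else UNIV)"

lemma distinct_kids: "distinct (kids m p v)"
  by (simp add: kids_def)

lemma set_kids:
  assumes "p \<in> (\<Pi>\<^sub>E l\<in>{2..m}. {1..<l})" "v \<ge> 1"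
  shows "set (kids m p v) = {k\<in>{2..m}. p k = v}"
  using PiE_mem[OF assms(1)] assms(2) by (fastforce simp: kids_def)

text \<open>Turns the summation over index lists in \<open>ltree_field\<close> into one over labels
  attached to the children, so that the labels chosen at different vertices can be merged into a
  single function.\<close>

lemma bij_betw_map_PiE:
  fixes ks :: "'a list"
  assumes "distinct ks"
  shows "bij_betw (\<lambda>\<psi> :: 'a \<Rightarrow> 'b. map \<psi> ks) (\<Pi>\<^sub>E c\<in>set ks. UNIV) {js. length js = length ks}"
proof -
  let ?g = "\<lambda>js :: 'b list. \<lambda>c\<in>set ks. the (map_of (zip ks js) c)"
  have nth: "the (map_of (zip ks js) (ks ! i)) = js ! i" if "length js = length ks" "i < length ks" for js :: "'b list" and i
    using map_of_zip_nth[of ks js i] assms that by simp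
  have 1: "\<forall>\<psi>\<in>\<Pi>\<^sub>E c\<in>set ks. UNIV. ?g (map \<psi> ks) = \<psi>"
  proof
    fix \<psi> :: "'a \<Rightarrow> 'b" assume \<psi>: "\<psi> \<in> (\<Pi>\<^sub>E c\<in>set ks. UNIV)"
    show "?g (map \<psi> ks) = \<psi>"
    proof
      fix c show "?g (map \<psi> ks) c = \<psi> c"
      proof (cases "c \<in> set ks")
        case True
        then obtain i where "i < length ks" "c = ks ! i" by (metis in_set_conv_nth)
        then show ?thesis using nth[of "map \<psi> ks" i] by simp
      next
        case False
        then show ?thesis using PiE_arb[OF \<psi> False] by simp
      qed
    qed
  qed
  have 2: "\<forall>js\<in>{js. length js = length ks}. map (?g js) ks = js"
    using nth by (auto intro!: nth_equalityI)
  show ?thesis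
    by (rule bij_betw_byWitness[where f' = ?g]) (use 1 2 in auto)
qed

lemma ltree_field_subtree:
  "ltree_field V (subtree w p l) x $ j =
     (\<Sum>\<psi>\<in>PiE (set (kids (length w) p l)) (\<lambda>_. UNIV).
        (\<Prod>c\<in>set (kids (length w) p l). ltree_field V (subtree w p c) x $ \<psi> c) *
        iter_partial (map \<psi> (kids (length w) p l)) (V (w ! (l - 1))) x $ j)"
proof -
  let ?ks = "kids (length w) p l" and ?f = "\<lambda>c. ltree_field V (subtree w p c) x"
  have "ltree_field V (subtree w p l) x = (\<Sum>js | length js = length ?ks.
        (\<Prod>(j, v)\<leftarrow>zip js (map ?f ?ks). v $ j) *\<^sub>R iter_partial js (V (w ! (l - 1))) x)"
    by (subst subtree.simps) (simp add: kids_def comp_def)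
  also have "\<dots> = (\<Sum>\<psi>\<in>PiE (set ?ks) (\<lambda>_. UNIV). (\<Prod>(j, v)\<leftarrow>zip (map \<psi> ?ks) (map ?f ?ks). v $ j) *\<^sub>R
        iter_partial (map \<psi> ?ks) (V (w ! (l - 1))) x)"
    by (rule sum.reindex_bij_betw[OF bij_betw_map_PiE[OF distinct_kids], symmetric])
  also have "\<dots> = (\<Sum>\<psi>\<in>PiE (set ?ks) (\<lambda>_. UNIV). (\<Prod>c\<in>set ?ks. ?f c $ \<psi> c) *\<^sub>R
        iter_partial (map \<psi> ?ks) (V (w ! (l - 1))) x)"
    by (intro sum.cong refl arg_cong2[of _ _ _ _ "(*\<^sub>R)"])
      (simp add: zip_map_map zip_same_conv_map comp_def prod.distinct_set_conv_list[OF distinct_kids])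
  finally show ?thesis by (simp add: sum_component)
qed

lemma sum_PiE_union:
  assumes "A \<inter> B = {}"
  shows "sum f (PiE (A \<union> B) T) =
    (\<Sum>\<phi>\<in>PiE A T. \<Sum>\<psi>\<in>PiE B T. f (\<lambda>x. if x \<in> A then \<phi> x else \<psi> x))"
proof -
  have "sum f (PiE (A \<union> B) T) =
      (\<Sum>(\<phi>, \<psi>)\<in>PiE A T \<times> PiE B T. f (\<lambda>x. if x \<in> A then \<phi> x else \<psi> x))"
  proof (rule sum.reindex_bij_witness[of _ "\<lambda>(\<phi>, \<psi>) x. if x \<in> A then \<phi> x else \<psi> x"
        "\<lambda>\<xi>. (restrict \<xi> A, restrict \<xi> B)"])
    fix \<xi> assume \<xi>: "\<xi> \<in> PiE (A \<union> B) T"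
    have "(\<lambda>x. if x \<in> A then restrict \<xi> A x else restrict \<xi> B x) = \<xi>"
      using PiE_arb[OF \<xi>] by (auto simp: fun_eq_iff)
    then show "(case (restrict \<xi> A, restrict \<xi> B) of (\<phi>, \<psi>) \<Rightarrow> \<lambda>x. if x \<in> A then \<phi> x else \<psi> x) = \<xi>"
      and "(case (restrict \<xi> A, restrict \<xi> B) of (\<phi>, \<psi>) \<Rightarrow> f (\<lambda>x. if x \<in> A then \<phi> x else \<psi> x)) = f \<xi>"
      by simp_all
    show "(restrict \<xi> A, restrict \<xi> B) \<in> PiE A T \<times> PiE B T"
      using \<xi> by auto
  next
    fix b assume b: "b \<in> PiE A T \<times> PiE B T"
    obtain \<phi> \<psi> where [simp]: "b = (\<phi>, \<psi>)" by (cases b)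
    show "(case b of (\<phi>, \<psi>) \<Rightarrow> \<lambda>x. if x \<in> A then \<phi> x else \<psi> x) \<in> PiE (A \<union> B) T"
      using b by (auto simp: PiE_iff extensional_def split: if_splits)
    have "restrict (\<lambda>x. if x \<in> A then \<phi> x else \<psi> x) A = \<phi>"
      "restrict (\<lambda>x. if x \<in> A then \<phi> x else \<psi> x) B = \<psi>"
      using b assms PiE_arb[of \<phi> A T] PiE_arb[of \<psi> B T] by (auto simp: fun_eq_iff restrict_def)
    then show "(restrict (case b of (\<phi>, \<psi>) \<Rightarrow> \<lambda>x. if x \<in> A then \<phi> x else \<psi> x) A,
        restrict (case b of (\<phi>, \<psi>) \<Rightarrow> \<lambda>x. if x \<in> A then \<phi> x else \<psi> x) B) = b"
      by simp
  qed
  then show ?thesis by (simp add: sum.cartesian_product)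
qed

text \<open>The recursive definition is unfolded at the vertices \<open>1, \<dots>, m\<close> in turn; after \<open>k\<close> steps the
  labels are chosen on \<open>E k\<close>, the vertices whose parent has been unfolded.\<close>

lemma tree_field_eq_sum_labelings:
  fixes V :: "nat \<Rightarrow> real^'n::finite \<Rightarrow> real^'n"
  assumes m: "length w = m" "m \<ge> 1" and p: "p \<in> (\<Pi>\<^sub>E l\<in>{2..m}. {1..<l})"
  shows "tree_field V (w, p) x $ j = (\<Sum>\<phi>\<in>labelings m j. \<Prod>v\<in>{1..m}.
      iter_partial (map \<phi> (kids m p v)) (V (w ! (v - 1))) x $ \<phi> v)"
proof -
  define G where "G = (\<lambda>\<phi> v. iter_partial (map \<phi> (kids m p v)) (V (w ! (v - 1))) x $ \<phi> v)"
  define F where "F = (\<lambda>v. ltree_field V (subtree w p v) x)"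
  define E where "E = (\<lambda>k. {v\<in>{1..m}. v = 1 \<or> p v \<le> k})"
  define T where "T = (\<lambda>v :: nat. if v = 1 then {j} else UNIV)"
  have pv: "1 \<le> p v" "p v < v" if "2 \<le> v" "v \<le> m" for v
    using PiE_mem[OF p, of v] that by auto
  have "k \<le> m \<Longrightarrow> F 1 $ j = (\<Sum>\<phi>\<in>PiE (E k) T. (\<Prod>v\<in>{1..k}. G \<phi> v) * (\<Prod>v\<in>E k - {1..k}. F v $ \<phi> v))" for k
  proof (induction k)
    case 0
    have "v = 1" if "v \<in> {1..m}" "p v = 0" for v
      using pv(1)[of v] that by (cases "v = 1") auto
    then have E0: "E 0 = {1}" using m by (auto simp: E_def)
    have "PiE {1} T = {\<lambda>v\<in>{1}. j}"
    proof -
      have "PiE {1} T = PiE {1} (\<lambda>v. {(\<lambda>v\<in>{1}. j) v})"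
        by (intro PiE_cong) (simp add: T_def)
      then show ?thesis by (simp only: PiE_singleton[OF restrict_extensional])
    qed
    then show ?case by (simp add: E0)
  next
    case (Suc k)
    let ?v = "Suc k" and ?C = "set (kids m p (Suc k))"
    let ?mg = "\<lambda>\<phi> \<psi> x. if x \<in> E k then \<phi> x else \<psi> x"
    have C: "?C = {c\<in>{2..m}. p c = ?v}" using p by (intro set_kids) auto
    have ES: "E ?v = E k \<union> ?C" unfolding C by (auto simp: E_def)
    have disj: "E k \<inter> ?C = {}" unfolding C by (auto simp: E_def)
    \<comment> \<open>Parents have smaller numbers than their children, so the next vertex to be
      unfolded already carries a label.\<close>
    have vE: "{1..?v} \<subseteq> E k"
    proof
      fix v assume v: "v \<in> {1..?v}"
      show "v \<in> E k"
      proof (cases "v = 1")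
        case False
        then show ?thesis using pv[of v] v Suc.prems by (auto simp: E_def)
      qed (use m in \<open>auto simp: E_def\<close>)
    qed
    have CT: "PiE ?C T = PiE ?C (\<lambda>_. UNIV)"
      by (intro PiE_cong) (auto simp: C T_def)
    have fin: "finite (E k)" by (simp add: E_def)
    have step: "(\<Prod>v\<in>{1..k}. G \<phi> v) * (\<Prod>v\<in>E k - {1..k}. F v $ \<phi> v) =
        (\<Sum>\<psi>\<in>PiE ?C T. (\<Prod>v\<in>{1..?v}. G (?mg \<phi> \<psi>) v) *
           (\<Prod>v\<in>E ?v - {1..?v}. F v $ (if v \<in> E k then \<phi> v else \<psi> v)))" for \<phi>
    proof -
      have split: "E k - {1..k} = insert ?v (E k - {1..?v})" using vE by auto
      have 1: "(\<Prod>v\<in>E k - {1..k}. F v $ \<phi> v) = F ?v $ \<phi> ?v * (\<Prod>v\<in>E k - {1..?v}. F v $ \<phi> v)"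
        unfolding split using fin by (subst prod.insert) auto
      have 2: "F ?v $ \<phi> ?v = (\<Sum>\<psi>\<in>PiE ?C T. (\<Prod>c\<in>?C. F c $ \<psi> c) *
          iter_partial (map \<psi> (kids m p ?v)) (V (w ! (?v - 1))) x $ \<phi> ?v)"
        unfolding F_def CT using ltree_field_subtree[of V w p ?v x "\<phi> ?v"] m by simp
      have 3: "G (?mg \<phi> \<psi>) v = G \<phi> v" if "v \<in> {1..k}" for v \<psi>
      proof -
        have "set (kids m p v) \<subseteq> E k"
          using set_kids[OF p, of v] that by (auto simp: E_def)
        then have "map (?mg \<phi> \<psi>) (kids m p v) = map \<phi> (kids m p v)"
          by auto
        moreover have "v \<in> E k" using vE that by auto
        ultimately show ?thesis by (simp only: G_def if_True)
      qed
      have 4: "G (?mg \<phi> \<psi>) ?v =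
          iter_partial (map \<psi> (kids m p ?v)) (V (w ! (?v - 1))) x $ \<phi> ?v" for \<psi>
      proof -
        have "map (?mg \<phi> \<psi>) (kids m p ?v) = map \<psi> (kids m p ?v)"
          using disj by auto
        moreover have "?v \<in> E k" using vE by auto
        ultimately show ?thesis by (simp only: G_def if_True)
      qed
      have 5: "(\<Prod>v\<in>{1..?v}. G (?mg \<phi> \<psi>) v) =
          (\<Prod>v\<in>{1..k}. G \<phi> v) * iter_partial (map \<psi> (kids m p ?v)) (V (w ! (?v - 1))) x $ \<phi> ?v" for \<psi>
      proof -
        have "(\<Prod>v\<in>{1..?v}. G (?mg \<phi> \<psi>) v) =
          (\<Prod>v\<in>{1..k}. G (?mg \<phi> \<psi>) v) * G (?mg \<phi> \<psi>) ?v"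
          by (simp add: prod.nat_ivl_Suc')
        also have "(\<Prod>v\<in>{1..k}. G (?mg \<phi> \<psi>) v) = (\<Prod>v\<in>{1..k}. G \<phi> v)"
          by (intro prod.cong refl 3)
        finally show ?thesis by (simp only: 4)
      qed
      have 6: "(\<Prod>v\<in>E ?v - {1..?v}. F v $ (if v \<in> E k then \<phi> v else \<psi> v)) =
          (\<Prod>v\<in>E k - {1..?v}. F v $ \<phi> v) * (\<Prod>c\<in>?C. F c $ \<psi> c)" for \<psi>
      proof -
        have eq: "E ?v - {1..?v} = (E k - {1..?v}) \<union> ?C"
          using vE disj by (auto simp: ES)
        have "(\<Prod>v\<in>(E k - {1..?v}) \<union> ?C. F v $ (if v \<in> E k then \<phi> v else \<psi> v)) =
          (\<Prod>v\<in>E k - {1..?v}. F v $ (if v \<in> E k then \<phi> v else \<psi> v)) *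
          (\<Prod>v\<in>?C. F v $ (if v \<in> E k then \<phi> v else \<psi> v))"
          using fin disj by (intro prod.union_disjoint) auto
        also have "(\<Prod>v\<in>E k - {1..?v}. F v $ (if v \<in> E k then \<phi> v else \<psi> v)) = (\<Prod>v\<in>E k - {1..?v}. F v $ \<phi> v)"
          by (intro prod.cong) auto
        also have "(\<Prod>v\<in>?C. F v $ (if v \<in> E k then \<phi> v else \<psi> v)) = (\<Prod>c\<in>?C. F c $ \<psi> c)"
          using disj by (intro prod.cong) auto
        finally show ?thesis by (simp only: eq)
      qed
      show ?thesis
        unfolding 1 2 5 6 by (simp add: sum_distrib_left sum_distrib_right mult_ac)
    qed
    have "F 1 $ j = (\<Sum>\<phi>\<in>PiE (E k) T. (\<Prod>v\<in>{1..k}. G \<phi> v) * (\<Prod>v\<in>E k - {1..k}. F v $ \<phi> v))"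
      using Suc by simp
    also have "\<dots> = (\<Sum>\<phi>\<in>PiE (E ?v) T. (\<Prod>v\<in>{1..?v}. G \<phi> v) * (\<Prod>v\<in>E ?v - {1..?v}. F v $ \<phi> v))"
      unfolding ES sum_PiE_union[OF disj] step[unfolded ES] by (rule refl)
    finally show ?case .
  qed
  from this[of m] have "F 1 $ j = (\<Sum>\<phi>\<in>PiE (E m) T. (\<Prod>v\<in>{1..m}. G \<phi> v) * (\<Prod>v\<in>E m - {1..m}. F v $ \<phi> v))"
    by simp
  moreover have Em: "E m = {1..m}"
  proof -
    have "v \<in> E m" if "v \<in> {1..m}" for v
      using pv(2)[of v] that by (cases "v = 1") (auto simp: E_def)
    then have "{1..m} \<subseteq> E m" by (rule subsetI)
    moreover have "E m \<subseteq> {1..m}" by (auto simp: E_def)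
    ultimately show ?thesis by (rule equalityI[rotated])
  qed
  ultimately have "F 1 $ j = (\<Sum>\<phi>\<in>PiE {1..m} T. \<Prod>v\<in>{1..m}. G \<phi> v)"
    by (simp add: Em)
  then show ?thesis
    by (simp add: F_def G_def T_def labelings_def tree_field_def to_ltree_def)
qed

section \<open>Derivatives of double exponentials and decorations of trees\<close>

text \<open>Repeated differentiation of \<open>exp (\<Sum>l. \<alpha> l * exp (\<delta> l * x l))\<close>: every further derivative in direction
  \<open>l\<close> opens a new block with label \<open>l\<close> or joins one of the existing blocks with this label.\<close>

definition block_step :: "'n \<Rightarrow> 'n multiset list \<Rightarrow> 'n multiset list" where
  "block_step l Bs = concat (map (\<lambda>B. add_mset l B # replicate (count B l) B) Bs)"

definition blocks :: "'n list \<Rightarrow> 'n multiset list" where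
  "blocks js = fold block_step js [{#}]"

lemma blocks_Nil [simp]: "blocks [] = [{#}]"
  by (simp add: blocks_def)

lemma blocks_snoc: "blocks (js @ [l]) = block_step l (blocks js)"
  by (simp add: blocks_def)

text \<open>The first derivative in a direction finds no block with this label and has to open one,
  so every direction in \<open>js\<close> is represented in each summand.\<close>

lemma set_mset_blocks: "B \<in> set (blocks js) \<Longrightarrow> set_mset B = set js"
proof (induction js arbitrary: B rule: rev_induct)
  case (snoc l js)
  from snoc.prems obtain B' where B': "B' \<in> set (blocks js)" "B = add_mset l B' \<or> (B = B' \<and> l \<in># B')"
    by (auto simp: blocks_snoc block_step_def split: if_splits)
  then show ?case using snoc.IH[OF B'(1)] by auto
qed simp

text \<open>After the first derivative, all further ones in the same direction may join the only
  block. Canonical decorations consist of such terms.\<close>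

lemma singleton_in_blocks:
  assumes "set js = {k}"
  shows "{#k#} \<in> set (blocks js)"
  using assms
proof (induction js rule: rev_induct)
  case (snoc l js)
  have l: "l = k" using snoc.prems by auto
  show ?case
  proof (cases "js = []")
    case True
    then show ?thesis by (simp add: blocks_snoc[of "[]", simplified] block_step_def l)
  next
    case False
    then have "set js = {k}" using snoc.prems l by (cases js) auto
    with snoc.IH have "{#k#} \<in> set (blocks js)" .
    then show ?thesis by (auto simp: blocks_snoc block_step_def l intro!: bexI[of _ "{#k#}"])
  qed
qed simp

definition exp_field :: "('n \<Rightarrow> 'n \<Rightarrow> real) \<Rightarrow> ('n \<Rightarrow> real) \<Rightarrow> real^'n::finite \<Rightarrow> 'n \<Rightarrow> real" where
  "exp_field \<alpha> \<delta> x k = exp (\<Sum>l\<in>UNIV. \<alpha> k l * exp (\<delta> l * x $ l))"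

text \<open>A derivative in direction \<open>l\<close> yields a factor \<open>\<delta> l\<close>
  whether it opens a block or joins one, but a factor
  \<open>\<alpha> k l * exp (\<delta> l * x $ l)\<close> only if it opens one. This is why the
  exponents of \<delta> are later read off from the children and those of \<alpha> from the
  blocks.\<close>

definition iter_exp_field ::
    "('n \<Rightarrow> 'n \<Rightarrow> real) \<Rightarrow> ('n \<Rightarrow> real) \<Rightarrow> 'n list \<Rightarrow> real^'n::finite \<Rightarrow> 'n \<Rightarrow> real" where
  "iter_exp_field \<alpha> \<delta> js x k = exp_field \<alpha> \<delta> x k * (\<Prod>l\<leftarrow>js. \<delta> l) *
     (\<Sum>B\<leftarrow>blocks js. \<Prod>l\<in>#B. \<alpha> k l * exp (\<delta> l * x $ l))"

lemma has_vector_derivative_vec_lambda: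
  fixes f :: "real \<Rightarrow> 'n::finite \<Rightarrow> real"
  assumes "\<And>k. ((\<lambda>t. f t k) has_real_derivative g k) (at t)"
  shows "((\<lambda>t. \<chi> k. f t k) has_vector_derivative (\<chi> k. g k)) (at (t::real))"
proof -
  have "((\<lambda>t. \<Sum>k\<in>UNIV. f t k *\<^sub>R axis k (1::real)) has_vector_derivative (\<Sum>k\<in>UNIV. g k *\<^sub>R axis k 1)) (at t)"
  proof (intro has_vector_derivative_sum)
    fix k
    have "((\<lambda>t. f t k) has_vector_derivative g k) (at t)"
      using assms by (simp add: has_real_derivative_iff_has_vector_derivative)
    then show "((\<lambda>t. f t k *\<^sub>R axis k (1::real)) has_vector_derivative g k *\<^sub>R axis k 1) (at t)"
      by (rule bounded_linear.has_vector_derivative[OF bounded_linear_scaleR_left])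
  qed
  moreover have "(\<Sum>k\<in>UNIV. h k *\<^sub>R axis k (1::real)) = (\<chi> k. h k)" for h :: "'n \<Rightarrow> real"
    by (simp add: vec_eq_iff axis_def if_distrib cong: if_cong)
  ultimately show ?thesis by (simp only:)
qed

lemma DERIV_sum_list:
  "(\<And>B. B \<in> set Bs \<Longrightarrow> ((\<lambda>t. f B t) has_real_derivative g B) (at t)) \<Longrightarrow>
   ((\<lambda>t. \<Sum>B\<leftarrow>Bs. f B t) has_real_derivative (\<Sum>B\<leftarrow>Bs. g B)) (at t)"
  by (induction Bs) (auto intro!: DERIV_add)

lemma iter_exp_field_deriv:
  fixes x :: "real^'n::finite"
  shows "((\<lambda>t. iter_exp_field \<alpha> \<delta> js (x + t *\<^sub>R axis l 1) k) has_real_derivative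
     iter_exp_field \<alpha> \<delta> (js @ [l]) x k) (at 0)"
proof -
  let ?c = "\<lambda>n. if n = l then 1 else 0 :: real"
  let ?y = "\<lambda>n. exp (\<delta> n * x $ n)"
  have comp: "(x + t *\<^sub>R axis l 1) $ n = x $ n + t * ?c n" for t n
    by (simp add: axis_def)
  have dy: "((\<lambda>t. exp (\<delta> n * (x + t *\<^sub>R axis l 1) $ n)) has_real_derivative ?c n * (\<delta> n * ?y n)) (at 0)" for n
    unfolding comp by (auto intro!: derivative_eq_intros)
  have dZ: "((\<lambda>t. exp_field \<alpha> \<delta> (x + t *\<^sub>R axis l 1) k) has_real_derivative
      exp_field \<alpha> \<delta> x k * (\<alpha> k l * (\<delta> l * ?y l))) (at 0)"
  proof -
    have "((\<lambda>t. \<Sum>n\<in>UNIV. \<alpha> k n * exp (\<delta> n * (x + t *\<^sub>R axis l 1) $ n)) has_real_derivative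
        (\<Sum>n\<in>UNIV. \<alpha> k n * (?c n * (\<delta> n * ?y n)))) (at 0)"
      by (intro DERIV_sum DERIV_cmult dy)
    moreover have "(\<Sum>n\<in>UNIV. \<alpha> k n * (?c n * (\<delta> n * ?y n))) = \<alpha> k l * (\<delta> l * ?y l)"
      by (simp add: if_distrib[of "\<lambda>u. u * _"] if_distrib[of "\<lambda>u. _ * u"] cong: if_cong)
    ultimately show ?thesis
      unfolding exp_field_def by (auto intro!: DERIV_fun_exp[THEN DERIV_cong])
  qed
  have dB: "((\<lambda>t. \<Prod>n\<in>#B. \<alpha> k n * exp (\<delta> n * (x + t *\<^sub>R axis l 1) $ n)) has_real_derivative
      real (count B l) * \<delta> l * (\<Prod>n\<in>#B. \<alpha> k n * ?y n)) (at 0)" for B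
  proof (induction B)
    case (add n B)
    have "((\<lambda>t. (\<alpha> k n * exp (\<delta> n * (x + t *\<^sub>R axis l 1) $ n)) *
        (\<Prod>n\<in>#B. \<alpha> k n * exp (\<delta> n * (x + t *\<^sub>R axis l 1) $ n))) has_real_derivative
        (\<alpha> k n * (?c n * (\<delta> n * ?y n))) * (\<Prod>n\<in>#B. \<alpha> k n * ?y n) +
        (real (count B l) * \<delta> l * (\<Prod>n\<in>#B. \<alpha> k n * ?y n)) * (\<alpha> k n * ?y n)) (at 0)"
      using DERIV_mult[OF DERIV_cmult[OF dy[of n], of "\<alpha> k n"] add] by simp
    moreover have "(\<alpha> k n * (?c n * (\<delta> n * ?y n))) * (\<Prod>n\<in>#B. \<alpha> k n * ?y n) +
        (real (count B l) * \<delta> l * (\<Prod>n\<in>#B. \<alpha> k n * ?y n)) * (\<alpha> k n * ?y n) =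
        real (count (add_mset n B) l) * \<delta> l * (\<Prod>n\<in>#add_mset n B. \<alpha> k n * ?y n)"
      by (simp add: algebra_simps)
    ultimately show ?case by (simp only: image_mset_add_mset prod_mset.add_mset)
  qed simp
  have "((\<lambda>t. iter_exp_field \<alpha> \<delta> js (x + t *\<^sub>R axis l 1) k) has_real_derivative
      (exp_field \<alpha> \<delta> x k * (\<alpha> k l * (\<delta> l * ?y l))) * (\<Prod>l\<leftarrow>js. \<delta> l) * (\<Sum>B\<leftarrow>blocks js. \<Prod>l\<in>#B. \<alpha> k l * ?y l) +
      (\<Sum>B\<leftarrow>blocks js. real (count B l) * \<delta> l * (\<Prod>n\<in>#B. \<alpha> k n * ?y n)) * (exp_field \<alpha> \<delta> x k * (\<Prod>l\<leftarrow>js. \<delta> l))) (at 0)"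
    unfolding iter_exp_field_def
    using DERIV_mult[OF DERIV_cmult_right[OF dZ, of "\<Prod>l\<leftarrow>js. \<delta> l"] DERIV_sum_list[of "blocks js", OF dB]]
    by simp
  moreover have "(\<Sum>B\<leftarrow>blocks (js @ [l]). f B) =
      (\<Sum>B\<leftarrow>blocks js. f (add_mset l B)) + (\<Sum>B\<leftarrow>blocks js. real (count B l) * f B)" for f :: "'n multiset \<Rightarrow> real"
  proof -
    have "(\<Sum>B\<leftarrow>block_step l Bs. f B) =
      (\<Sum>B\<leftarrow>Bs. f (add_mset l B)) + (\<Sum>B\<leftarrow>Bs. real (count B l) * f B)" for Bs
      by (induction Bs) (simp_all add: block_step_def sum_list_replicate)
    then show ?thesis by (simp add: blocks_snoc)
  qed
  ultimately show ?thesis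
    by (simp add: iter_exp_field_def[of _ _ "js @ [l]"] sum_list_const_mult algebra_simps)
qed

lemma iter_partial_exp_field:
  fixes f :: "real^'n::finite \<Rightarrow> real^'n"
  assumes "f = (\<lambda>x. \<chi> k. exp_field \<alpha> \<delta> x k)"
  shows "iter_partial js f = (\<lambda>x. \<chi> k. iter_exp_field \<alpha> \<delta> js x k)"
proof (induction js rule: rev_induct)
  case Nil
  then show ?case using assms by (simp add: iter_partial_def iter_exp_field_def)
next
  case (snoc l js)
  have "iter_partial (js @ [l]) f = partial l (iter_partial js f)"
    by (simp add: iter_partial_def)
  also have "\<dots> = (\<lambda>x. \<chi> k. iter_exp_field \<alpha> \<delta> (js @ [l]) x k)"
    unfolding snoc partial_def
    by (intro ext vector_derivative_at has_vector_derivative_vec_lambda iter_exp_field_deriv)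
  finally show ?case .
qed

text \<open>A decoration of a tree: the labels of the vertices, and for each vertex the labels of the blocks
  formed by its children.\<close>

type_synonym 'n deco = "rec_tree \<times> (nat \<Rightarrow> 'n) \<times> (nat \<Rightarrow> 'n multiset)"

text \<open>The tree is kept as a component, so that decorations of different trees remain distinct
  when those of all recursive trees of one word are united.\<close>

definition decos :: "rec_tree \<Rightarrow> 'n \<Rightarrow> 'n deco set" where
  "decos = (\<lambda>(w, p) j. SIGMA \<tau>:{(w, p)}. SIGMA \<phi>:labelings (length w) j.
     \<Pi>\<^sub>E v\<in>{1..length w}. set (blocks (map \<phi> (kids (length w) p v))))"

fun deco_cnt :: "'n deco \<Rightarrow> nat" where
  "deco_cnt ((w, p), \<phi>, B) = (\<Prod>v\<in>{1..length w}. count_list (blocks (map \<phi> (kids (length w) p v))) (B v))"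

fun deco_labels :: "'n deco \<Rightarrow> (nat \<times> 'n) multiset" where
  "deco_labels ((w, p), \<phi>, B) = (\<Sum>v\<in>{1..length w}. {#(w ! (v - 1), \<phi> v)#})"

fun deco_blocks :: "'n deco \<Rightarrow> (nat \<times> 'n) multiset" where
  "deco_blocks ((w, p), \<phi>, B) = (\<Sum>v\<in>{1..length w}. {#(w ! (v - 1), k). k \<in># B v#})"

fun deco_A :: "'n deco \<Rightarrow> (nat \<times> 'n \<times> 'n) multiset" where
  "deco_A ((w, p), \<phi>, B) = (\<Sum>v\<in>{1..length w}. {#(w ! (v - 1), \<phi> v, k). k \<in># B v#})"

fun deco_D :: "'n deco \<Rightarrow> (nat \<times> 'n) multiset" where
  "deco_D ((w, p), \<phi>, B) = (\<Sum>v\<in>{1..length w}. {#(w ! (v - 1), \<phi> c). c \<in># mset (kids (length w) p v)#})"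

definition deco_ex :: "'n deco \<Rightarrow> ((nat \<times> 'n \<times> 'n) + (nat \<times> 'n)) multiset" where
  "deco_ex l = image_mset Inl (deco_A l) + image_mset Inr (deco_D l)"

lemma prod_mset_sum: "prod_mset (\<Sum>v\<in>S. X v) = (\<Prod>v\<in>S. prod_mset (X v))"
  by (induction S rule: infinite_finite_induct) auto

lemma sum_mset_sum: "sum_mset (\<Sum>v\<in>S. X v) = (\<Sum>v\<in>S. sum_mset (X v))"
  by (induction S rule: infinite_finite_induct) auto

lemma image_mset_sum_set: "image_mset f (\<Sum>v\<in>S. X v) = (\<Sum>v\<in>S. image_mset f (X v))"
  by (induction S rule: infinite_finite_induct) auto

lemma set_mset_sum_set: "finite S \<Longrightarrow> set_mset (\<Sum>v\<in>S. X v) = (\<Union>v\<in>S. set_mset (X v))"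
  by (induction S rule: finite_induct) auto

lemma sum_mset_eq_sum_count:
  fixes f :: "'a \<Rightarrow> real"
  assumes "finite S" "set_mset X \<subseteq> S"
  shows "(\<Sum>x\<in>#X. f x) = (\<Sum>x\<in>S. real (count X x) * f x)"
  using assms(2)
proof (induction X)
  case (add y X)
  have "(\<Sum>x\<in>S. real (count (add_mset y X) x) * f x) =
      (\<Sum>x\<in>S. real (count X x) * f x + (if x = y then f x else 0))"
    by (intro sum.cong) (auto simp: distrib_right)
  then show ?case using add assms(1) by (simp add: sum.distrib)
qed simp

lemma sum_list_map_eq_sum_count_real:
  "(\<Sum>x\<leftarrow>xs. f x) = (\<Sum>x\<in>set xs. real (count_list xs x) * f x)"
  using sum_mset_eq_sum_count[of "set xs" "mset xs" f]
  by (simp add: count_mset sum_mset_sum_list flip: mset_map)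

text \<open>Linear independence over the rationals, applied to the differences of the
  multiplicities. It lets exponents and growth rates determine the multisets from which they are
  formed.\<close>

lemma alg_independent_sum_mset_inj:
  assumes alg: "alg_independent I a" and X: "set_mset X \<subseteq> I" and Y: "set_mset Y \<subseteq> I"
    and eq: "(\<Sum>v\<in>#X. a v) = (\<Sum>v\<in>#Y. a v)"
  shows "X = Y"
proof (rule multiset_eqI)
  fix v
  let ?K = "set_mset X \<union> set_mset Y \<union> {v}"
  define q :: "_ \<Rightarrow> rat" where "q = (\<lambda>v. of_nat (count X v) - of_nat (count Y v))"
  have sum: "(\<Sum>v\<in>#Z. a v) = (\<Sum>v\<in>?K. real (count Z v) * a v)" if "set_mset Z \<subseteq> ?K" for Z
    using that by (intro sum_mset_eq_sum_count) auto
  show "count X v = count Y v"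
  proof (cases "v \<in> I")
    case True
    have "(\<Sum>k | k \<in> ?K \<and> {#k#} = {#v#}. q k) = 0"
    proof (rule alg_independent_imp_coeff_sum_0[OF alg])
      have "(\<Sum>k\<in>?K. of_rat (q k) * prod_mset (image_mset a {#k#})) =
          (\<Sum>v\<in>#X. a v) - (\<Sum>v\<in>#Y. a v)"
        by (subst (1 2) sum) (auto simp: q_def of_rat_diff left_diff_distrib sum_subtractf)
      then show "(\<Sum>k\<in>?K. of_rat (q k) * prod_mset (image_mset a {#k#})) = 0"
        using eq by simp
    qed (use X Y True in auto)
    moreover have "{k. k \<in> ?K \<and> {#k#} = {#v#}} = {v}" by auto
    ultimately show ?thesis by (simp add: q_def)
  next
    case False
    then have "v \<notin># X" "v \<notin># Y" using X Y by auto
    then show ?thesis by (simp add: not_in_iff)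
  qed
qed

lemma finite_labelings: "finite (labelings m (j :: 'n::finite))"
  unfolding labelings_def by (intro finite_PiE) auto

lemma finite_decos: "finite (decos \<tau> (j :: 'n::finite))"
  unfolding decos_def
  by (auto simp: split_def intro!: finite_SigmaI finite_labelings finite_PiE)

section \<open>The fields of the theorem, restricted to the diagonal\<close>

locale exp_exp_fields =
  fixes d :: nat
    and A D :: "nat \<Rightarrow> real^'n::finite^'n"
    and V :: "nat \<Rightarrow> real^'n \<Rightarrow> real^'n"
  assumes diagonal: "\<And>i j k. i \<in> {1..d} \<Longrightarrow> j \<noteq> k \<Longrightarrow> D i $ j $ k = 0"
    and algebraically_independent: "alg_independent
           (({1..d} \<times> (UNIV :: 'n set) \<times> (UNIV :: 'n set)) <+> ({1..d} \<times> (UNIV :: 'n set)))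
           (case_sum (\<lambda>(i, j, k). A i $ j $ k) (\<lambda>(i, j). D i $ j $ j))"
    and V_eq: "\<And>i x. i \<in> {1..d} \<Longrightarrow> V i x = vexp (A i *v vexp (D i *v x))"
begin

abbreviation \<alpha> :: "nat \<Rightarrow> 'n \<Rightarrow> 'n \<Rightarrow> real" where "\<alpha> i j k \<equiv> A i $ j $ k"
abbreviation \<delta> :: "nat \<Rightarrow> 'n \<Rightarrow> real" where "\<delta> i j \<equiv> D i $ j $ j"

definition coeff :: "(nat \<times> 'n \<times> 'n) + (nat \<times> 'n) \<Rightarrow> real" where
  "coeff = case_sum (\<lambda>(i, j, k). \<alpha> i j k) (\<lambda>(i, j). \<delta> i j)"

lemma coeff_simps [simp]: "coeff (Inl (i, j, k)) = \<alpha> i j k" "coeff (Inr (i, j)) = \<delta> i j"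
  by (simp_all add: coeff_def)

definition growth :: "(nat \<times> 'n) multiset \<Rightarrow> real \<Rightarrow> real" where
  "growth M t = (\<Sum>(i, k)\<in>#M. \<Sum>l\<in>UNIV. \<alpha> i k l * exp (\<delta> i l * t))"

definition exponent :: "(nat \<times> 'n) multiset \<Rightarrow> real" where
  "exponent F = (\<Sum>(i, l)\<in>#F. \<delta> i l)"

definition deco_coeff :: "'n deco \<Rightarrow> real" where
  "deco_coeff l = real (deco_cnt l) * (\<Prod>v\<in>#deco_ex l. coeff v)"

definition deco_fun :: "'n deco \<Rightarrow> real \<Rightarrow> real" where
  "deco_fun l t = exp (growth (deco_labels l) t) * exp (exponent (deco_blocks l) * t)"

lemma V_eq_exp_field: "i \<in> {1..d} \<Longrightarrow> V i = (\<lambda>x. \<chi> k. exp_field (\<alpha> i) (\<delta> i) x k)"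
proof (rule ext)
  fix x assume i: "i \<in> {1..d}"
  have "D i *v x = (\<chi> l. \<delta> i l * x $ l)"
  proof (rule vec_eq_iff[THEN iffD2], rule allI)
    fix l
    have "(\<Sum>k\<in>UNIV. D i $ l $ k * x $ k) = (\<Sum>k\<in>UNIV. if k = l then \<delta> i l * x $ l else 0)"
      using diagonal[OF i] by (intro sum.cong) auto
    then show "(D i *v x) $ l = (\<chi> l. \<delta> i l * x $ l) $ l"
      by (simp add: matrix_vector_mult_def)
  qed
  then show "V i x = (\<chi> k. exp_field (\<alpha> i) (\<delta> i) x k)"
    using i by (simp add: V_eq vexp_def exp_field_def matrix_vector_mult_def)
qed

lemma iter_partial_V:
  "i \<in> {1..d} \<Longrightarrow> iter_partial js (V i) x $ k = iter_exp_field (\<alpha> i) (\<delta> i) js x k"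
  using iter_partial_exp_field[OF V_eq_exp_field] by simp

text \<open>On the diagonal every block with label \<open>k\<close> at a vertex with letter
  \<open>i\<close> contributes \<open>exp (\<delta> i k * t)\<close>. Multiplying out the sums over
  blocks at all vertices therefore leaves terms that depend on \<open>t\<close> through
  \<open>growth\<close> and \<open>exponent\<close> only.\<close>

lemma tree_field_diagonal:
  assumes w: "w \<in> words d m" "m \<ge> 1" and \<tau>: "(w, p) \<in> rec_trees w"
  shows "tree_field V (w, p) (\<chi> _. t) $ j = (\<Sum>l\<in>decos (w, p) j. deco_coeff l * deco_fun l t)"
proof -
  let ?T = "\<lambda>\<phi> B. deco_coeff ((w, p), \<phi>, B) * deco_fun ((w, p), \<phi>, B) t"
  have len: "length w = m" and p: "p \<in> (\<Pi>\<^sub>E l\<in>{2..m}. {1..<l})"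
    using assms by (auto simp: words_def rec_trees_def)
  have letter: "w ! (v - 1) \<in> {1..d}" if "v \<in> {1..m}" for v
    using w that by (auto simp: words_def subset_iff)
  let ?l = "\<lambda>v. w ! (v - 1)"
  let ?js = "\<lambda>\<phi> v. map \<phi> (kids m p v)"
  let ?S = "\<lambda>\<phi>. \<Pi>\<^sub>E v\<in>{1..m}. set (blocks (?js \<phi> v))"
  have "(\<Prod>v\<in>{1..m}. iter_partial (?js \<phi> v) (V (?l v)) (\<chi> _. t) $ \<phi> v) =
      (\<Sum>B\<in>?S \<phi>. ?T \<phi> B)" for \<phi>
  proof -
    let ?Z = "\<lambda>v. exp (\<Sum>l\<in>UNIV. \<alpha> (?l v) (\<phi> v) l * exp (\<delta> (?l v) l * t))"
    let ?d = "\<lambda>v. \<Prod>c\<leftarrow>?js \<phi> v. \<delta> (?l v) c"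
    let ?b = "\<lambda>v B. real (count_list (blocks (?js \<phi> v)) B) * (\<Prod>k\<in>#B. \<alpha> (?l v) (\<phi> v) k * exp (\<delta> (?l v) k * t))"
    have "(\<Prod>v\<in>{1..m}. iter_partial (?js \<phi> v) (V (?l v)) (\<chi> _. t) $ \<phi> v) =
        (\<Prod>v\<in>{1..m}. ?Z v * ?d v * (\<Sum>B\<in>set (blocks (?js \<phi> v)). ?b v B))"
      by (intro prod.cong refl, subst iter_partial_V[OF letter])
        (simp_all add: iter_exp_field_def exp_field_def sum_list_map_eq_sum_count_real)
    also have "\<dots> = (\<Prod>v\<in>{1..m}. ?Z v) * (\<Prod>v\<in>{1..m}. ?d v) *
        (\<Sum>B\<in>?S \<phi>. \<Prod>v\<in>{1..m}. ?b v (B v))"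
      by (simp add: prod.distrib prod_sum_PiE)
    also have "\<dots> = (\<Sum>B\<in>?S \<phi>. (\<Prod>v\<in>{1..m}. ?Z v) * (\<Prod>v\<in>{1..m}. ?d v) * (\<Prod>v\<in>{1..m}. ?b v (B v)))"
      by (rule sum_distrib_left)
    also have "\<dots> = (\<Sum>B\<in>?S \<phi>. ?T \<phi> B)"
    proof (intro sum.cong refl)
      fix B
      have Z: "(\<Prod>v\<in>{1..m}. ?Z v) = exp (growth (deco_labels ((w, p), \<phi>, B)) t)"
        by (simp add: growth_def len image_mset_sum_set sum_mset_sum exp_sum)
      have d: "(\<Prod>v\<in>{1..m}. ?d v) = (\<Prod>v\<in>#image_mset Inr (deco_D ((w, p), \<phi>, B)). coeff v)"
        by (simp add: len image_mset_sum_set prod_mset_sum image_mset.compositionality comp_def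
            prod_mset_prod_list flip: mset_map)
      have "(\<Prod>k\<in>#Y. \<alpha> i x k * exp (\<delta> i k * t)) = (\<Prod>k\<in>#Y. \<alpha> i x k) * exp ((\<Sum>k\<in>#Y. \<delta> i k) * t)" for i x Y
        by (induction Y) (simp_all add: distrib_right exp_add)
      then have "(\<Prod>v\<in>{1..m}. ?b v (B v)) = real (deco_cnt ((w, p), \<phi>, B)) *
          (\<Prod>v\<in>#image_mset Inl (deco_A ((w, p), \<phi>, B)). coeff v) * exp (exponent (deco_blocks ((w, p), \<phi>, B)) * t)"
        by (simp add: len image_mset_sum_set prod_mset_sum sum_mset_sum image_mset.compositionality comp_def
            prod.distrib exponent_def sum_distrib_right exp_sum)
      then show "(\<Prod>v\<in>{1..m}. ?Z v) * (\<Prod>v\<in>{1..m}. ?d v) * (\<Prod>v\<in>{1..m}. ?b v (B v)) =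
          ?T \<phi> B"
        unfolding Z d by (simp only: deco_coeff_def deco_fun_def deco_ex_def image_mset_union
            prod_mset.union mult_ac)
    qed
    finally show ?thesis .
  qed
  then have "tree_field V (w, p) (\<chi> _. t) $ j =
      (\<Sum>\<phi>\<in>labelings m j. \<Sum>B\<in>?S \<phi>. ?T \<phi> B)"
    by (simp add: tree_field_eq_sum_labelings[OF len w(2) p])
  also have "\<dots> = (\<Sum>(\<phi>, B)\<in>(SIGMA \<phi>:labelings m j. ?S \<phi>). ?T \<phi> B)"
    by (rule sum.Sigma) (auto intro!: finite_labelings finite_PiE)
  also have "\<dots> = (\<Sum>l\<in>decos (w, p) j. deco_coeff l * deco_fun l t)"
    by (rule sum.reindex_bij_witness[of _ snd "Pair (w, p)"]) (auto simp: decos_def len)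
  finally show ?thesis .
qed

end

lemmas deco_simps = deco_cnt.simps deco_labels.simps deco_blocks.simps deco_A.simps deco_D.simps
declare deco_simps [simp del]

lemma decosE:
  assumes "l \<in> decos (w, p) j"
  obtains \<phi> B where "l = ((w, p), \<phi>, B)" "\<phi> \<in> labelings (length w) j"
    "\<And>v. v \<in> {1..length w} \<Longrightarrow> B v \<in> set (blocks (map \<phi> (kids (length w) p v)))"
  using assms unfolding decos_def by (auto simp: PiE_iff)

lemma deco_cnt_pos: "l \<in> decos \<tau> j \<Longrightarrow> deco_cnt l > 0"
proof -
  assume l: "l \<in> decos \<tau> j"
  obtain w p where [simp]: "\<tau> = (w, p)" by (cases \<tau>)
  obtain \<phi> B where "l = ((w, p), \<phi>, B)"
    "\<And>v. v \<in> {1..length w} \<Longrightarrow> B v \<in> set (blocks (map \<phi> (kids (length w) p v)))"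
    using l by (auto elim: decosE)
  then show ?thesis
    by (auto simp: deco_simps intro!: prod_pos) (metis count_list_0_iff gr0I)
qed

lemma deco_letters:
  assumes w: "w \<in> words d m" and l: "l \<in> decos (w, p) j"
  shows "set_mset (deco_labels l) \<subseteq> {1..d} \<times> UNIV" "set_mset (deco_blocks l) \<subseteq> {1..d} \<times> UNIV"
    "set_mset (deco_ex l) \<subseteq> ({1..d} \<times> UNIV \<times> UNIV) <+> ({1..d} \<times> UNIV)"
proof -
  obtain \<phi> B where l: "l = ((w, p), \<phi>, B)" using l by (rule decosE)
  have *: "w ! (v - 1) \<in> {1..d}" if "v \<in> {1..length w}" for v
  proof -
    have "w ! (v - 1) \<in> set w" using that by (intro nth_mem) auto
    then show ?thesis using w by (auto simp: words_def)
  qed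
  show "set_mset (deco_labels l) \<subseteq> {1..d} \<times> UNIV" "set_mset (deco_blocks l) \<subseteq> {1..d} \<times> UNIV"
    "set_mset (deco_ex l) \<subseteq> ({1..d} \<times> UNIV \<times> UNIV) <+> ({1..d} \<times> UNIV)"
    unfolding l deco_ex_def deco_simps using * by (fastforce simp: set_mset_sum_set)+
qed

section \<open>Splitting a relation into rows\<close>

context exp_exp_fields
begin

abbreviation "indices \<equiv> ({1..d} \<times> (UNIV :: 'n set) \<times> (UNIV :: 'n set)) <+> ({1..d} \<times> (UNIV :: 'n set))"

lemma alg_independent_coeffs: "alg_independent indices coeff"
  unfolding coeff_def by (rule algebraically_independent)

lemma inj_on_\<delta>: "inj_on (case_prod \<delta>) ({1..d} \<times> UNIV)"
proof (rule inj_onI, clarsimp)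
  fix i k i' k' assume *: "Suc 0 \<le> i" "i \<le> d" "Suc 0 \<le> i'" "i' \<le> d" "\<delta> i k = \<delta> i' k'"
  have "inj_on coeff indices" using alg_independent_coeffs by (simp add: alg_independent_def)
  then have "Inr (i, k) = (Inr (i', k') :: (nat \<times> 'n \<times> 'n) + _)"
    by (rule inj_onD) (use * in auto)
  then show "i = i' \<and> k = k'" by simp
qed

lemma \<delta>_nonzero: "i \<in> {1..d} \<Longrightarrow> \<delta> i k \<noteq> 0"
proof
  assume "i \<in> {1..d}" "\<delta> i k = 0"
  \<comment> \<open>A vanishing entry would have the same sum as the empty multiset.\<close>
  then have "{#Inr (i, k)#} = ({#} :: ((nat \<times> 'n \<times> 'n) + _) multiset)"
    by (intro alg_independent_sum_mset_inj[OF alg_independent_coeffs]) auto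
  then show False by simp
qed

lemma exponent_inj:
  assumes "set_mset F \<subseteq> {1..d} \<times> UNIV" "set_mset F' \<subseteq> {1..d} \<times> UNIV" "exponent F = exponent F'"
  shows "F = F'"
proof -
  have *: "exponent F = (\<Sum>v\<in>#image_mset Inr F. coeff v)" for F
    by (simp add: exponent_def image_mset.compositionality comp_def case_prod_unfold coeff_def)
  have "image_mset Inr F = (image_mset Inr F' :: ((nat \<times> 'n \<times> 'n) + _) multiset)"
    by (rule alg_independent_sum_mset_inj[OF alg_independent_coeffs])
      (use assms in \<open>auto simp: *\<close>)
  then show ?thesis by (rule multiset.inj_map[OF inj_Inr, THEN injD])
qed

abbreviation "exponents \<equiv> case_prod \<delta> ` ({1..d} \<times> UNIV)"

text \<open>The coefficient of \<open>exp (\<delta> i l * t)\<close> in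
  \<open>growth M t\<close>.\<close>

definition growth_coeff :: "(nat \<times> 'n) multiset \<Rightarrow> nat \<Rightarrow> 'n \<Rightarrow> real" where
  "growth_coeff M i l = (\<Sum>(i', k)\<in>#filter_mset (\<lambda>(i', k). i' = i) M. \<alpha> i k l)"

text \<open>For one fixed \<open>l\<close> the numbers \<open>\<alpha> i k l\<close> with varying
  \<open>k\<close> are linearly independent over the rationals, so the coefficient at (i, l) already
  recovers the multiplicities of all pairs (i, k).\<close>

lemma growth_coeff_inj:
  assumes M: "set_mset M \<subseteq> {1..d} \<times> UNIV" "set_mset M' \<subseteq> {1..d} \<times> UNIV" "M \<noteq> M'"
  shows "\<exists>i\<in>{1..d}. \<exists>l. growth_coeff M i l \<noteq> growth_coeff M' i l"
proof (rule ccontr)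
  assume "\<not> ?thesis"
  then have eq: "growth_coeff M i l = growth_coeff M' i l" if "i \<in> {1..d}" for i l
    using that by blast
  obtain ik where ik: "count M ik \<noteq> count M' ik" using M(3) by (meson multiset_eqI)
  obtain i k where [simp]: "ik = (i, k)" by (cases ik)
  have "(i, k) \<in># M \<or> (i, k) \<in># M'" using ik by (metis \<open>ik = (i, k)\<close> not_in_iff)
  then have i: "i \<in> {1..d}" using M by auto
  fix l :: 'n
  let ?g = "\<lambda>M. image_mset (\<lambda>(i', k). Inl (i, k, l)) (filter_mset (\<lambda>(i', k). i' = i) M) :: ((nat \<times> 'n \<times> 'n) + (nat \<times> 'n)) multiset"
  have g: "growth_coeff M i l = (\<Sum>v\<in>#?g M. coeff v)" for M
    by (simp add: growth_coeff_def image_mset.compositionality comp_def case_prod_unfold coeff_def)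
  have "?g M = ?g M'"
    by (rule alg_independent_sum_mset_inj[OF alg_independent_coeffs])
      (use eq[OF i, of l] M i in \<open>auto simp: g\<close>)
  moreover have "count (?g M) (Inl (i, k, l)) = count M (i, k)" for M
    by (induction M) auto
  ultimately show False using ik by (metis \<open>ik = (i, k)\<close>)
qed

text \<open>An \<open>expsum\<close> is indexed by its exponents. Different pairs (i, l) have
  different \<open>\<delta> i l\<close>, so \<open>inv_into\<close> recovers the pair from the
  exponent.\<close>

lemma growth_eq_expsum:
  assumes "set_mset M \<subseteq> {1..d} \<times> UNIV"
  shows "growth M = expsum exponents
     (\<lambda>s. case inv_into ({1..d} \<times> UNIV) (case_prod \<delta>) s of (i, l) \<Rightarrow> growth_coeff M i l)"
proof
  fix t
  have "growth M t = (\<Sum>(i, l)\<in>{1..d} \<times> UNIV. growth_coeff M i l * exp (\<delta> i l * t))"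
    using assms
  proof (induction M)
    case (add ik M)
    obtain i k where [simp]: "ik = (i, k)" by (cases ik)
    have "growth (add_mset ik M) t = (\<Sum>l\<in>UNIV. \<alpha> i k l * exp (\<delta> i l * t)) + growth M t"
      by (simp add: growth_def)
    also have "(\<Sum>l\<in>UNIV. \<alpha> i k l * exp (\<delta> i l * t)) =
        (\<Sum>i'\<in>{1..d}. if i' = i then \<Sum>l\<in>UNIV. \<alpha> i k l * exp (\<delta> i l * t) else 0)"
      using add.prems by simp
    also have "\<dots> = (\<Sum>i'\<in>{1..d}. \<Sum>l\<in>UNIV. (if i' = i then \<alpha> i k l else 0) * exp (\<delta> i' l * t))"
      by (intro sum.cong) auto
    also have "\<dots> = (\<Sum>(i', l)\<in>{1..d} \<times> UNIV. (if i' = i then \<alpha> i k l else 0) * exp (\<delta> i' l * t))"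
      by (rule sum.cartesian_product)
    also have "growth M t = (\<Sum>(i, l)\<in>{1..d} \<times> UNIV. growth_coeff M i l * exp (\<delta> i l * t))"
      using add by simp
    finally show ?case
      by (simp add: growth_coeff_def case_prod_unfold algebra_simps flip: sum.distrib)
        (intro sum.cong, auto simp: algebra_simps)
  qed (simp add: growth_def growth_coeff_def)
  also have "\<dots> = expsum exponents
     (\<lambda>s. case inv_into ({1..d} \<times> UNIV) (case_prod \<delta>) s of (i, l) \<Rightarrow> growth_coeff M i l) t"
    unfolding expsum_def
    by (subst sum.reindex[OF inj_on_\<delta>])
      (auto intro!: sum.cong simp: inv_into_f_f[OF inj_on_\<delta>, of "(_, _)", simplified])
  finally show "growth M t = \<dots>" .
qed

text \<open>Two separations. Different label multisets have different growths, so
  \<open>exp_expsum_independent\<close> leaves for each of them an exponential sum that vanishes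
  identically; in it different block multisets have different exponents, so its coefficients vanish
  one by one.\<close>

lemma deco_relation_coefficients:
  assumes T: "finite T" "\<And>\<tau>. \<tau> \<in> T \<Longrightarrow> finite (Lab \<tau>)"
    and letters: "\<And>\<tau> l. \<tau> \<in> T \<Longrightarrow> l \<in> Lab \<tau> \<Longrightarrow> set_mset (deco_labels l) \<subseteq> {1..d} \<times> UNIV"
      "\<And>\<tau> l. \<tau> \<in> T \<Longrightarrow> l \<in> Lab \<tau> \<Longrightarrow> set_mset (deco_blocks l) \<subseteq> {1..d} \<times> UNIV"
    and rel: "\<And>t. (\<Sum>\<tau>\<in>T. c \<tau> * (\<Sum>l\<in>Lab \<tau>. deco_coeff l * deco_fun l t)) = 0"
  shows "(\<Sum>\<tau>\<in>T. c \<tau> * (\<Sum>l | l \<in> Lab \<tau> \<and> (deco_labels l, deco_blocks l) = r. deco_coeff l)) = 0"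
proof -
  obtain M F where r: "r = (M, F)" by (cases r)
  define K where "K = Sigma T Lab"
  define u where "u = (\<lambda>(\<tau>, l). c \<tau> * deco_coeff l)"
  define L where "L = (\<lambda>k. deco_labels (snd k)) ` K"
  define p where "p = (\<lambda>M t. \<Sum>k | k \<in> K \<and> deco_labels (snd k) = M. u k * exp (exponent (deco_blocks (snd k)) * t))"
  have K: "finite K" unfolding K_def using T by auto
  have Kl: "set_mset (deco_labels (snd k)) \<subseteq> {1..d} \<times> UNIV"
    "set_mset (deco_blocks (snd k)) \<subseteq> {1..d} \<times> UNIV" if "k \<in> K" for k
    using letters[of "fst k" "snd k"] that by (cases k; simp add: K_def)+
  have L: "finite L" using K by (simp add: L_def)
  have LM: "set_mset M \<subseteq> {1..d} \<times> UNIV" if "M \<in> L" for M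
  proof -
    obtain k where "k \<in> K" "M = deco_labels (snd k)" using \<open>M \<in> L\<close> by (auto simp: L_def)
    then show ?thesis using Kl by simp
  qed
  have "\<forall>M\<in>L. \<forall>t. p M t = 0"
  proof (rule exp_expsum_independent[OF L])
    let ?\<beta> = "\<lambda>M s. case inv_into ({1..d} \<times> UNIV) (case_prod \<delta>) s of (i, l) \<Rightarrow> growth_coeff M i l"
    show "finite exponents" by simp
    show "0 \<notin> exponents" using \<delta>_nonzero by force
    show "\<exists>s\<in>exponents. ?\<beta> M s \<noteq> ?\<beta> M' s" if MM: "M \<in> L" "M' \<in> L" "M \<noteq> M'" for M M'
    proof -
      obtain i l where il: "i \<in> {1..d}" "growth_coeff M i l \<noteq> growth_coeff M' i l"
        using growth_coeff_inj[OF LM[OF MM(1)] LM[OF MM(2)] MM(3)] by blast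
      have "inv_into ({1..d} \<times> UNIV) (case_prod \<delta>) (\<delta> i l) = (i, l)"
        using inv_into_f_f[OF inj_on_\<delta>, of "(i, l)"] il by simp
      then show ?thesis using il by (intro bexI[of _ "\<delta> i l"]) force+
    qed
    show "p M \<in> expsums" for M
      unfolding p_def using K by (intro expsums_sum expsums_monomial) simp
    show "(\<Sum>M\<in>L. p M t * exp (expsum exponents (?\<beta> M) t)) = 0" for t
    proof -
      have "(\<Sum>M\<in>L. p M t * exp (expsum exponents (?\<beta> M) t)) = (\<Sum>M\<in>L. p M t * exp (growth M t))"
        by (intro sum.cong refl) (simp add: growth_eq_expsum[OF LM])
      also have "\<dots> = (\<Sum>M\<in>L. \<Sum>k | k \<in> K \<and> deco_labels (snd k) = M. u k * deco_fun (snd k) t)"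
        unfolding p_def sum_distrib_right by (intro sum.cong refl) (auto simp: deco_fun_def)
      also have "\<dots> = (\<Sum>k\<in>K. u k * deco_fun (snd k) t)"
        unfolding L_def by (rule sum.group[OF K]) (use K in auto)
      also have "\<dots> = (\<Sum>\<tau>\<in>T. c \<tau> * (\<Sum>l\<in>Lab \<tau>. deco_coeff l * deco_fun l t))"
        unfolding K_def u_def sum_distrib_left using T
        by (subst sum.Sigma) (auto simp: case_prod_unfold mult.assoc)
      finally show ?thesis using rel by simp
    qed
  qed
  then have pM: "p M t = 0" for t
  proof (cases "M \<in> L")
    case False
    then have "{k. k \<in> K \<and> deco_labels (snd k) = M} = {}" by (auto simp only: L_def)
    then show ?thesis by (simp only: p_def sum.empty)
  qed blast
  have "(\<Sum>\<tau>\<in>T. c \<tau> * (\<Sum>l | l \<in> Lab \<tau> \<and> (deco_labels l, deco_blocks l) = r. deco_coeff l)) =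
      (\<Sum>\<tau>\<in>T. \<Sum>l\<in>Lab \<tau>. if (deco_labels l, deco_blocks l) = r then u (\<tau>, l) else 0)"
    using T by (intro sum.cong refl) (simp add: u_def sum_distrib_left sum.inter_filter if_distrib cong: if_cong)
  also have "\<dots> = (\<Sum>k\<in>K. if (deco_labels (snd k), deco_blocks (snd k)) = r then u k else 0)"
    unfolding K_def using T by (subst sum.Sigma) (auto simp: case_prod_unfold cong: if_cong)
  also have "\<dots> = (\<Sum>k | k \<in> K \<and> deco_labels (snd k) = M \<and> deco_blocks (snd k) = F. u k)"
    using K by (simp add: r sum.inter_filter)
  also have "\<dots> = 0"
  proof (cases "\<exists>k\<in>K. deco_labels (snd k) = M \<and> deco_blocks (snd k) = F")
    case True
    then obtain k where "k \<in> K" "deco_blocks (snd k) = F" by blast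
    then have F: "set_mset F \<subseteq> {1..d} \<times> UNIV" using Kl by blast
    let ?K = "{k \<in> K. deco_labels (snd k) = M}"
    let ?e = "\<lambda>k. exponent (deco_blocks (snd k))"
    have "p M t = expsum (?e ` ?K) (\<lambda>\<mu>. \<Sum>k | k \<in> ?K \<and> ?e k = \<mu>. u k) t" for t
    proof -
      have "expsum (?e ` ?K) (\<lambda>\<mu>. \<Sum>k | k \<in> ?K \<and> ?e k = \<mu>. u k) t =
          (\<Sum>\<mu>\<in>?e ` ?K. \<Sum>k | k \<in> ?K \<and> ?e k = \<mu>. u k * exp (?e k * t))"
        unfolding expsum_def sum_distrib_right by (intro sum.cong refl) auto
      also have "\<dots> = (\<Sum>k\<in>?K. u k * exp (?e k * t))"
        by (rule sum.group) (use K in auto)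
      finally show ?thesis by (simp add: p_def)
    qed
    then have z: "expsum (?e ` ?K) (\<lambda>\<mu>. \<Sum>k | k \<in> ?K \<and> ?e k = \<mu>. u k) t = 0" for t
      using pM by simp
    have "finite (?e ` ?K)" using K by simp
    moreover have "exponent F \<in> ?e ` ?K" using True by (force simp only: image_iff mem_Collect_eq)
    ultimately have "(\<Sum>k | k \<in> ?K \<and> ?e k = exponent F. u k) = 0"
      using expsum_eq_0_imp_coeff_0[OF _ z] by blast
    moreover have "{k. k \<in> ?K \<and> ?e k = exponent F} =
        {k. k \<in> K \<and> deco_labels (snd k) = M \<and> deco_blocks (snd k) = F}"
      using exponent_inj[OF Kl(2) F] by blast
    ultimately show ?thesis by simp
  next
    case False
    then show ?thesis by (intro sum.neutral) auto
  qed
  finally show ?thesis .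
qed

text \<open>Rows are pairs of a label multiset and a block multiset. Of the equation between total
  exponents only the \<alpha>-part is handed on to \<open>unique\<close>; it is extracted by
  \<open>proj\<close>, which drops the variables \<delta>.\<close>

lemma independent_if_unique_deco:
  assumes T: "finite T"
    and Lab: "\<And>\<tau> l. \<tau> \<in> T \<Longrightarrow> l \<in> Lab \<tau> \<Longrightarrow> \<exists>w p. w \<in> words d m \<and> l \<in> decos (w, p) j"
      "\<And>\<tau>. \<tau> \<in> T \<Longrightarrow> finite (Lab \<tau>)"
    and can: "\<And>\<tau>. \<tau> \<in> T \<Longrightarrow> can \<tau> \<in> Lab \<tau>"
    and unique: "\<And>\<pi> g \<tau>. \<pi> permutes T \<Longrightarrow> (\<And>\<tau>. \<tau> \<in> T \<Longrightarrow> g \<tau> \<in> Lab (\<pi> \<tau>)) \<Longrightarrow>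
        (\<And>\<tau>. \<tau> \<in> T \<Longrightarrow> deco_labels (g \<tau>) = deco_labels (can \<tau>) \<and> deco_blocks (g \<tau>) = deco_blocks (can \<tau>)) \<Longrightarrow>
        (\<Sum>\<tau>\<in>T. deco_A (g \<tau>)) = (\<Sum>\<tau>\<in>T. deco_A (can \<tau>)) \<Longrightarrow> \<tau> \<in> T \<Longrightarrow> \<pi> \<tau> = \<tau>"
    and rel: "\<And>t. (\<Sum>\<tau>\<in>T. c \<tau> * (\<Sum>l\<in>Lab \<tau>. deco_coeff l * deco_fun l t)) = 0"
    and \<tau>: "\<tau> \<in> T"
  shows "c \<tau> = 0"
proof (rule independent_if_unique_monomial[OF alg_independent_coeffs T Lab(2), where ex = deco_ex and can = can
      and cnt = deco_cnt and cls = "\<lambda>l. (deco_labels l, deco_blocks l)"])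
  show "set_mset (deco_ex l) \<subseteq> indices" if \<tau>l: "\<tau> \<in> T" "l \<in> Lab \<tau>" for \<tau> l
  proof -
    obtain w p where "w \<in> words d m" "l \<in> decos (w, p) j" using Lab(1)[OF \<tau>l] by blast
    then show ?thesis by (rule deco_letters(3))
  qed
  show "can \<tau> \<in> Lab \<tau>" "deco_cnt (can \<tau>) > 0" if "\<tau> \<in> T" for \<tau>
    using can[OF that] Lab(1)[OF that can[OF that]] by (auto dest: deco_cnt_pos)
  show "(\<Sum>\<tau>\<in>T. c \<tau> * (\<Sum>l | l \<in> Lab \<tau> \<and> (deco_labels l, deco_blocks l) = r.
      real (deco_cnt l) * prod_mset (image_mset coeff (deco_ex l)))) = 0" for r
  proof -
    have "set_mset (deco_labels l) \<subseteq> {1..d} \<times> UNIV" "set_mset (deco_blocks l) \<subseteq> {1..d} \<times> UNIV"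
      if \<tau>l: "\<tau> \<in> T" "l \<in> Lab \<tau>" for \<tau> l
    proof -
      obtain w p where "w \<in> words d m" "l \<in> decos (w, p) j" using Lab(1)[OF \<tau>l] by blast
      then show "set_mset (deco_labels l) \<subseteq> {1..d} \<times> UNIV" "set_mset (deco_blocks l) \<subseteq> {1..d} \<times> UNIV"
        by (rule deco_letters(1,2))+
    qed
    from deco_relation_coefficients[where r = r, OF T Lab(2) this rel]
    show ?thesis unfolding deco_coeff_def .
  qed
  show "\<pi> \<tau> = \<tau>" if "\<pi> permutes T" "\<And>\<tau>. \<tau> \<in> T \<Longrightarrow> g \<tau> \<in> Lab (\<pi> \<tau>)"
    "\<And>\<tau>. \<tau> \<in> T \<Longrightarrow> (deco_labels (g \<tau>), deco_blocks (g \<tau>)) = (deco_labels (can \<tau>), deco_blocks (can \<tau>))"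
    "(\<Sum>\<tau>\<in>T. deco_ex (g \<tau>)) = (\<Sum>\<tau>\<in>T. deco_ex (can \<tau>))" "\<tau> \<in> T" for \<pi> g \<tau>
  proof (rule unique[OF that(1,2)])
    define proj where "proj = (\<lambda>X :: ((nat \<times> 'n \<times> 'n) + (nat \<times> 'n)) multiset. image_mset projl (filter_mset isl X))"
    have "proj (image_mset Inl X) = X" "proj (image_mset Inr Y) = {#}" for X Y
      by (induction X) (simp add: proj_def, simp add: proj_def, induction Y, simp_all add: proj_def)
    then have "proj (deco_ex l) = deco_A l" for l
      unfolding deco_ex_def by (simp add: proj_def)
    moreover have "proj (\<Sum>\<tau>\<in>T. X \<tau>) = (\<Sum>\<tau>\<in>T. proj (X \<tau>))" for X
      using T by (induction T rule: finite_induct) (auto simp: proj_def)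
    ultimately show "(\<Sum>\<tau>\<in>T. deco_A (g \<tau>)) = (\<Sum>\<tau>\<in>T. deco_A (can \<tau>))"
      using arg_cong[OF that(4), of proj] by simp
  qed (use that in auto)
qed (use \<tau> in auto)

end

section \<open>Iterated operators as sums over recursive trees\<close>

lemma sum_PiE_insert:
  assumes "a \<notin> S"
  shows "sum f (PiE (insert a S) T) = (\<Sum>g\<in>PiE S T. \<Sum>y\<in>T a. f (g(a := y)))"
proof -
  have "sum f (PiE (insert a S) T) = (\<Sum>(g, y)\<in>PiE S T \<times> T a. f (g(a := y)))"
  proof (rule sum.reindex_bij_witness[of _ "\<lambda>(g, y). g(a := y)" "\<lambda>h. (h(a := undefined), h a)"])
    show "(case (h(a := undefined), h a) of (g, y) \<Rightarrow> g(a := y)) = h" for h by simp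
    show "(h(a := undefined), h a) \<in> PiE S T \<times> T a" if "h \<in> PiE (insert a S) T" for h
      using that assms by (auto simp: PiE_iff extensional_def)
    fix b assume b: "b \<in> PiE S T \<times> T a"
    obtain g y where [simp]: "b = (g, y)" by (cases b)
    have "g a = undefined" using b assms by (auto simp: PiE_iff extensional_def)
    then show "((case b of (g, y) \<Rightarrow> g(a := y))(a := undefined), (case b of (g, y) \<Rightarrow> g(a := y)) a) = b"
      by (simp add: fun_upd_idem)
    show "(case b of (g, y) \<Rightarrow> g(a := y)) \<in> PiE (insert a S) T"
      using b by (auto simp: PiE_iff extensional_def)
  qed simp
  then show ?thesis by (simp add: sum.cartesian_product)
qed

lemma sum_labelings_Suc:
  assumes "m \<ge> 1"
  shows "sum f (labelings (Suc m) j) = (\<Sum>\<phi>\<in>labelings m j. \<Sum>k\<in>UNIV. f (\<phi>(Suc m := k)))"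
proof -
  have "{1..Suc m} = insert (Suc m) {1..m}" by auto
  then show ?thesis using assms by (simp add: labelings_def sum_PiE_insert)
qed

lemma sum_singleton_times: "sum g ({v} \<times> P) = (\<Sum>p\<in>P. g (v, p))"
  by (rule sum.reindex_bij_witness[of _ "Pair v" snd]) auto

text \<open>Removing the last vertex, which is a leaf, leaves a recursive tree, and its parent may
  be any of the other vertices.\<close>

lemma sum_rec_trees_snoc:
  assumes "w \<noteq> []"
  shows "sum f (rec_trees (w @ [i])) =
    (\<Sum>(w, p)\<in>rec_trees w. \<Sum>u\<in>{1..length w}. f (w @ [i], p(Suc (length w) := u)))"
proof -
  let ?m = "length w"
  have "?m \<ge> 1" using assms by (cases w) auto
  then have ins: "{2..Suc ?m} = insert (Suc ?m) {2..?m}" by auto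
  have "sum f (rec_trees (w @ [i])) = (\<Sum>p\<in>PiE (insert (Suc ?m) {2..?m}) (\<lambda>l. {1..<l}). f (w @ [i], p))"
    by (simp add: rec_trees_def ins sum_singleton_times)
  also have "\<dots> = (\<Sum>p\<in>PiE {2..?m} (\<lambda>l. {1..<l}). \<Sum>u\<in>{1..<Suc ?m}. f (w @ [i], p(Suc ?m := u)))"
    by (rule sum_PiE_insert) simp
  also have "\<dots> = (\<Sum>(w, p)\<in>rec_trees w. \<Sum>u\<in>{1..length w}. f (w @ [i], p(Suc (length w) := u)))"
    by (simp add: rec_trees_def sum_singleton_times atLeastLessThanSuc_atLeastAtMost)
  finally show ?thesis .
qed

text \<open>The new vertex has the largest number and hence comes last among its siblings, which
  corresponds to the derivative that is taken last.\<close>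

lemma kids_graft:
  assumes "v \<in> {1..Suc m}" "p \<in> (\<Pi>\<^sub>E l\<in>{2..m}. {1..<l})" "u \<in> {1..m}"
  shows "kids (Suc m) (p(Suc m := u)) v =
    (if v = Suc m then [] else kids m p v @ (if v = u then [Suc m] else []))"
proof (cases "v = Suc m")
  case False
  then have "[v + 1..<Suc m + 1] = [v + 1..<m + 1] @ [Suc m]" using assms by auto
  moreover have "filter (\<lambda>k. (p(Suc m := u)) k = v) [v + 1..<m + 1] = filter (\<lambda>k. p k = v) [v + 1..<m + 1]"
    by (intro filter_cong) auto
  ultimately show ?thesis using False by (simp add: kids_def)
qed (simp add: kids_def)

context exp_exp_fields
begin

lemma partial_eq: "((\<lambda>t. F (x + t *\<^sub>R axis k 1)) has_real_derivative y) (at 0) \<Longrightarrow> partial k F x = y"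
  unfolding partial_def
  by (intro vector_derivative_at) (simp add: has_real_derivative_iff_has_vector_derivative)

text \<open>Differentiating a factor of a tree-like field in direction \<open>k\<close> amounts to attaching a new last
  vertex with label \<open>k\<close> to the corresponding vertex.\<close>

lemma letter_op_tree_fields:
  assumes w: "w \<in> words d m" "m \<ge> 1" and i: "i \<in> {1..d}"
  shows "letter_op V i (\<lambda>x. \<Sum>\<tau>\<in>rec_trees w. tree_field V \<tau> x $ j) x =
    (\<Sum>\<tau>\<in>rec_trees (w @ [i]). tree_field V \<tau> x $ j)"
proof -
  have len: "length w = m" and letters: "set w \<subseteq> {1..d}" using w by (auto simp: words_def)
  have letter: "w ! (v - 1) \<in> {1..d}" if "v \<in> {1..m}" for v
    using letters len that by (auto simp: subset_iff)
  \<comment> \<open>The factor of the vertex \<open>v\<close> after further derivatives in the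
    directions \<open>js\<close>.\<close>
  define J where "J = (\<lambda>p \<phi> js v x. iter_exp_field (\<alpha> (w ! (v - 1))) (\<delta> (w ! (v - 1))) (map \<phi> (kids m p v) @ js) x (\<phi> v))"
  let ?P = "\<lambda>p \<phi> k u. J p \<phi> [k] u x * (\<Prod>v\<in>{1..m} - {u}. J p \<phi> [] v x)"
  have expand: "tree_field V (w, p) x $ j = (\<Sum>\<phi>\<in>labelings m j. \<Prod>v\<in>{1..m}. J p \<phi> [] v x)"
    if "(w, p) \<in> rec_trees w" for p x
    unfolding J_def using that w(2) letter
    by (subst tree_field_eq_sum_labelings[OF len]) (auto simp: rec_trees_def len iter_partial_V)
  \<comment> \<open>Product rule: \<open>u\<close> is the vertex whose factor is differentiated and
    becomes the parent of the new vertex.\<close>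
  have deriv: "partial k (\<lambda>x. \<Sum>\<tau>\<in>rec_trees w. tree_field V \<tau> x $ j) x =
    (\<Sum>(w, p)\<in>rec_trees w. \<Sum>\<phi>\<in>labelings m j. \<Sum>u\<in>{1..m}. ?P p \<phi> k u)" for k
  proof (rule partial_eq)
    have "((\<lambda>t. \<Sum>\<tau>\<in>rec_trees w. tree_field V \<tau> (x + t *\<^sub>R axis k 1) $ j) has_real_derivative
      (\<Sum>\<tau>\<in>rec_trees w. \<Sum>\<phi>\<in>labelings m j. \<Sum>u\<in>{1..m}. ?P (snd \<tau>) \<phi> k u)) (at 0)"
    proof (intro DERIV_sum)
      fix \<tau> assume \<tau>: "\<tau> \<in> rec_trees w"
      obtain p where [simp]: "\<tau> = (w, p)" using \<tau> by (auto simp: rec_trees_def)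
      have dJ: "((\<lambda>t. J p \<phi> [] v (x + t *\<^sub>R axis k 1)) has_real_derivative J p \<phi> [k] v x) (at 0)" for \<phi> v
        unfolding J_def append_Nil2 by (rule iter_exp_field_deriv)
      have "((\<lambda>t. \<Sum>\<phi>\<in>labelings m j. \<Prod>v\<in>{1..m}. J p \<phi> [] v (x + t *\<^sub>R axis k 1)) has_real_derivative
          (\<Sum>\<phi>\<in>labelings m j. \<Sum>u\<in>{1..m}. ?P p \<phi> k u)) (at 0)"
      proof (intro DERIV_sum)
        fix \<phi>
        show "((\<lambda>t. \<Prod>v\<in>{1..m}. J p \<phi> [] v (x + t *\<^sub>R axis k 1)) has_real_derivative
            (\<Sum>u\<in>{1..m}. ?P p \<phi> k u)) (at 0)"
          using has_field_derivative_prod[of "{1..m}" "\<lambda>v t. J p \<phi> [] v (x + t *\<^sub>R axis k 1)"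
              "\<lambda>v. J p \<phi> [k] v x" 0, OF dJ] by simp
      qed
      then show "((\<lambda>t. tree_field V \<tau> (x + t *\<^sub>R axis k 1) $ j) has_real_derivative
          (\<Sum>\<phi>\<in>labelings m j. \<Sum>u\<in>{1..m}. ?P (snd \<tau>) \<phi> k u)) (at 0)"
        using \<tau> by (simp add: expand)
    qed
    moreover have "(\<Sum>\<tau>\<in>rec_trees w. \<Sum>\<phi>\<in>labelings m j. \<Sum>u\<in>{1..m}. ?P (snd \<tau>) \<phi> k u) =
      (\<Sum>(w, p)\<in>rec_trees w. \<Sum>\<phi>\<in>labelings m j. \<Sum>u\<in>{1..m}. ?P p \<phi> k u)"
      by (simp add: case_prod_unfold)
    ultimately show "((\<lambda>t. \<Sum>\<tau>\<in>rec_trees w. tree_field V \<tau> (x + t *\<^sub>R axis k 1) $ j) has_real_derivative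
      (\<Sum>(w, p)\<in>rec_trees w. \<Sum>\<phi>\<in>labelings m j. \<Sum>u\<in>{1..m}. ?P p \<phi> k u)) (at 0)"
      by (simp only:)
  qed
  have graft: "tree_field V (w @ [i], p(Suc m := u)) x $ j =
      (\<Sum>\<phi>\<in>labelings m j. \<Sum>k\<in>UNIV. ?P p \<phi> k u * V i x $ k)"
    if p: "(w, p) \<in> rec_trees w" and u: "u \<in> {1..m}" for p u
  proof -
    let ?p = "p(Suc m := u)"
    have p: "p \<in> (\<Pi>\<^sub>E l\<in>{2..m}. {1..<l})" using p by (auto simp: rec_trees_def len)
    have p': "?p \<in> (\<Pi>\<^sub>E l\<in>{2..Suc m}. {1..<l})"
      using p u by (auto simp: PiE_iff extensional_def)
    have "tree_field V (w @ [i], ?p) x $ j = (\<Sum>\<phi>\<in>labelings m j. \<Sum>k\<in>UNIV. \<Prod>v\<in>{1..Suc m}.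
        iter_partial (map (\<phi>(Suc m := k)) (kids (Suc m) ?p v)) (V ((w @ [i]) ! (v - 1))) x $ (\<phi>(Suc m := k)) v)"
    proof -
      have len': "length (w @ [i]) = Suc m" "1 \<le> Suc m" by (simp_all add: len)
      show ?thesis
        by (subst tree_field_eq_sum_labelings[OF len' p']) (rule sum_labelings_Suc[OF w(2)])
    qed
    also have "\<dots> = (\<Sum>\<phi>\<in>labelings m j. \<Sum>k\<in>UNIV. ?P p \<phi> k u * V i x $ k)"
    proof (intro sum.cong refl)
      fix \<phi> k
      let ?G = "\<lambda>v. iter_partial (map (\<phi>(Suc m := k)) (kids (Suc m) ?p v)) (V ((w @ [i]) ! (v - 1))) x $ (\<phi>(Suc m := k)) v"
      have G: "?G v = J p \<phi> (if v = u then [k] else []) v x" if v: "v \<in> {1..m}" for v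
      proof -
        have "Suc m \<notin> set (kids m p v)" by (simp add: kids_def)
        then have "map (\<phi>(Suc m := k)) (kids (Suc m) ?p v) = map \<phi> (kids m p v) @ (if v = u then [k] else [])"
          using v p u by (subst kids_graft) auto
        moreover have "(w @ [i]) ! (v - 1) = w ! (v - 1)" "(\<phi>(Suc m := k)) v = \<phi> v"
          using v len by (auto simp: nth_append)
        ultimately show ?thesis
          unfolding J_def by (simp only: iter_partial_V[OF letter[OF v]])
      qed
      have last: "?G (Suc m) = V i x $ k"
        using p u by (subst kids_graft) (auto simp: iter_partial_def nth_append len)
      have "(\<Prod>v\<in>{1..Suc m}. ?G v) = (\<Prod>v\<in>{1..m}. ?G v) * ?G (Suc m)"
        by (simp add: prod.nat_ivl_Suc')
      also have "(\<Prod>v\<in>{1..m}. ?G v) = (\<Prod>v\<in>{1..m}. J p \<phi> (if v = u then [k] else []) v x)"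
        by (intro prod.cong refl G)
      also have "\<dots> = ?P p \<phi> k u"
        using u by (subst prod.remove[of _ u]) auto
      finally show "(\<Prod>v\<in>{1..Suc m}. ?G v) = ?P p \<phi> k u * V i x $ k"
        by (simp only: last)
    qed
    finally show ?thesis .
  qed
  have "letter_op V i (\<lambda>x. \<Sum>\<tau>\<in>rec_trees w. tree_field V \<tau> x $ j) x =
      (\<Sum>k\<in>UNIV. (\<Sum>\<tau>\<in>rec_trees w. \<Sum>\<phi>\<in>labelings m j. \<Sum>u\<in>{1..m}. ?P (snd \<tau>) \<phi> k u) * V i x $ k)"
    by (simp add: letter_op_def gradient_def inner_vec_def deriv case_prod_unfold)
  also have "\<dots> = (\<Sum>\<tau>\<in>rec_trees w. \<Sum>u\<in>{1..m}. \<Sum>\<phi>\<in>labelings m j. \<Sum>k\<in>UNIV.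
      ?P (snd \<tau>) \<phi> k u * V i x $ k)"
    unfolding sum_distrib_right
    by (subst sum.swap, intro sum.cong refl, subst sum.swap, subst (2) sum.swap, intro sum.cong refl, rule sum.swap)
  also have "\<dots> = (\<Sum>(w, p)\<in>rec_trees w. \<Sum>u\<in>{1..length w}. tree_field V (w @ [i], p(Suc (length w) := u)) x $ j)"
    using graft by (intro sum.cong refl) (auto simp: rec_trees_def len)
  also have "\<dots> = (\<Sum>\<tau>\<in>rec_trees (w @ [i]). tree_field V \<tau> x $ j)"
    using w by (subst sum_rec_trees_snoc) (auto simp: words_def)
  finally show ?thesis .
qed

text \<open>The gradient of a coordinate function is a unit vector, so the first letter produces a
  component of \<open>V i\<close>, the field of the one-vertex tree; every further letter attaches
  one more vertex in all possible ways.\<close>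

lemma word_op_coordinate:
  assumes "w \<in> words d m" "m \<ge> 1"
  shows "word_op V w (\<lambda>x. x $ j) = (\<lambda>x. \<Sum>\<tau>\<in>rec_trees w. tree_field V \<tau> x $ j)"
  using assms
proof (induction w arbitrary: m rule: rev_induct)
  case (snoc i w)
  have i: "i \<in> {1..d}" and w: "w \<in> words d (length w)" using snoc.prems by (auto simp: words_def)
  show ?case
  proof (cases "w = []")
    case True
    have "partial k (\<lambda>x. x $ j) x = (if k = j then 1 else 0)" for k and x :: "real^'n"
      by (rule partial_eq) (auto simp: axis_def intro!: derivative_eq_intros)
    then have "letter_op V i (\<lambda>x. x $ j) x = V i x $ j" for x
      by (simp add: letter_op_def gradient_def inner_vec_def if_distrib[of "\<lambda>u. u * _"] cong: if_cong)
    moreover have "rec_trees [i] = {([i], \<lambda>_. undefined)}" by (auto simp: rec_trees_def)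
    moreover have "tree_field V ([i], p) x = V i x" for p x
      by (simp add: tree_field_def to_ltree_def subtree.simps iter_partial_def)
    ultimately show ?thesis by (simp add: True word_op_def)
  next
    case False
    then have "length w \<ge> 1" by (cases w) auto
    then show ?thesis
      using snoc.IH[OF w] letter_op_tree_fields[OF w _ i]
      by (intro ext) (simp add: word_op_def)
  qed
qed (auto simp: words_def)

end

section \<open>Breadth-first words of a tree\<close>

definition kidset :: "nat \<Rightarrow> (nat \<Rightarrow> nat) \<Rightarrow> nat \<Rightarrow> nat set" where
  "kidset m p v = {k\<in>{2..m}. p k = v}"

definition parent_map :: "nat \<Rightarrow> (nat \<Rightarrow> nat) \<Rightarrow> bool" where
  "parent_map m p \<longleftrightarrow> m \<ge> 1 \<and> (\<forall>l\<in>{2..m}. p l \<in> {1..<l})"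

lemma finite_kidset [simp]: "finite (kidset m p v)"
  by (simp add: kidset_def)

text \<open>Initial segments of the orders in which a breadth-first search may visit the vertices, the
  order of siblings being arbitrary.\<close>

inductive bfs :: "nat \<Rightarrow> (nat \<Rightarrow> nat) \<Rightarrow> nat list \<Rightarrow> bool" for m p where
  bfs_root: "bfs m p [1]"
| bfs_step: "bfs m p vs \<Longrightarrow> a < length vs \<Longrightarrow> (\<And>a'. a' < a \<Longrightarrow> kidset m p (vs ! a') \<subseteq> set vs) \<Longrightarrow>
    k \<in> kidset m p (vs ! a) \<Longrightarrow> k \<notin> set vs \<Longrightarrow> bfs m p (vs @ [k])"

lemma bfs_basic:
  assumes "bfs m p vs" "m \<ge> 1"
  shows "vs \<noteq> []" "vs ! 0 = 1" "distinct vs" "set vs \<subseteq> {1..m}"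
  using assms by (induction rule: bfs.induct) (auto simp: kidset_def nth_append)

lemma bfs_nth:
  assumes "bfs m p vs" "0 < i" "i < length vs"
  obtains a where "a < i" "\<And>a'. a' < a \<Longrightarrow> kidset m p (vs ! a') \<subseteq> set (take i vs)"
    "vs ! i \<in> kidset m p (vs ! a)"
proof -
  have "\<exists>a<i. (\<forall>a'<a. kidset m p (vs ! a') \<subseteq> set (take i vs)) \<and> vs ! i \<in> kidset m p (vs ! a)"
    using assms
  proof (induction rule: bfs.induct)
    case (bfs_step vs a k)
    show ?case
    proof (cases "i = length vs")
      case True
      then show ?thesis using bfs_step by (auto simp: nth_append intro!: exI[of _ a])
    next
      case False
      then have "i < length vs" using bfs_step.prems by simp
      then obtain a where "a < i" "\<forall>a'<a. kidset m p (vs ! a') \<subseteq> set (take i vs)" "vs ! i \<in> kidset m p (vs ! a)"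
        using bfs_step by blast
      then show ?thesis using \<open>i < length vs\<close> by (auto simp: nth_append intro!: exI[of _ a])
    qed
  qed simp
  then show ?thesis using that by blast
qed

text \<open>The least vertex not yet visited has a visited parent, so some position has a missing
  child; the first such position may be served next.\<close>

lemma bfs_extend:
  assumes p: "parent_map m p" and vs: "bfs m p vs" "length vs < m"
  shows "\<exists>k. bfs m p (vs @ [k])"
proof -
  have m: "m \<ge> 1" using p by (simp add: parent_map_def)
  note basic = bfs_basic[OF vs(1) m]
  have "card (set vs) < card {1..m}" using vs(2) distinct_card[OF basic(3)] by simp
  then have "{1..m} - set vs \<noteq> {}" using card_mono[of "set vs" "{1..m}"] by auto
  define l where "l = Min ({1..m} - set vs)"
  have l: "l \<in> {1..m}" "l \<notin> set vs" and min: "\<And>k. k \<in> {1..m} \<Longrightarrow> k \<notin> set vs \<Longrightarrow> l \<le> k"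
    using Min_in[of "{1..m} - set vs"] \<open>{1..m} - set vs \<noteq> {}\<close> by (auto simp: l_def)
  have "1 \<in> set vs" using basic(1,2) by (metis length_greater_0_conv nth_mem)
  then have "l \<in> {2..m}" using l by (cases "l = 1") auto
  then have pl: "p l \<in> {1..<l}" using p by (simp add: parent_map_def)
  then have "p l \<in> set vs" using min[of "p l"] l by auto
  then obtain a where a: "a < length vs" "vs ! a = p l" by (auto simp: in_set_conv_nth)
  let ?P = "\<lambda>a. a < length vs \<and> \<not> kidset m p (vs ! a) \<subseteq> set vs"
  have "?P a" using a l \<open>l \<in> {2..m}\<close> by (auto simp: kidset_def)
  then have L: "?P (LEAST a. ?P a)" by (rule LeastI)
  then obtain k where k: "k \<in> kidset m p (vs ! (LEAST a. ?P a))" "k \<notin> set vs" by blast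
  have "bfs m p (vs @ [k])"
  proof (rule bfs_step[OF vs(1) _ _ k])
    show "(LEAST a. ?P a) < length vs" using L by blast
    show "kidset m p (vs ! a') \<subseteq> set vs" if "a' < (LEAST a. ?P a)" for a'
      using not_less_Least[OF that] that L by auto
  qed
  then show ?thesis ..
qed

lemma bfs_length_le:
  assumes "bfs m p vs" "m \<ge> 1"
  shows "length vs \<le> m"
  using card_mono[of "{1..m}" "set vs"] bfs_basic[OF assms] distinct_card[of vs] by simp

lemma bfs_extend_full:
  assumes p: "parent_map m p" and vs: "bfs m p vs"
  shows "\<exists>us. bfs m p (vs @ us) \<and> length (vs @ us) = m"
  using vs
proof (induction "m - length vs" arbitrary: vs)
  case 0
  then show ?case using bfs_length_le[of m p vs] p by (intro exI[of _ "[]"]) (auto simp: parent_map_def)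
next
  case (Suc n)
  then have "length vs < m" by simp
  then obtain k where k: "bfs m p (vs @ [k])" using bfs_extend[OF p Suc.prems] by blast
  have "n = m - length (vs @ [k])" using Suc.hyps(2) by simp
  then obtain us where "bfs m p ((vs @ [k]) @ us)" "length ((vs @ [k]) @ us) = m"
    using Suc.hyps(1)[OF _ k] by blast
  then show ?case by (intro exI[of _ "k # us"]) simp
qed

lemma bfs_full_set:
  assumes "bfs m p us" "m \<ge> 1" "length us = m"
  shows "set us = {1..m}"
  using bfs_basic[OF assms(1,2)] assms distinct_card[of us] by (intro card_subset_eq) auto

section \<open>Vertex codes and canonical orders\<close>

definition kid_letters :: "nat list \<Rightarrow> (nat \<Rightarrow> nat) \<Rightarrow> nat \<Rightarrow> nat multiset" where
  "kid_letters w p v = {#w ! (c - 1). c \<in># mset_set (kidset (length w) p v)#}"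

text \<open>A code is equivalent to the letter of the vertex and the letters of its children, the
  data that a row provides. Numbers are used for their linear order, and the children go into the
  first component so that among vertices of equal letter the leaves have the smallest code.\<close>

definition code :: "nat list \<Rightarrow> (nat \<Rightarrow> nat) \<Rightarrow> nat \<Rightarrow> nat" where
  "code w p v = prod_encode (list_encode (sorted_list_of_multiset (kid_letters w p v)), w ! (v - 1))"

lemma kid_letters_empty_iff: "kid_letters w p v = {#} \<longleftrightarrow> kidset (length w) p v = {}"
  by (simp add: kid_letters_def mset_set_empty_iff)

lemma code_eq_iff:
  "code w p v = code w' p' v' \<longleftrightarrow> kid_letters w p v = kid_letters w' p' v' \<and> w ! (v - 1) = w' ! (v' - 1)"
proof -
  have "sorted_list_of_multiset M = sorted_list_of_multiset M' \<longleftrightarrow> M = M'" for M M' :: "nat multiset"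
    by (metis mset_sorted_list_of_multiset)
  then show ?thesis by (simp add: code_def list_encode_eq prod_encode_eq)
qed

text \<open>\<open>list_encode\<close> is 0 for the empty list only, and \<open>prod_encode\<close>
  is strictly increasing in its first component.\<close>

lemma code_leaf_less:
  assumes "kidset (length w) p v = {}" "kidset (length w') p' v' \<noteq> {}" "w ! (v - 1) = w' ! (v' - 1)"
  shows "code w p v < code w' p' v'"
proof -
  have 1: "kid_letters w p v = {#}" using assms by (simp add: kid_letters_empty_iff)
  have "kid_letters w' p' v' \<noteq> {#}" using assms by (simp add: kid_letters_empty_iff)
  then have "sorted_list_of_multiset (kid_letters w' p' v') \<noteq> []"
    by (metis mset.simps(1) mset_sorted_list_of_multiset)
  then have "list_encode (sorted_list_of_multiset (kid_letters w' p' v')) > 0"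
    by (metis list_encode.simps(1) list_encode_eq gr0I)
  then obtain n where n: "list_encode (sorted_list_of_multiset (kid_letters w' p' v')) = Suc n"
    by (metis gr0_implies_Suc)
  have "triangle x \<le> triangle (n + x)" for x by (induction n) auto
  then have "triangle (w ! (v - 1)) \<le> triangle (n + w ! (v - 1))" .
  then show ?thesis using assms(3) by (simp add: code_def 1 n prod_encode_def)
qed

lemma card_filter_eq_count_image:
  assumes "finite X"
  shows "card {x\<in>X. f x = c} = count (image_mset f (mset_set X)) c"
proof -
  have "f -` {c} \<inter> X = {x\<in>X. f x = c}" by auto
  then show ?thesis using assms by (simp add: count_image_mset)
qed

lemma take_mono_list: "xs \<le> ys \<Longrightarrow> take b xs \<le> take b (ys :: 'a :: linorder list)"
proof (induction xs arbitrary: b ys)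
  case (Cons x xs)
  then show ?case by (cases ys; cases b) (auto simp: less_le)
qed simp

lemma list_less_nth:
  fixes xs ys :: "'a :: linorder list"
  assumes "k < length xs" "k < length ys" "\<And>i. i < k \<Longrightarrow> xs ! i = ys ! i" "xs ! k < ys ! k"
  shows "xs < ys"
  using assms
proof (induction k arbitrary: xs ys)
  case 0
  then show ?case by (cases xs; cases ys) auto
next
  case (Suc k)
  obtain x xs' y ys' where [simp]: "xs = x # xs'" "ys = y # ys'"
    using Suc.prems by (cases xs; cases ys) auto
  have "x = y" using Suc.prems(3)[of 0] by simp
  moreover have "xs' < ys'" using Suc.prems Suc.prems(3)[of "Suc _"] by (intro Suc.IH) auto
  ultimately show ?case by simp
qed

definition canonical :: "nat list \<Rightarrow> (nat \<Rightarrow> nat) \<Rightarrow> nat list \<Rightarrow> bool" where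
  "canonical w p us \<longleftrightarrow> bfs (length w) p us \<and> length us = length w \<and>
     (\<forall>vs. bfs (length w) p vs \<longrightarrow> length vs = length w \<longrightarrow> map (code w p) vs \<le> map (code w p) us)"

lemma canonical_exists:
  assumes p: "parent_map (length w) p"
  shows "\<exists>us. canonical w p us"
proof -
  let ?X = "{us. bfs (length w) p us \<and> length us = length w}"
  have m: "length w \<ge> 1" using p by (simp add: parent_map_def)
  have "finite {us. set us \<subseteq> {1..length w} \<and> length us = length w}"
    by (intro finite_lists_length_eq) simp
  then have fin: "finite ?X" by (rule rev_finite_subset) (use bfs_basic(4) m in auto)
  have "?X \<noteq> {}" using bfs_extend_full[OF p bfs_root] by auto
  then have "Max (map (code w p) ` ?X) \<in> map (code w p) ` ?X" using fin by (intro Max_in) auto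
  then obtain us where "us \<in> ?X" "Max (map (code w p) ` ?X) = map (code w p) us" by blast
  moreover have "map (code w p) vs \<le> Max (map (code w p) ` ?X)" if "vs \<in> ?X" for vs
    using fin that by (intro Max_ge) auto
  ultimately show ?thesis by (auto simp: canonical_def)
qed

text \<open>Positions start at 0 and vertices at 1: the root is the vertex 1 at position 0.\<close>

definition position :: "nat list \<Rightarrow> nat \<Rightarrow> nat" where
  "position us = inv_into {..<length us} ((!) us)"

lemma position_nth: "distinct us \<Longrightarrow> i < length us \<Longrightarrow> position us (us ! i) = i"
  unfolding position_def by (intro inv_into_f_f) (auto simp: inj_on_def nth_eq_iff_index_eq)

lemma nth_position:
  assumes "v \<in> set us"
  shows "us ! position us v = v" "position us v < length us"
proof -
  have v: "v \<in> (!) us ` {..<length us}" using assms by (auto simp: in_set_conv_nth)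
  show "us ! position us v = v"
    unfolding position_def by (rule f_inv_into_f[OF v])
  show "position us v < length us"
    unfolding position_def using inv_into_into[OF v] by simp
qed

definition parent_pos :: "(nat \<Rightarrow> nat) \<Rightarrow> nat list \<Rightarrow> nat \<Rightarrow> nat" where
  "parent_pos p us i = position us (p (us ! i))"

definition internal_pos :: "nat \<Rightarrow> (nat \<Rightarrow> nat) \<Rightarrow> nat list \<Rightarrow> nat set" where
  "internal_pos m p us = {i. i < m \<and> kidset m p (us ! i) \<noteq> {}}"

section \<open>Positions of parents, and comparison with a second tree\<close>

locale full_bfs =
  fixes m :: nat and p :: "nat \<Rightarrow> nat" and us :: "nat list"
  assumes tree: "parent_map m p" and us: "bfs m p us" "length us = m"
begin

abbreviation "par \<equiv> parent_pos p us"
abbreviation "S \<equiv> internal_pos m p us"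

lemma m1: "m \<ge> 1"
  using tree by (simp add: parent_map_def)

lemmas us_set = bfs_full_set[OF us(1) m1 us(2)]
  and us_distinct = bfs_basic(3)[OF us(1) m1]
  and us0 = bfs_basic(2)[OF us(1) m1]

lemma parE:
  assumes "0 < i" "i < m"
  shows "par i < i" "p (us ! i) = us ! par i" "us ! i \<in> {2..m}" "us ! i \<in> kidset m p (us ! par i)"
    "\<And>a'. a' < par i \<Longrightarrow> kidset m p (us ! a') \<subseteq> set (take i us)" "par i \<in> S"
proof -
  obtain a where a: "a < i" "\<And>a'. a' < a \<Longrightarrow> kidset m p (us ! a') \<subseteq> set (take i us)"
    "us ! i \<in> kidset m p (us ! a)"
    using bfs_nth[OF us(1) assms(1)] assms us(2) by blast
  have "par i = a"
    unfolding parent_pos_def using a assms us(2) us_distinct by (simp add: kidset_def position_nth)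
  then show "par i < i" "p (us ! i) = us ! par i" "us ! i \<in> {2..m}" "us ! i \<in> kidset m p (us ! par i)"
    "\<And>a'. a' < par i \<Longrightarrow> kidset m p (us ! a') \<subseteq> set (take i us)" "par i \<in> S"
    using a assms by (auto simp: kidset_def internal_pos_def)
qed

text \<open>A child stands at a later position than its parent, so the last position
  \<open>m - 1\<close> is never internal.\<close>

lemma S_less:
  assumes "i \<in> S"
  shows "i < m - 1"
proof -
  obtain k where k: "k \<in> kidset m p (us ! i)" "i < m" using assms by (auto simp: internal_pos_def)
  then have "k \<in> set us" by (auto simp: us_set kidset_def)
  then obtain i' where i': "i' < m" "us ! i' = k" using us(2) by (auto simp: in_set_conv_nth)
  have "i' > 0" using k i' us0 by (cases i') (auto simp: kidset_def)
  then have "par i' = i"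
    using k i' us us_distinct by (simp add: parent_pos_def kidset_def position_nth)
  then show ?thesis using parE(1)[OF \<open>i' > 0\<close>] i' by simp
qed

lemma zero_in_S: "m \<ge> 2 \<Longrightarrow> 0 \<in> S"
  using parE(1,6)[of 1] by simp

end

text \<open>The second tree \<open>(w', p')\<close> is the one whose decoration reproduces the row
  of \<open>(w, p)\<close>. There \<open>binv i\<close> will be the internal vertex opening the
  block with label \<open>e i\<close>, and \<open>par' i\<close> the index of the block that
  contains \<open>binv i\<close>. Leaves open no block and are outside the range of
  \<open>binv\<close>.\<close>

locale bfs_comparison = full_bfs m p us for m p us +
  fixes w w' :: "nat list" and p' :: "nat \<Rightarrow> nat" and binv par' :: "nat \<Rightarrow> nat"
  assumes len: "length w = m" "length w' = m" and tree': "parent_map m p'"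
    and binv: "bij_betw binv S {v\<in>{1..m}. kidset m p' v \<noteq> {}}"
    and root: "code w' p' 1 = code w p 1" "0 \<in> S \<Longrightarrow> binv 0 = 1"
    and code_binv: "\<And>i. i \<in> S \<Longrightarrow> code w' p' (binv i) = code w p (us ! i)"
    and par': "\<And>i. i \<in> S \<Longrightarrow> 0 < i \<Longrightarrow> par' i \<in> S \<and> par' i < i \<and> p' (binv i) = binv (par' i)"
begin

text \<open>\<open>vs\<close> imitates the first \<open>k\<close> positions of \<open>us\<close> in
  the second tree. Internal vertices are prescribed by \<open>binv\<close>, whereas a leaf may be
  any vertex with the right code and parent.\<close>

definition matches :: "nat \<Rightarrow> nat list \<Rightarrow> bool" where
  "matches k vs \<longleftrightarrow> bfs m p' vs \<and> length vs = k \<and> (\<forall>i<k. code w' p' (vs ! i) = code w p (us ! i)) \<and>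
     (\<forall>i<k. i \<in> S \<longrightarrow> vs ! i = binv i) \<and> (\<forall>i. 0 < i \<longrightarrow> i < k \<longrightarrow> p' (vs ! i) = vs ! par i)"

text \<open>Equal codes give equally many children with letter \<open>c\<close> in total, and the
  children already placed correspond to the same positions \<open>I\<close>, because letters and
  parent positions agree.\<close>

lemma matches_unplaced:
  assumes k: "matches k vs" "k < m" and b: "b < k"
  shows "card {x\<in>kidset m p' (vs ! b) - set vs. w' ! (x - 1) = c} =
    card {x\<in>kidset m p (us ! b) - set (take k us). w ! (x - 1) = c}"
proof -
  let ?P' = "{x\<in>kidset m p' (vs ! b) \<inter> set vs. w' ! (x - 1) = c}"
    and ?P = "{x\<in>kidset m p (us ! b) \<inter> set (take k us). w ! (x - 1) = c}"
  have vs: "bfs m p' vs" "length vs = k" and code: "\<And>i. i < k \<Longrightarrow> code w' p' (vs ! i) = code w p (us ! i)"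
    and par: "\<And>i. 0 < i \<Longrightarrow> i < k \<Longrightarrow> p' (vs ! i) = vs ! par i"
    using k(1) by (auto simp: matches_def)
  note basic = bfs_basic[OF vs(1) m1]
  define I where "I = {i. 0 < i \<and> i < k \<and> par i = b \<and> w ! (us ! i - 1) = c}"
  have letter: "w' ! (vs ! i - 1) = w ! (us ! i - 1)" if "i < k" for i
    using code[OF that] by (simp add: code_eq_iff)
  have 1: "?P' = (!) vs ` I"
  proof (intro equalityI subsetI)
    fix x assume x: "x \<in> ?P'"
    then obtain i where i: "i < k" "x = vs ! i" using vs(2) by (auto simp: in_set_conv_nth)
    have "i > 0" using x i basic(2) by (cases i) (auto simp: kidset_def)
    then have "vs ! par i = vs ! b" using par[of i] x i by (simp add: kidset_def)
    moreover have "par i < k" using parE(1)[of i] \<open>i > 0\<close> i k(2) by simp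
    ultimately have "par i = b" using basic(3) vs(2) b by (simp add: nth_eq_iff_index_eq)
    then have "i \<in> I" using x i \<open>i > 0\<close> letter[of i] by (simp add: I_def)
    then show "x \<in> (!) vs ` I" using i by blast
  next
    fix x assume "x \<in> (!) vs ` I"
    then obtain i where i: "0 < i" "i < k" "par i = b" "w ! (us ! i - 1) = c" "x = vs ! i"
      by (auto simp: I_def)
    have "vs ! i \<noteq> vs ! 0" using basic(3) vs(2) i by (simp add: nth_eq_iff_index_eq)
    moreover have "vs ! i \<in> {1..m}" using basic(4) vs(2) i nth_mem[of i vs] by blast
    ultimately have "vs ! i \<in> {2..m}" using basic(2) by auto
    then show "x \<in> ?P'"
      using par[of i] i vs(2) letter[of i] by (simp add: kidset_def)
  qed
  have 2: "?P = (!) us ` I"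
  proof (intro equalityI subsetI)
    fix x assume x: "x \<in> ?P"
    then obtain i where i: "i < k" "x = us ! i" by (auto simp: in_set_conv_nth)
    have "i > 0" using x i us0 by (cases i) (auto simp: kidset_def)
    then have "par i = b"
      using x i k(2) b us us_distinct by (simp add: parent_pos_def kidset_def position_nth)
    then have "i \<in> I" using x i \<open>i > 0\<close> by (simp add: I_def)
    then show "x \<in> (!) us ` I" using i by blast
  next
    fix x assume "x \<in> (!) us ` I"
    then obtain i where i: "0 < i" "i < k" "par i = b" "w ! (us ! i - 1) = c" "x = us ! i"
      by (auto simp: I_def)
    have "us ! i \<in> set (take k us)"
      using i us(2) k(2) by (auto simp: in_set_conv_nth intro!: exI[of _ i])
    then show "x \<in> ?P"
      using parE(4)[of i] i k(2) by simp
  qed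
  have I: "I \<subseteq> {..<k}" by (auto simp: I_def)
  have "inj_on ((!) vs) I" "inj_on ((!) us) I"
    using I basic(3) vs(2) us_distinct us(2) k(2) by (auto intro!: inj_on_nth)
  then have placed: "card ?P' =
      card ?P"
    unfolding 1 2 by (simp add: card_image)
  have "kid_letters w' p' (vs ! b) = kid_letters w p (us ! b)"
    using code[OF b] by (simp add: code_eq_iff)
  then have all: "card {x\<in>kidset m p' (vs ! b). w' ! (x - 1) = c} = card {x\<in>kidset m p (us ! b). w ! (x - 1) = c}"
    by (simp add: card_filter_eq_count_image kid_letters_def len)
  have split: "card {x\<in>K. P x} = card {x\<in>K - A. P x} + card {x\<in>K \<inter> A. P x}" if "finite K" for K A :: "nat set" and P
  proof -
    have "{x\<in>K. P x} = {x\<in>K - A. P x} \<union> {x\<in>K \<inter> A. P x}" by blast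
    then show ?thesis using that by (subst card_Un_disjoint[symmetric]) auto
  qed
  show ?thesis
    using all placed split[of "kidset m p' (vs ! b)" "\<lambda>x. w' ! (x - 1) = c" "set vs"]
      split[of "kidset m p (us ! b)" "\<lambda>x. w ! (x - 1) = c" "set (take k us)"] by simp
qed

text \<open>In \<open>us\<close> the children of a position before \<open>par k\<close> all stand
  before \<open>k\<close>; by \<open>matches_unplaced\<close> none is missing in \<open>vs\<close>
  either.\<close>

lemma matches_complete:
  assumes k: "matches k vs" "0 < k" "k < m" and a: "a < par k"
  shows "kidset m p' (vs ! a) \<subseteq> set vs"
proof
  fix x assume x: "x \<in> kidset m p' (vs ! a)"
  show "x \<in> set vs"
  proof (rule ccontr)
    assume "x \<notin> set vs"
    have "a < k" using a parE(1)[OF k(2,3)] by simp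
    then have "card {y\<in>kidset m p' (vs ! a) - set vs. w' ! (y - 1) = w' ! (x - 1)} =
      card {y\<in>kidset m p (us ! a) - set (take k us). w ! (y - 1) = w' ! (x - 1)}"
      by (rule matches_unplaced[OF k(1,3)])
    also have "\<dots> = 0" using parE(5)[OF k(2,3) a] by auto
    finally have "{y\<in>kidset m p' (vs ! a) - set vs. w' ! (y - 1) = w' ! (x - 1)} = {}" by simp
    then show False using x \<open>x \<notin> set vs\<close> by blast
  qed
qed

lemma binv_internal: "i \<in> S \<Longrightarrow> binv i \<in> {1..m} \<and> kidset m p' (binv i) \<noteq> {}"
  using bij_betw_apply[OF binv] by simp

lemma binv_not_root: "i \<in> S \<Longrightarrow> 0 < i \<Longrightarrow> binv i \<in> {2..m}"
proof -
  assume i: "i \<in> S" "0 < i"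
  have "m \<ge> 2" using S_less[OF i(1)] i(2) by simp
  then have "0 \<in> S" by (rule zero_in_S)
  have "binv i \<noteq> binv 0"
    using inj_onD[OF bij_betw_imp_inj_on[OF binv] _ i(1) \<open>0 \<in> S\<close>] i(2) by blast
  then have "binv i \<noteq> 1" using root(2)[OF \<open>0 \<in> S\<close>] by simp
  then show "binv i \<in> {2..m}" using binv_internal[OF i(1)] by auto
qed

text \<open>The code shows that a vertex is internal, so a visited \<open>binv k\<close> would stand
  at an internal position \<open>i < k\<close> and equal \<open>binv i\<close>.\<close>

lemma binv_fresh:
  assumes k: "matches k vs" and "k \<in> S"
  shows "binv k \<notin> set vs"
proof
  assume "binv k \<in> set vs"
  then obtain i where i: "i < k" "vs ! i = binv k"
    using k by (auto simp: matches_def in_set_conv_nth)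
  then have "code w p (us ! i) = code w' p' (binv k)" using k by (auto simp: matches_def)
  then have "kid_letters w p (us ! i) = kid_letters w' p' (binv k)" by (simp add: code_eq_iff)
  moreover have "kid_letters w' p' (binv k) \<noteq> {#}"
    using binv_internal[OF assms(2)] by (simp add: kid_letters_empty_iff len)
  ultimately have "kidset m p (us ! i) \<noteq> {}" using kid_letters_empty_iff[of w p "us ! i"] len by metis
  then have "i \<in> S" using i S_less[OF assms(2)] by (simp add: internal_pos_def)
  then have "binv i = binv k" using k i by (auto simp: matches_def)
  then have "i = k" using binv \<open>i \<in> S\<close> assms(2) by (auto simp: bij_betw_def inj_on_def)
  then show False using i by simp
qed

text \<open>An internal position \<open>k\<close> is continued by \<open>binv k\<close>, which has
  the right parent by assumption. At a leaf position some unplaced child with the same letter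
  exists: if it is a leaf, the imitation continues, otherwise its code is larger.\<close>

lemma matches_step:
  assumes k: "matches k vs" "0 < k" "k < m" and par_k: "k \<in> S \<Longrightarrow> par' k = par k"
  shows "(\<exists>v. matches (Suc k) (vs @ [v])) \<or>
    (\<exists>v. bfs m p' (vs @ [v]) \<and> code w p (us ! k) < code w' p' v)"
proof -
  let ?a = "par k"
  have vs: "bfs m p' vs" "length vs = k" using k(1) by (auto simp: matches_def)
  have a: "?a < k" "?a \<in> S" using parE(1,6)[OF k(2,3)] by auto
  have ext: "bfs m p' (vs @ [v])" if "v \<in> kidset m p' (vs ! ?a)" "v \<notin> set vs" for v
    by (rule bfs_step[OF vs(1) _ _ that]) (use a vs matches_complete[OF k] in auto)
  have snoc: "matches (Suc k) (vs @ [v])" if "v \<in> kidset m p' (vs ! ?a)" "v \<notin> set vs"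
    "code w' p' v = code w p (us ! k)" "k \<in> S \<Longrightarrow> v = binv k" for v
    unfolding matches_def
  proof (intro conjI allI impI)
    show "bfs m p' (vs @ [v])" by (rule ext[OF that(1,2)])
    show "length (vs @ [v]) = Suc k" using vs by simp
    fix i
    show "code w' p' ((vs @ [v]) ! i) = code w p (us ! i)" if i: "i < Suc k"
      using k(1) vs(2) i \<open>code w' p' v = _\<close> by (cases "i = k") (auto simp: matches_def nth_append)
    show "(vs @ [v]) ! i = binv i" if i: "i < Suc k" "i \<in> S"
      using k(1) vs(2) i \<open>k \<in> S \<Longrightarrow> v = binv k\<close> by (cases "i = k") (auto simp: matches_def nth_append)
    show "p' ((vs @ [v]) ! i) = (vs @ [v]) ! par i" if i: "0 < i" "i < Suc k"
    proof (cases "i = k")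
      case True
      then show ?thesis using vs(2) a that \<open>v \<in> kidset m p' (vs ! ?a)\<close> by (simp add: nth_append kidset_def)
    next
      case False
      then show ?thesis using k i vs(2) parE(1)[of i] by (auto simp: matches_def nth_append)
    qed
  qed
  show ?thesis
  proof (cases "k \<in> S")
    case True
    have "p' (binv k) = binv ?a" using par'[OF True k(2)] par_k[OF True] by simp
    also have "binv ?a = vs ! ?a" using k(1) a by (auto simp: matches_def)
    finally have "binv k \<in> kidset m p' (vs ! ?a)" using binv_not_root[OF True k(2)] by (simp add: kidset_def)
    then have "matches (Suc k) (vs @ [binv k])"
      using snoc[of "binv k"] binv_fresh[OF k(1) True] code_binv[OF True] by simp
    then show ?thesis by blast
  next
    case False
    have "us ! k \<in> kidset m p (us ! ?a) - set (take k us)"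
      using parE(4)[OF k(2,3)] us_distinct us(2) k(3) by (auto simp: in_set_conv_nth nth_eq_iff_index_eq)
    then have "card {x\<in>kidset m p (us ! ?a) - set (take k us). w ! (x - 1) = w ! (us ! k - 1)} \<noteq> 0"
      by (auto simp: card_eq_0_iff)
    then have "card {x\<in>kidset m p' (vs ! ?a) - set vs. w' ! (x - 1) = w ! (us ! k - 1)} \<noteq> 0"
      using matches_unplaced[OF k(1,3) a(1)] by simp
    then have "{x\<in>kidset m p' (vs ! ?a) - set vs. w' ! (x - 1) = w ! (us ! k - 1)} \<noteq> {}"
      by (metis card.empty)
    then obtain v where v: "v \<in> kidset m p' (vs ! ?a)" "v \<notin> set vs" "w' ! (v - 1) = w ! (us ! k - 1)"
      by blast
    have leaf: "kidset m p (us ! k) = {}" using False k(3) by (simp add: internal_pos_def)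
    show ?thesis
    proof (cases "kidset m p' v = {}")
      case True
      then have "code w' p' v = code w p (us ! k)"
        using leaf v(3) by (simp add: code_eq_iff kid_letters_def len)
      then show ?thesis using snoc[OF v(1,2)] False by blast
    next
      case False
      then have "code w p (us ! k) < code w' p' v"
        using code_leaf_less[of w p "us ! k" w' p' v] leaf v(3) by (simp add: len)
      then show ?thesis using ext[OF v(1,2)] by blast
    qed
  qed
qed

lemma matches_or_greater:
  assumes "1 \<le> b" "b \<le> m" and par: "\<And>i. i \<in> S \<Longrightarrow> 0 < i \<Longrightarrow> i < b \<Longrightarrow> par' i = par i"
  shows "(\<exists>vs. matches b vs) \<or>
    (\<exists>vs k. k < b \<and> bfs m p' vs \<and> length vs = Suc k \<and>
       (\<forall>i<k. code w' p' (vs ! i) = code w p (us ! i)) \<and> code w p (us ! k) < code w' p' (vs ! k))"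
  using assms
proof (induction b)
  case (Suc b)
  show ?case
  proof (cases "b = 0")
    case True
    have "matches 1 [1]"
      using root us0 bfs_root[of m p'] by (auto simp: matches_def)
    then show ?thesis using True by auto
  next
    case False
    consider vs where "matches b vs" | vs k where "k < b" "bfs m p' vs" "length vs = Suc k"
       "\<forall>i<k. code w' p' (vs ! i) = code w p (us ! i)" "code w p (us ! k) < code w' p' (vs ! k)"
      using Suc.IH Suc.prems False by force
    then show ?thesis
    proof cases
      case 1
      consider v where "matches (Suc b) (vs @ [v])" | v where "bfs m p' (vs @ [v])" "code w p (us ! b) < code w' p' v"
        using matches_step[OF 1] False Suc.prems by auto
      then show ?thesis
      proof cases
        case (2 v)
        then show ?thesis using 1
          by (intro disjI2 exI[of _ "vs @ [v]"] exI[of _ b]) (auto simp: matches_def nth_append)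
      qed blast
    next
      case 2
      then show ?thesis by (intro disjI2 exI[of _ vs] exI[of _ k]) auto
    qed
  qed
qed simp

text \<open>Both an imitation and a first deviation upwards extend to a full breadth-first order of
  the second tree, whose word is at most the canonical one. If the prefixes agree, a deviation
  upwards is impossible and an imitation remains.\<close>

lemma canonical_prefix:
  assumes can': "canonical w' p' us'" and b: "1 \<le> b" "b \<le> m"
    and par: "\<And>i. i \<in> S \<Longrightarrow> 0 < i \<Longrightarrow> i < b \<Longrightarrow> par' i = par i"
  shows "take b (map (code w p) us) \<le> take b (map (code w' p') us')"
    and "take b (map (code w p) us) = take b (map (code w' p') us') \<Longrightarrow> \<exists>vs. matches b vs"
proof -
  have us': "bfs m p' us'" "length us' = m" and max: "\<And>vs. bfs m p' vs \<Longrightarrow> length vs = m \<Longrightarrow> map (code w' p') vs \<le> map (code w' p') us'"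
    using can' by (auto simp: canonical_def len)
  have le: "take b (map (code w' p') (vs @ zs)) \<le> take b (map (code w' p') us')"
    if "bfs m p' (vs @ zs)" "length (vs @ zs) = m" for vs zs
    by (rule take_mono_list[OF max[OF that]])
  have greater: "take b (map (code w p) us) < take b (map (code w' p') us')"
    if k: "k < b" "bfs m p' vs" "length vs = Suc k"
       "\<forall>i<k. code w' p' (vs ! i) = code w p (us ! i)" "code w p (us ! k) < code w' p' (vs ! k)" for vs k
  proof -
    obtain zs where zs: "bfs m p' (vs @ zs)" "length (vs @ zs) = m"
      using bfs_extend_full[OF tree' k(2)] by blast
    have "take b (map (code w p) us) < take b (map (code w' p') (vs @ zs))"
    proof (rule list_less_nth[of k])
      show "k < length (take b (map (code w p) us))" "k < length (take b (map (code w' p') (vs @ zs)))"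
        using k(1) b(2) us(2) zs(2) by simp_all
      have nth: "take b (map (code w' p') (vs @ zs)) ! i = code w' p' (vs ! i)"
        "take b (map (code w p) us) ! i = code w p (us ! i)" if "i \<le> k" for i
        using that k(1,3) b(2) us(2) zs(2) by (simp_all add: nth_append)
      show "take b (map (code w p) us) ! i = take b (map (code w' p') (vs @ zs)) ! i" if "i < k" for i
        unfolding nth(1)[OF less_imp_le[OF that]] nth(2)[OF less_imp_le[OF that]] using k(4) that by simp
      show "take b (map (code w p) us) ! k < take b (map (code w' p') (vs @ zs)) ! k"
        unfolding nth(1)[OF order_refl] nth(2)[OF order_refl] by (rule k(5))
    qed
    also note le[OF zs]
    finally show ?thesis .
  qed
  have same: "take b (map (code w p) us) \<le> take b (map (code w' p') us')" if vs: "matches b vs" for vs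
  proof -
    have "bfs m p' vs" "length vs = b" and eq: "\<And>i. i < b \<Longrightarrow> code w' p' (vs ! i) = code w p (us ! i)"
      using vs by (auto simp: matches_def)
    then obtain zs where zs: "bfs m p' (vs @ zs)" "length (vs @ zs) = m"
      using bfs_extend_full[OF tree'] by blast
    have "take b (map (code w p) us) = take b (map (code w' p') (vs @ zs))"
      using eq b us(2) zs(2) \<open>length vs = b\<close> by (intro nth_equalityI) (auto simp: nth_append)
    then show ?thesis using le[OF zs] by simp
  qed
  have cases: "(\<exists>vs. matches b vs) \<or>
    (\<exists>vs k. k < b \<and> bfs m p' vs \<and> length vs = Suc k \<and>
       (\<forall>i<k. code w' p' (vs ! i) = code w p (us ! i)) \<and> code w p (us ! k) < code w' p' (vs ! k))"
    using par by (rule matches_or_greater[OF b])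
  show "take b (map (code w p) us) \<le> take b (map (code w' p') us')"
    using cases
  proof (elim disjE exE conjE)
    fix vs k assume "k < b" "bfs m p' vs" "length vs = Suc k"
       "\<forall>i<k. code w' p' (vs ! i) = code w p (us ! i)" "code w p (us ! k) < code w' p' (vs ! k)"
    then show ?thesis by (rule less_imp_le[OF greater])
  qed (rule same)
  show "\<exists>vs. matches b vs" if "take b (map (code w p) us) = take b (map (code w' p') us')"
    using cases
  proof (elim disjE exE conjE)
    fix vs k assume "k < b" "bfs m p' vs" "length vs = Suc k"
       "\<forall>i<k. code w' p' (vs ! i) = code w p (us ! i)" "code w p (us ! k) < code w' p' (vs ! k)"
    then show ?thesis using greater[of k vs] that by simp
  qed blast
qed

text \<open>With an earlier parent, \<open>binv k\<close> would be a child of a position whose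
  children have all been visited, although it has not been visited itself.\<close>

lemma matches_par_le:
  assumes k: "matches k vs" "0 < k" "k < m" and S: "k \<in> S"
  shows "par k \<le> par' k"
proof (rule ccontr)
  assume "\<not> par k \<le> par' k"
  then have less: "par' k < par k" by simp
  have p': "par' k \<in> S" "par' k < k" "p' (binv k) = binv (par' k)" using par'[OF S k(2)] by auto
  have "binv (par' k) = vs ! par' k" using k(1) p' by (auto simp: matches_def)
  then have "binv k \<in> kidset m p' (vs ! par' k)"
    using p' binv_not_root[OF S k(2)] by (simp add: kidset_def)
  then show False using matches_complete[OF k less] binv_fresh[OF k(1) S] by blast
qed

lemma matches_iso:
  assumes k: "matches m vs"
  shows "tree_iso (w, p) (w', p')"
proof -
  have vs: "bfs m p' vs" "length vs = m" and code: "\<And>i. i < m \<Longrightarrow> code w' p' (vs ! i) = code w p (us ! i)"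
    and par: "\<And>i. 0 < i \<Longrightarrow> i < m \<Longrightarrow> p' (vs ! i) = vs ! par i"
    using k by (auto simp: matches_def)
  note basic = bfs_basic[OF vs(1) m1]
  have vs_set: "set vs = {1..m}" by (rule bfs_full_set[OF vs(1) m1 vs(2)])
  \<comment> \<open>Equal positions in \<open>us\<close> and in its imitation \<open>vs\<close>
    correspond to each other.\<close>
  define \<sigma> where "\<sigma> v = vs ! position us v" for v
  have pos: "us ! position us v = v" "position us v < m" if "v \<in> {1..m}" for v
    using nth_position[of v us] that us_set us(2) by auto
  have "bij_betw \<sigma> {1..m} {1..m}"
  proof -
    have "inj_on \<sigma> {1..m}"
    proof (rule inj_onI)
      fix u v assume "u \<in> {1..m}" "v \<in> {1..m}" "\<sigma> u = \<sigma> v"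
      then have "position us u = position us v"
        using basic(3) vs(2) pos by (simp add: \<sigma>_def nth_eq_iff_index_eq)
      then show "u = v" using pos \<open>u \<in> {1..m}\<close> \<open>v \<in> {1..m}\<close> by metis
    qed
    moreover have "\<sigma> ` {1..m} \<subseteq> {1..m}"
      using vs_set vs(2) pos(2) nth_mem by (fastforce simp: \<sigma>_def)
    ultimately show ?thesis by (simp add: bij_betw_def endo_inj_surj)
  qed
  moreover have "\<sigma> 1 = 1"
  proof -
    have "position us 1 = 0" using position_nth[OF us_distinct, of 0] us0 us(2) m1 by simp
    then show ?thesis using basic(2) by (simp add: \<sigma>_def)
  qed
  moreover have "\<sigma> (p l) = p' (\<sigma> l)" if l: "l \<in> {2..m}" for l
  proof -
    let ?i = "position us l"
    have i: "us ! ?i = l" "?i < m" using pos l by auto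
    have "?i > 0" using i us0 l by (cases ?i) auto
    then have "p' (vs ! ?i) = vs ! par ?i" using par i by simp
    moreover have "par ?i = position us (p l)" using i by (simp add: parent_pos_def)
    ultimately show ?thesis by (simp add: \<sigma>_def)
  qed
  moreover have "w ! (l - 1) = w' ! (\<sigma> l - 1)" if l: "l \<in> {1..m}" for l
    using code[OF pos(2)[OF l]] pos(1)[OF l] by (simp add: \<sigma>_def code_eq_iff)
  ultimately show ?thesis
    unfolding tree_iso_def using len by auto
qed

end

section \<open>Canonical decorations\<close>

lemma sum_singleton_mset: "finite X \<Longrightarrow> (\<Sum>v\<in>X. {#f v#}) = {#f v. v \<in># mset_set X#}"
  by (induction X rule: finite_induct) auto

lemma parent_mapI: "p \<in> (\<Pi>\<^sub>E l\<in>{2..m}. {1..<l}) \<Longrightarrow> m \<ge> 1 \<Longrightarrow> parent_map m p"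
  unfolding parent_map_def by (auto dest: PiE_mem)

lemma set_kids_eq_kidset: "p \<in> (\<Pi>\<^sub>E l\<in>{2..m}. {1..<l}) \<Longrightarrow> v \<ge> 1 \<Longrightarrow> set (kids m p v) = kidset m p v"
  by (simp add: set_kids kidset_def)

lemma deco_set_blocks:
  assumes "((w, p), \<phi>, B) \<in> decos (w, p) j" "p \<in> (\<Pi>\<^sub>E l\<in>{2..length w}. {1..<l})" "v \<in> {1..length w}"
  shows "set_mset (B v) = \<phi> ` kidset (length w) p v"
proof -
  have "B v \<in> set (blocks (map \<phi> (kids (length w) p v)))"
    using assms(1,3) by (auto elim!: decosE)
  then have "set_mset (B v) = set (map \<phi> (kids (length w) p v))" by (rule set_mset_blocks)
  then show ?thesis using assms by (simp add: set_kids_eq_kidset)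
qed

text \<open>Every internal vertex opens at least one block. Summed over all rows, this bound forces
  equality in each of them.\<close>

lemma size_deco_blocks_ge:
  assumes "((w, p), \<phi>, B) \<in> decos (w, p) j" "p \<in> (\<Pi>\<^sub>E l\<in>{2..length w}. {1..<l})"
  shows "card {v\<in>{1..length w}. kidset (length w) p v \<noteq> {}} \<le> size (deco_blocks ((w, p), \<phi>, B))"
proof -
  have "card {v\<in>{1..length w}. kidset (length w) p v \<noteq> {}} =
      (\<Sum>v\<in>{1..length w}. if kidset (length w) p v \<noteq> {} then 1 else 0)"
    by (simp add: sum.inter_filter[symmetric])
  also have "\<dots> \<le> (\<Sum>v\<in>{1..length w}. size (B v))"
  proof (rule sum_mono)
    fix v assume "v \<in> {1..length w}"
    then have "set_mset (B v) = \<phi> ` kidset (length w) p v" by (rule deco_set_blocks[OF assms])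
    then show "(if kidset (length w) p v \<noteq> {} then 1 else 0) \<le> size (B v)"
      by (cases "B v = {#}") (auto simp: Suc_le_eq nonempty_has_size[symmetric])
  qed
  also have "\<dots> = size (deco_blocks ((w, p), \<phi>, B))"
    by (simp add: deco_simps size_multiset_sum)
  finally show ?thesis .
qed

text \<open>A vertex has the label of the block that it belongs to, given by the position of its
  parent. The root belongs to no block and gets \<open>e 0\<close>, a label that it shares with its
  own children.\<close>

definition canonical_deco :: "(nat \<Rightarrow> 'n) \<Rightarrow> nat list \<Rightarrow> (nat \<Rightarrow> nat) \<Rightarrow> nat list \<Rightarrow> 'n deco" where
  "canonical_deco e w p us = ((w, p),
     (\<lambda>v\<in>{1..length w}. if v = 1 then e 0 else e (position us (p v))),
     (\<lambda>v\<in>{1..length w}. if kidset (length w) p v = {} then {#} else {#e (position us v)#}))"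

context full_bfs
begin

definition label_pos :: "nat \<Rightarrow> nat" where
  "label_pos i = (if i = 0 then 0 else par i)"

lemma sum_us: "(\<Sum>v\<in>{1..m}. f v) = (\<Sum>i<m. f (us ! i))"
  using sum.reindex_bij_betw[OF bij_betw_nth[OF us_distinct, of "{..<m}" "{1..m}"], of f] us(2) us_set by simp

lemma position_us: "i < m \<Longrightarrow> position us (us ! i) = i"
  using position_nth[OF us_distinct] us(2) by simp

lemma us_in: "i < m \<Longrightarrow> us ! i \<in> {1..m}"
  using us_set us(2) nth_mem by blast

lemma us_eq_1_iff: "i < m \<Longrightarrow> us ! i = 1 \<longleftrightarrow> i = 0"
  using us0 us_distinct us(2) m1 by (metis nth_eq_iff_index_eq less_le_trans zero_less_one)

lemma finite_S: "finite S"
  by (simp add: internal_pos_def)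

lemma canonical_deco_in_decos:
  assumes w: "length w = m" and p: "p \<in> (\<Pi>\<^sub>E l\<in>{2..m}. {1..<l})"
  shows "canonical_deco e w p us \<in> decos (w, p) (e 0)"
proof -
  let ?\<phi> = "\<lambda>v\<in>{1..m}. if v = 1 then e 0 else e (position us (p v))"
  have "(if kidset m p v = {} then {#} else {#e (position us v)#}) \<in> set (blocks (map ?\<phi> (kids m p v)))"
    if v: "v \<in> {1..m}" for v
  proof (cases "kidset m p v = {}")
    case True
    then have "kids m p v = []" using set_kids_eq_kidset[OF p, of v] v by auto
    then show ?thesis using True by simp
  next
    case False
    have "set (map ?\<phi> (kids m p v)) = ?\<phi> ` kidset m p v" using set_kids_eq_kidset[OF p, of v] v by simp
    also have "\<dots> = (\<lambda>_. e (position us v)) ` kidset m p v"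
      by (rule image_cong) (auto simp: kidset_def)
    also have "\<dots> = {e (position us v)}" using False by auto
    finally have "{#e (position us v)#} \<in> set (blocks (map ?\<phi> (kids m p v)))" by (rule singleton_in_blocks)
    then show ?thesis by (simp only: False if_False)
  qed
  then show ?thesis
    unfolding canonical_deco_def decos_def using w m1 by (auto simp: labelings_def)
qed

context
  fixes w :: "nat list"
  assumes w: "length w = m"
begin

lemma sum_internal: "(\<Sum>i<m. if kidset m p (us ! i) = {} then {#} else {#f i#}) = {#f i. i \<in># mset_set S#}"
proof -
  have "(\<Sum>i<m. if kidset m p (us ! i) = {} then {#} else {#f i#}) = (\<Sum>i\<in>S. {#f i#})"
    by (rule sum.mono_neutral_cong_right) (auto simp: internal_pos_def)
  then show ?thesis by (simp add: sum_singleton_mset finite_S)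
qed

lemma canonical_deco_blocks:
  "deco_blocks (canonical_deco e w p us) = {#(w ! (us ! i - 1), e i). i \<in># mset_set S#}"
proof -
  have "deco_blocks (canonical_deco e w p us) =
      (\<Sum>v\<in>{1..m}. {#(w ! (v - 1), k). k \<in># if kidset m p v = {} then {#} else {#e (position us v)#}#})"
    by (simp add: canonical_deco_def deco_simps w)
  also have "\<dots> = (\<Sum>i<m. if kidset m p (us ! i) = {} then {#} else {#(w ! (us ! i - 1), e i)#})"
    unfolding sum_us by (intro sum.cong refl) (auto simp: position_us)
  finally show ?thesis by (simp only: sum_internal)
qed

lemma canonical_deco_A:
  "deco_A (canonical_deco e w p us) = {#(w ! (us ! i - 1), e (label_pos i), e i). i \<in># mset_set S#}"
proof -
  have "deco_A (canonical_deco e w p us) =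
      (\<Sum>v\<in>{1..m}. {#(w ! (v - 1), if v = 1 then e 0 else e (position us (p v)), k).
         k \<in># if kidset m p v = {} then {#} else {#e (position us v)#}#})"
    by (simp add: canonical_deco_def deco_simps w)
  also have "\<dots> = (\<Sum>i<m. if kidset m p (us ! i) = {} then {#} else {#(w ! (us ! i - 1), e (label_pos i), e i)#})"
    unfolding sum_us
    by (intro sum.cong refl) (use us_eq_1_iff in \<open>auto simp: label_pos_def parent_pos_def position_us\<close>)
  finally show ?thesis by (simp only: sum_internal)
qed

end

lemma card_S: "card S = card {v\<in>{1..m}. kidset m p v \<noteq> {}}"
proof -
  have "(!) us ` S = {v\<in>{1..m}. kidset m p v \<noteq> {}}"
  proof (intro equalityI subsetI)
    fix v assume v: "v \<in> {v\<in>{1..m}. kidset m p v \<noteq> {}}"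
    then obtain i where "i < m" "v = us ! i" using us_set us(2) by (metis (no_types, lifting) in_set_conv_nth mem_Collect_eq)
    then show "v \<in> (!) us ` S" using v by (auto simp: internal_pos_def)
  qed (use us_in in \<open>auto simp: internal_pos_def\<close>)
  moreover have "inj_on ((!) us) S"
    using us_distinct us(2) by (intro inj_on_nth) (auto simp: internal_pos_def)
  ultimately show ?thesis by (metis card_image)
qed

lemma label_pos_le: "i \<in> S \<Longrightarrow> label_pos i < i \<or> (i = 0 \<and> label_pos i = 0)"
  using parE(1)[of i] by (auto simp: label_pos_def internal_pos_def)

end

text \<open>One row: a decoration of \<open>(w', p')\<close> with the labels and blocks of the
  canonical decoration of \<open>(w, p)\<close>. In the application \<open>card_eq\<close> comes
  from summing the bound \<open>size_deco_blocks_ge\<close> over all rows.\<close>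

locale deco_row = full_bfs m p us for m p us +
  fixes e :: "nat \<Rightarrow> 'n" and w w' :: "nat list" and p' :: "nat \<Rightarrow> nat"
    and \<phi> :: "nat \<Rightarrow> 'n" and B :: "nat \<Rightarrow> 'n multiset"
  assumes len: "length w = m" "length w' = m" and p': "p' \<in> (\<Pi>\<^sub>E l\<in>{2..m}. {1..<l})"
    and e: "inj_on e {..<m - 1}"
    and deco: "((w', p'), \<phi>, B) \<in> decos (w', p') (e 0)"
    and labels: "deco_labels ((w', p'), \<phi>, B) = deco_labels (canonical_deco e w p us)"
    and blocks: "deco_blocks ((w', p'), \<phi>, B) = deco_blocks (canonical_deco e w p us)"
    and card_eq: "card {v\<in>{1..m}. kidset m p' v \<noteq> {}} = card S"
begin

abbreviation "g \<equiv> ((w', p'), \<phi>, B)"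

definition internal' :: "nat set" where "internal' = {v\<in>{1..m}. kidset m p' v \<noteq> {}}"

definition block_label :: "nat \<Rightarrow> 'n" where "block_label v = (THE k. B v = {#k#})"

definition binv :: "nat \<Rightarrow> nat" where "binv i = inv_into internal' block_label (e i)"

lemma finite_internal': "finite internal'"
  by (simp add: internal'_def)

lemma \<phi>1: "\<phi> 1 = e 0"
proof -
  have "\<phi> \<in> labelings m (e 0)" using deco by (auto elim!: decosE simp: len)
  then have "\<phi> 1 \<in> (if (1::nat) = 1 then {e 0} else UNIV)"
    unfolding labelings_def by (rule PiE_mem) (use m1 in simp)
  then show ?thesis by simp
qed

lemma set_B: "v \<in> {1..m} \<Longrightarrow> set_mset (B v) = \<phi> ` kidset m p' v"
  using deco_set_blocks[OF deco] p' by (simp add: len)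

text \<open>The number of blocks equals the number of internal vertices, each of which opens at
  least one; so each opens exactly one.\<close>

lemma B_eq:
  assumes "v \<in> {1..m}"
  shows "B v = (if v \<in> internal' then {#block_label v#} else {#})"
proof -
  have "(\<Sum>v\<in>{1..m}. if v \<in> internal' then 1 else 0) = card S"
    using card_eq by (simp add: internal'_def sum.inter_filter[symmetric])
  also have "\<dots> = size (deco_blocks g)"
    unfolding blocks canonical_deco_blocks[OF len(1)] by simp
  also have "\<dots> = (\<Sum>v\<in>{1..m}. size (B v))" by (simp add: deco_simps size_multiset_sum len)
  finally have eq: "(\<Sum>v\<in>{1..m}. if v \<in> internal' then 1 else 0) = (\<Sum>v\<in>{1..m}. size (B v))" .
  have le: "(if v \<in> internal' then 1 else 0) \<le> size (B v)" if "v \<in> {1..m}" for v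
    using set_B[OF that] by (cases "B v = {#}") (auto simp: internal'_def Suc_le_eq nonempty_has_size[symmetric])
  have size: "(if v \<in> internal' then 1 else 0) = size (B v)"
    by (rule sum_mono_inv[OF eq le assms]) simp_all
  show ?thesis
  proof (cases "v \<in> internal'")
    case True
    then have "size (B v) = 1" using size by simp
    then obtain k where "B v = {#k#}" by (metis One_nat_def size_1_singleton_mset)
    then show ?thesis using True by (simp add: block_label_def)
  next
    case False
    then show ?thesis using size by simp
  qed
qed

lemma \<phi>_kid:
  assumes "v \<in> {1..m}" "c \<in> kidset m p' v"
  shows "\<phi> c = block_label v" "v \<in> internal'"
proof -
  show v: "v \<in> internal'" using assms by (auto simp: internal'_def)
  have "\<phi> c \<in> set_mset (B v)" using set_B[OF assms(1)] assms(2) by simp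
  then show "\<phi> c = block_label v" using B_eq[OF assms(1)] v by simp
qed

lemma sum_internal': "(\<Sum>v\<in>{1..m}. {#f v k. k \<in># B v#}) = {#f v (block_label v). v \<in># mset_set internal'#}"
proof -
  have "(\<Sum>v\<in>{1..m}. {#f v k. k \<in># B v#}) = (\<Sum>v\<in>internal'. {#f v (block_label v)#})"
    by (rule sum.mono_neutral_cong_right) (auto simp: B_eq internal'_def)
  then show ?thesis by (simp add: sum_singleton_mset finite_internal')
qed

lemma blocks_eq:
  "{#(w' ! (v - 1), block_label v). v \<in># mset_set internal'#} = {#(w ! (us ! i - 1), e i). i \<in># mset_set S#}"
proof -
  have "deco_blocks g = {#(w' ! (v - 1), block_label v). v \<in># mset_set internal'#}"
    by (simp only: deco_simps len sum_internal')
  then show ?thesis unfolding blocks canonical_deco_blocks[OF len(1)] by (rule sym)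
qed

lemma inj_e_S: "inj_on e S"
  using e by (rule inj_on_subset) (use S_less in auto)

lemma block_label_image: "block_label ` internal' = e ` S"
proof -
  have "snd ` set_mset {#(w' ! (v - 1), block_label v). v \<in># mset_set internal'#} =
      snd ` set_mset {#(w ! (us ! i - 1), e i). i \<in># mset_set S#}" by (simp only: blocks_eq)
  then show ?thesis by (simp add: finite_internal' finite_S image_image)
qed

lemma inj_block_label: "inj_on block_label internal'"
proof (rule eq_card_imp_inj_on[OF finite_internal'])
  show "card (block_label ` internal') = card internal'"
    unfolding block_label_image card_image[OF inj_e_S] by (rule card_eq[folded internal'_def, symmetric])
qed

lemma binv_bij: "bij_betw binv S internal'"
proof -
  have 1: "bij_betw e S (block_label ` internal')"
    unfolding block_label_image by (rule inj_on_imp_bij_betw[OF inj_e_S])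
  have "bij_betw (inv_into internal' block_label) (block_label ` internal') internal'"
    by (rule bij_betw_inv_into[OF inj_on_imp_bij_betw[OF inj_block_label]])
  then have "bij_betw (inv_into internal' block_label \<circ> e) S internal'"
    by (rule bij_betw_trans[OF 1])
  moreover have "binv = inv_into internal' block_label \<circ> e"
    by (simp add: fun_eq_iff binv_def)
  ultimately show ?thesis by simp
qed

lemma binv_mem: "i \<in> S \<Longrightarrow> binv i \<in> internal'"
  using bij_betw_apply[OF binv_bij] .

lemma block_label_binv: "i \<in> S \<Longrightarrow> block_label (binv i) = e i"
  unfolding binv_def by (rule f_inv_into_f) (simp add: block_label_image)

lemma binv_surj:
  assumes "v \<in> internal'"
  obtains i where "i \<in> S" "v = binv i" "block_label v = e i"
  using assms binv_bij block_label_binv by (metis bij_betw_imp_surj_on imageE)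

lemma letter_binv:
  assumes "i \<in> S"
  shows "w' ! (binv i - 1) = w ! (us ! i - 1)"
proof -
  have "(w' ! (binv i - 1), e i) \<in># {#(w' ! (v - 1), block_label v). v \<in># mset_set internal'#}"
    using binv_mem[OF assms] block_label_binv[OF assms] finite_internal' by (force simp: image_iff)
  then obtain i' where "i' \<in> S" "w' ! (binv i - 1) = w ! (us ! i' - 1)" "e i = e i'"
    unfolding blocks_eq using finite_S by auto
  then show ?thesis using inj_onD[OF inj_e_S _ assms] by blast
qed

lemma deco_A_eq: "deco_A g = {#(w ! (us ! i - 1), \<phi> (binv i), e i). i \<in># mset_set S#}"
proof -
  have "deco_A g = {#(w' ! (v - 1), \<phi> v, block_label v). v \<in># mset_set internal'#}"
    by (simp only: deco_simps len sum_internal'[of "\<lambda>v k. (w' ! (v - 1), \<phi> v, k)"])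
  also have "mset_set internal' = image_mset binv (mset_set S)"
    using binv_bij by (simp add: bij_betw_def image_mset_mset_set)
  also have "{#(w' ! (v - 1), \<phi> v, block_label v). v \<in># image_mset binv (mset_set S)#} =
      {#(w' ! (binv i - 1), \<phi> (binv i), block_label (binv i)). i \<in># mset_set S#}"
    by (simp add: image_mset.compositionality comp_def)
  also have "\<dots> = {#(w ! (us ! i - 1), \<phi> (binv i), e i). i \<in># mset_set S#}"
    by (rule image_mset_cong) (use letter_binv block_label_binv finite_S in simp)
  finally show ?thesis .
qed

lemma parent_in:
  assumes "c \<in> {2..m}"
  shows "p' c \<in> {1..m}" "p' c < c" "c \<in> kidset m p' (p' c)"
  using PiE_mem[OF p' assms] assms by (auto simp: kidset_def)

text \<open>The assumption is established only in \<open>canonical_decos_unique\<close>, where the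
  total exponent of all rows is available: it says that every internal vertex has a label seen in
  some canonical decoration next to the same block.\<close>

context
  assumes label_binv: "\<And>i. i \<in> S \<Longrightarrow> \<exists>a. \<phi> (binv i) = e a \<and> (a < i \<or> (i = 0 \<and> a = 0))"
begin

definition par' :: "nat \<Rightarrow> nat" where "par' i = inv_into {..<m - 1} e (\<phi> (binv i))"

text \<open>The label of a vertex other than the root is that of the block opened by its parent,
  hence some \<open>e i'\<close> with parent \<open>binv i'\<close>. A vertex is not its own parent,
  so \<open>i' \<noteq> i\<close>, and \<open>label_binv\<close> leaves only
  \<open>i' < i\<close>.\<close>

lemma par'_cases:
  assumes i: "i \<in> S" and "binv i \<noteq> 1"
  shows "par' i \<in> S" "par' i < i" "p' (binv i) = binv (par' i)" "\<phi> (binv i) = e (par' i)"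
proof -
  have c: "binv i \<in> {2..m}" using binv_mem[OF i] assms(2) by (auto simp: internal'_def)
  note p = parent_in[OF c]
  obtain i' where i': "i' \<in> S" "p' (binv i) = binv i'" "block_label (p' (binv i)) = e i'"
    using binv_surj[OF \<phi>_kid(2)[OF p(1,3)]] by blast
  have \<phi>: "\<phi> (binv i) = e i'" using \<phi>_kid(1)[OF p(1,3)] i' by simp
  have par: "par' i = i'"
    unfolding par'_def \<phi> using S_less[OF i'(1)] by (intro inv_into_f_f[OF e]) simp
  obtain a where a: "\<phi> (binv i) = e a" "a < i \<or> (i = 0 \<and> a = 0)" using label_binv[OF i] by blast
  have "a < m - 1" using a(2) S_less[OF i] by auto
  then have "a = i'" using inj_onD[OF e, of a i'] a \<phi> S_less[OF i'(1)] by simp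
  moreover have "i' \<noteq> i" using p(2) i' by auto
  ultimately show "par' i \<in> S" "par' i < i" "p' (binv i) = binv (par' i)" "\<phi> (binv i) = e (par' i)"
    using a(2) i' par \<phi> by auto
qed

text \<open>If \<open>binv 0\<close> were not the root, its parent would have an index below
  0.\<close>

lemma binv_0: "0 \<in> S \<Longrightarrow> binv 0 = 1"
  using par'_cases(2)[of 0] by auto

lemma binv_ne_1:
  assumes "i \<in> S" "0 < i"
  shows "binv i \<noteq> 1"
proof -
  have "0 \<in> S" using S_less[OF assms(1)] assms(2) by (intro zero_in_S) simp
  then show ?thesis
    using binv_0 inj_onD[OF bij_betw_imp_inj_on[OF binv_bij] _ assms(1), of 0] assms(2) by auto
qed

lemma root_letter: "w' ! 0 = w ! 0"
proof (cases "m \<ge> 2")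
  case True
  then show ?thesis using letter_binv[OF zero_in_S] binv_0[OF zero_in_S] us0 by simp
next
  case False
  then have "m = 1" using m1 by simp
  then have "deco_labels g = {#(w' ! 0, \<phi> 1)#}"
    "deco_labels (canonical_deco e w p us) = {#(w ! 0, e 0)#}"
    by (simp_all add: deco_simps len canonical_deco_def)
  then show ?thesis using labels by simp
qed

text \<open>The children of \<open>binv i\<close> with letter \<open>c\<close> are the vertices with
  the pair (c, e i), and both decorations have equally many of these. The one exception is the root,
  which has the label \<open>e 0\<close> without being a child; its contribution \<open>?r\<close>
  is the same on both sides and cancels.\<close>

lemma kid_letters_binv:
  assumes i: "i \<in> S"
  shows "kid_letters w' p' (binv i) = kid_letters w p (us ! i)"
proof (rule multiset_eqI)
  fix c
  let ?Y = "{v\<in>{1..m}. (w ! (v - 1), if v = 1 then e 0 else e (position us (p v))) = (c, e i)}"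
    and ?Y' = "{v\<in>{1..m}. (w' ! (v - 1), \<phi> v) = (c, e i)}"
    and ?K' = "{v\<in>kidset m p' (binv i). w' ! (v - 1) = c}"
    and ?K = "{v\<in>kidset m p (us ! i). w ! (v - 1) = c}"
  have im: "i < m - 1" by (rule S_less[OF i])
  let ?r = "if i = 0 \<and> w ! 0 = c then {1} else {} :: nat set"
  have v1: "e 0 = e i \<longleftrightarrow> i = 0" using inj_onD[OF e, of 0 i] im by auto
  have set': "?Y' = ?K' \<union> ?r"
  proof (rule set_eqI)
    fix v
    show "v \<in> ?Y' \<longleftrightarrow>
        v \<in> ?K' \<union> ?r"
    proof (cases "v \<in> {2..m}")
      case True
      note p = parent_in[OF True]
      obtain i' where i': "i' \<in> S" "p' v = binv i'" "block_label (p' v) = e i'"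
        using binv_surj[OF \<phi>_kid(2)[OF p(1,3)]] by blast
      have "\<phi> v = e i'" using \<phi>_kid(1)[OF p(1,3)] i' by simp
      then have "\<phi> v = e i \<longleftrightarrow> p' v = binv i"
        using i' inj_onD[OF inj_e_S _ i'(1) i] inj_onD[OF bij_betw_imp_inj_on[OF binv_bij] _ i'(1) i] by auto
      then show ?thesis using True by (auto simp: kidset_def)
    next
      case False
      then show ?thesis using m1 \<phi>1 root_letter v1 by (cases "v = 1") (auto simp: kidset_def)
    qed
  qed
  have set: "?Y =
      ?K \<union> ?r"
  proof (rule set_eqI)
    fix v
    show "v \<in> ?Y \<longleftrightarrow>
        v \<in> ?K \<union> ?r"
    proof (cases "v \<in> {2..m}")
      case True
      then have "v \<in> set us" by (simp add: us_set)
      define j where "j = position us v"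
      have j: "us ! j = v" "j < m" using nth_position[OF \<open>v \<in> set us\<close>] us(2) by (auto simp: j_def)
      have "j > 0" using j True us0 by (cases j) auto
      note pj = parE[OF this j(2)]
      have "position us (p v) = par j" using j by (simp add: parent_pos_def)
      moreover have "e (par j) = e i \<longleftrightarrow> par j = i"
        using inj_onD[OF inj_e_S _ pj(6) i] by auto
      moreover have "p v = us ! i \<longleftrightarrow> par j = i"
      proof
        assume "p v = us ! i"
        then have "us ! par j = us ! i" using pj(2) j by simp
        then show "par j = i" using us_distinct us(2) pj(1) j(2) im by (simp add: nth_eq_iff_index_eq)
      qed (use pj(2) j in simp)
      ultimately show ?thesis using True by (auto simp: kidset_def)
    next
      case False
      then show ?thesis using m1 v1 by (cases "v = 1") (auto simp: kidset_def)
    qed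
  qed
  have cards: "card ?Y' =
      card ?Y"
  proof -
    have "count (deco_labels g) (c, e i) = card ?Y'"
      by (simp only: card_filter_eq_count_image[OF finite_atLeastAtMost] deco_simps len sum_singleton_mset finite_atLeastAtMost)
    moreover have "deco_labels (canonical_deco e w p us) =
        (\<Sum>v\<in>{1..m}. {#(w ! (v - 1), if v = 1 then e 0 else e (position us (p v)))#})"
      by (simp add: canonical_deco_def deco_simps len)
    then have "count (deco_labels (canonical_deco e w p us)) (c, e i) =
        card ?Y"
      by (simp only: card_filter_eq_count_image[OF finite_atLeastAtMost] sum_singleton_mset finite_atLeastAtMost)
    ultimately show ?thesis using labels by simp
  qed
  have un: "card (X \<union> ?r) = card X + card ?r" if "X \<subseteq> {2..m}" for X
    using that finite_subset[OF that] by (intro card_Un_disjoint) auto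
  have sub: "?K' \<subseteq> {2..m}"
    "?K \<subseteq> {2..m}" by (auto simp: kidset_def)
  have "card ?K' = card ?K"
    using cards unfolding set' set un[OF sub(1)] un[OF sub(2)] by (rule add_right_imp_eq)
  then show "count (kid_letters w' p' (binv i)) c = count (kid_letters w p (us ! i)) c"
    by (simp only: kid_letters_def len card_filter_eq_count_image[OF finite_kidset])
qed

lemma code_binv: "i \<in> S \<Longrightarrow> code w' p' (binv i) = code w p (us ! i)"
  using letter_binv[of i] kid_letters_binv[of i] by (simp add: code_eq_iff)

lemma code_root: "code w' p' 1 = code w p 1"
proof (cases "m \<ge> 2")
  case True
  then show ?thesis using code_binv[OF zero_in_S] binv_0[OF zero_in_S] us0 by simp
next
  case False
  then have "kidset m p' 1 = {}" "kidset m p 1 = {}" by (auto simp: kidset_def)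
  then have "kid_letters w' p' 1 = {#}" "kid_letters w p 1 = {#}"
    using kid_letters_empty_iff len by metis+
  then show ?thesis by (simp add: code_eq_iff root_letter)
qed

lemma bfs_comparison: "bfs_comparison m p us w w' p' binv par'"
proof unfold_locales
  show "parent_map m p'" using parent_mapI[OF p' m1] .
  show "bij_betw binv S {v \<in> {1..m}. kidset m p' v \<noteq> {}}" using binv_bij by (simp add: internal'_def)
  show "par' i \<in> S \<and> par' i < i \<and> p' (binv i) = binv (par' i)" if "i \<in> S" "0 < i" for i
    using par'_cases[OF that(1) binv_ne_1[OF that]] by simp
qed (use len code_root binv_0 code_binv in auto)

lemma label_binv_eq: "i \<in> S \<Longrightarrow> \<phi> (binv i) = e (if i = 0 then 0 else par' i)"
  using par'_cases(4) binv_ne_1 binv_0 \<phi>1 by auto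

end

end

text \<open>Along a permutation of a finite set values that never decrease cannot increase either,
  because the sum of the ranks is invariant.\<close>

lemma permutes_mono_eq:
  fixes f :: "'a \<Rightarrow> 'b :: linorder"
  assumes \<pi>: "\<pi> permutes T" and T: "finite T" and le: "\<And>t. t \<in> T \<Longrightarrow> f t \<le> f (\<pi> t)" and t: "t \<in> T"
  shows "f (\<pi> t) = f t"
proof (rule ccontr)
  \<comment> \<open>Ranks replace the values, which cannot be added, by natural numbers.\<close>
  define r where "r t = card {s\<in>T. f s < f t}" for t
  assume "f (\<pi> t) \<noteq> f t"
  then have "f t < f (\<pi> t)" using le[OF t] by simp
  then have "{s\<in>T. f s < f t} \<subset> {s\<in>T. f s < f (\<pi> t)}" using t by force
  then have "r t < r (\<pi> t)" unfolding r_def using T by (intro psubset_card_mono) auto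
  have mono: "r t \<le> r (\<pi> t)" if "t \<in> T" for t
    unfolding r_def using T le[OF that] by (intro card_mono) auto
  have "(\<Sum>t\<in>T. r t) = (\<Sum>t\<in>T. r (\<pi> t))"
    using sum.permute[OF \<pi>, of r] by (simp add: comp_def)
  then have "r t = r (\<pi> t)"
    by (rule sum_mono_inv[OF _ mono t T])
  with \<open>r t < r (\<pi> t)\<close> show False by simp
qed

context bfs_comparison
begin

context
  fixes us' b
  assumes can': "canonical w' p' us'" and b: "1 \<le> b" "b \<le> m"
    and par: "\<And>i. i \<in> S \<Longrightarrow> 0 < i \<Longrightarrow> i < b \<Longrightarrow> par' i = par i"
begin

lemma word_prefix_le: "take b (map (code w p) us) \<le> take b (map (code w' p') us')"
  using par by (rule canonical_prefix(1)[OF can' b])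

lemma par_le:
  assumes "take b (map (code w p) us) = take b (map (code w' p') us')" "b \<in> S"
  shows "par b \<le> par' b"
proof -
  obtain vs where "matches b vs" using canonical_prefix(2)[OF can' b par assms(1)] by blast
  then show ?thesis using matches_par_le[of b vs] b(1) S_less[OF assms(2)] assms(2) by simp
qed

lemma iso_if_words_eq:
  assumes "take b (map (code w p) us) = take b (map (code w' p') us')" "b = m"
  shows "tree_iso (w, p) (w', p')"
  using canonical_prefix(2)[OF can' b par assms(1)] matches_iso assms(2) by blast

end

end

text \<open>Existential form, so that the data can be chosen for all rows simultaneously. The
  condition on the labels remains a premise, since it becomes available only after the rows have
  been combined.\<close>

lemma (in deco_row) row_structure:
  "\<exists>b. deco_A g = {#(w ! (us ! i - 1), \<phi> (b i), e i). i \<in># mset_set S#} \<and>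
     ((\<forall>i\<in>S. \<exists>a. \<phi> (b i) = e a \<and> (a < i \<or> (i = 0 \<and> a = 0))) \<longrightarrow>
      (\<exists>q. bfs_comparison m p us w w' p' b q \<and> (\<forall>i\<in>S. \<phi> (b i) = e (if i = 0 then 0 else q i))))"
proof (rule exI[of _ binv], rule conjI, rule deco_A_eq, rule impI)
  assume "\<forall>i\<in>S. \<exists>a. \<phi> (binv i) = e a \<and> (a < i \<or> (i = 0 \<and> a = 0))"
  then have *: "\<And>i. i \<in> S \<Longrightarrow> \<exists>a. \<phi> (binv i) = e a \<and> (a < i \<or> (i = 0 \<and> a = 0))" by blast
  show "\<exists>q. bfs_comparison m p us w w' p' binv q \<and> (\<forall>i\<in>S. \<phi> (binv i) = e (if i = 0 then 0 else q i))"
    using bfs_comparison[OF *] label_binv_eq[OF *] by blast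
qed

text \<open>If a permutation \<open>\<pi>\<close> and decorations of the trees \<open>\<pi> t\<close> reproduce the canonical rows and the
  total exponent, then the first position at which some parent differs yields a contradiction: the
  prefixes of the canonical words do not decrease along \<open>\<pi>\<close>, hence agree, so parents can only move
  to later positions, while the sum of their positions is preserved.\<close>

lemma canonical_decos_unique:
  fixes T :: "rec_tree set" and us :: "rec_tree \<Rightarrow> nat list" and e :: "nat \<Rightarrow> 'n"
  assumes T: "finite T" and m: "m \<ge> 1" and e: "inj_on e {..<m - 1}"
    and trees: "\<And>t. t \<in> T \<Longrightarrow> length (fst t) = m \<and> snd t \<in> (\<Pi>\<^sub>E l\<in>{2..m}. {1..<l})"
    and can: "\<And>t. t \<in> T \<Longrightarrow> canonical (fst t) (snd t) (us t)"
    and noniso: "\<And>t t'. t \<in> T \<Longrightarrow> t' \<in> T \<Longrightarrow> tree_iso t t' \<Longrightarrow> t = t'"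
    and \<pi>: "\<pi> permutes T" and g: "\<And>t. t \<in> T \<Longrightarrow> g t \<in> decos (\<pi> t) (e 0)"
    and row: "\<And>t. t \<in> T \<Longrightarrow> deco_labels (g t) = deco_labels (canonical_deco e (fst t) (snd t) (us t)) \<and>
        deco_blocks (g t) = deco_blocks (canonical_deco e (fst t) (snd t) (us t))"
    and A: "(\<Sum>t\<in>T. deco_A (g t)) = (\<Sum>t\<in>T. deco_A (canonical_deco e (fst t) (snd t) (us t)))"
    and t: "t \<in> T"
  shows "\<pi> t = t"
proof -
  let ?can = "\<lambda>t. canonical_deco e (fst t) (snd t) (us t)"
  have \<pi>T: "\<pi> t \<in> T" if "t \<in> T" for t using that \<pi> by (simp add: permutes_in_image)
  have fb: "full_bfs m (snd t) (us t)" if "t \<in> T" for t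
    using trees[OF that] can[OF that] m parent_mapI by unfold_locales (auto simp: canonical_def)
  define S where "S = (\<lambda>t. internal_pos m (snd t) (us t))"
  define par where "par = (\<lambda>t. parent_pos (snd t) (us t))"
  define lab where "lab = (\<lambda>t. full_bfs.label_pos (snd t) (us t))"
  have lab_eq: "lab t i = (if i = 0 then 0 else par t i)" if "t \<in> T" for t i
    unfolding lab_def par_def by (rule full_bfs.label_pos_def[OF fb[OF that]])
  have S_less: "i < m - 1" if "t \<in> T" "i \<in> S t" for t i
    using full_bfs.S_less[OF fb[OF that(1)]] that(2) by (simp add: S_def)
  have fin_S: "finite (S t)" if "t \<in> T" for t
    using full_bfs.finite_S[OF fb[OF that]] by (simp add: S_def)
  have lab_le: "lab t i < i \<or> (i = 0 \<and> lab t i = 0)" if "t \<in> T" "i \<in> S t" for t i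
    using full_bfs.label_pos_le[OF fb[OF that(1)]] that(2) by (simp add: S_def lab_def)
  define \<phi> where "\<phi> = (\<lambda>t. fst (snd (g t)))"
  define B where "B = (\<lambda>t. snd (snd (g t)))"
  have g_eq: "g t = ((fst (\<pi> t), snd (\<pi> t)), \<phi> t, B t)" if "t \<in> T" for t
    using g[OF that] unfolding \<phi>_def B_def by (cases "\<pi> t") (auto elim!: decosE)
  define n where "n = (\<lambda>t :: rec_tree. card {v\<in>{1..m}. kidset m (snd t) v \<noteq> {}})"
  have n_S: "card (S t) = n t" if "t \<in> T" for t
    unfolding S_def n_def by (rule full_bfs.card_S[OF fb[OF that]])
  \<comment> \<open>The row of \<open>t\<close> has one block for each internal vertex of
    \<open>t\<close>, and at least one for each internal vertex of \<open>\<pi> t\<close>.\<close>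
  have n_le: "n (\<pi> t) \<le> n t" if "t \<in> T" for t
  proof -
    have "n (\<pi> t) \<le> size (deco_blocks (g t))"
      unfolding n_def g_eq[OF that]
      using size_deco_blocks_ge[of "fst (\<pi> t)" "snd (\<pi> t)"] g[OF that] trees[OF \<pi>T[OF that]]
      by (simp add: g_eq[OF that])
    also have "\<dots> = card (S t)"
      using row[OF that] full_bfs.canonical_deco_blocks[OF fb[OF that], of "fst t" e] trees[OF that]
      by (simp add: S_def)
    finally show ?thesis by (simp add: n_S[OF that])
  qed
  have "(\<Sum>t\<in>T. n (\<pi> t)) = (\<Sum>t\<in>T. n t)"
    using sum.permute[OF \<pi>, of n] by (simp add: comp_def)
  then have n_eq: "n (\<pi> t) = n t" if "t \<in> T" for t
    by (rule sum_mono_inv[OF _ n_le that T])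
  have rows: "deco_row m (snd t) (us t) e (fst t) (fst (\<pi> t)) (snd (\<pi> t)) (\<phi> t) (B t)" if "t \<in> T" for t
  proof -
    interpret full_bfs m "snd t" "us t" by (rule fb[OF that])
    show ?thesis
    proof unfold_locales
      show "card {v \<in> {1..m}. kidset m (snd (\<pi> t)) v \<noteq> {}} = card (internal_pos m (snd t) (us t))"
        using n_eq[OF that] n_S[OF that] by (simp add: n_def S_def)
    qed (use trees[OF that] trees[OF \<pi>T[OF that]] e g[OF that] row[OF that] in \<open>simp_all add: g_eq[OF that]\<close>)
  qed
  have "\<forall>t\<in>T. \<exists>b. deco_A (g t) = {#(fst t ! (us t ! i - 1), \<phi> t (b i), e i). i \<in># mset_set (S t)#} \<and>
     ((\<forall>i\<in>S t. \<exists>a. \<phi> t (b i) = e a \<and> (a < i \<or> (i = 0 \<and> a = 0))) \<longrightarrow>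
      (\<exists>q. bfs_comparison m (snd t) (us t) (fst t) (fst (\<pi> t)) (snd (\<pi> t)) b q \<and>
         (\<forall>i\<in>S t. \<phi> t (b i) = e (if i = 0 then 0 else q i))))"
    using deco_row.row_structure[OF rows] g_eq by (simp add: S_def)
  then obtain b where b: "\<And>t. t \<in> T \<Longrightarrow> deco_A (g t) = {#(fst t ! (us t ! i - 1), \<phi> t (b t i), e i). i \<in># mset_set (S t)#}"
    and b': "\<And>t. t \<in> T \<Longrightarrow> (\<forall>i\<in>S t. \<exists>a. \<phi> t (b t i) = e a \<and> (a < i \<or> (i = 0 \<and> a = 0))) \<Longrightarrow>
      \<exists>q. bfs_comparison m (snd t) (us t) (fst t) (fst (\<pi> t)) (snd (\<pi> t)) (b t) q \<and>
         (\<forall>i\<in>S t. \<phi> t (b t i) = e (if i = 0 then 0 else q i))"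
    by (auto dest!: bchoice)
  have can_A: "deco_A (?can t) =
      {#(fst t ! (us t ! i - 1), e (lab t i), e i). i \<in># mset_set (S t)#}" if "t \<in> T" for t
    using full_bfs.canonical_deco_A[OF fb[OF that], of "fst t" e] trees[OF that] by (simp add: S_def lab_def)
  \<comment> \<open>A triple in the exponent of \<open>g t\<close> occurs in the canonical
    decoration of some \<open>t2\<close>, possibly of another tree. Its last entry
    \<open>e i\<close> determines the position \<open>i\<close>, so its label is that of position
    \<open>i\<close> in the order of \<open>t2\<close>.\<close>
  have label: "\<exists>a. \<phi> t (b t i) = e a \<and> (a < i \<or> (i = 0 \<and> a = 0))" if ti: "t \<in> T" "i \<in> S t" for t i
  proof -
    have "(fst t ! (us t ! i - 1), \<phi> t (b t i), e i) \<in># deco_A (g t)"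
      using b[OF ti(1)] ti fin_S[OF ti(1)] by auto
    then have "(fst t ! (us t ! i - 1), \<phi> t (b t i), e i) \<in># (\<Sum>t\<in>T. deco_A (g t))"
      using ti(1) T by (auto simp: set_mset_sum_set)
    then obtain t2 where t2: "t2 \<in> T" "(fst t ! (us t ! i - 1), \<phi> t (b t i), e i) \<in># deco_A (?can t2)"
      unfolding A using T by (auto simp: set_mset_sum_set)
    then obtain i2 where i2: "i2 \<in> S t2" "\<phi> t (b t i) = e (lab t2 i2)" "e i = e i2"
      unfolding can_A[OF t2(1)] using fin_S[OF t2(1)] by auto
    have "i = i2" using inj_onD[OF e i2(3)] S_less[OF ti] S_less[OF t2(1) i2(1)] by simp
    then show ?thesis using i2 lab_le[OF t2(1) i2(1)] by auto
  qed
  have "\<forall>t\<in>T. \<exists>q. bfs_comparison m (snd t) (us t) (fst t) (fst (\<pi> t)) (snd (\<pi> t)) (b t) q \<and>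
         (\<forall>i\<in>S t. \<phi> t (b t i) = e (if i = 0 then 0 else q i))"
    using b' label by blast
  then obtain q where cmp: "\<And>t. t \<in> T \<Longrightarrow> bfs_comparison m (snd t) (us t) (fst t) (fst (\<pi> t)) (snd (\<pi> t)) (b t) (q t)"
    and q: "\<And>t i. t \<in> T \<Longrightarrow> i \<in> S t \<Longrightarrow> \<phi> t (b t i) = e (if i = 0 then 0 else q t i)"
    by (auto dest!: bchoice)
  have par_lt: "par t i < m - 1" if "t \<in> T" "i \<in> S t" "0 < i" for t i
    using lab_le[OF that(1,2)] lab_eq[OF that(1)] S_less[OF that(1,2)] that(3) by auto
  have q_lt: "q t i < m - 1" if "t \<in> T" "i \<in> S t" "0 < i" for t i
    using bfs_comparison.par'[OF cmp[OF that(1)], of i] that S_less[OF that(1,2)] by (auto simp: S_def)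
  have sums: "(\<Sum>t\<in>T. if k \<in> S t then q t k else 0) = (\<Sum>t\<in>T. if k \<in> S t then par t k else 0)"
    if k: "0 < k" for k
  proof (cases "k < m - 1")
    case True
    \<comment> \<open>Summing \<open>h\<close> over an exponent adds up the parent positions
      recorded in the triples that belong to block \<open>e k\<close>.\<close>
    define h where "h = (\<lambda>(_ :: nat, x, y). if y = e k then inv_into {..<m - 1} e x else 0)"
    have h: "(\<Sum>x\<in>#{#(f i, e (r i), e i). i \<in># mset_set (S t)#}. h x) = (if k \<in> S t then r k else 0)"
      if t: "t \<in> T" and r: "\<And>i. i \<in> S t \<Longrightarrow> 0 < i \<Longrightarrow> r i < m - 1" for f r t
    proof -
      have "(\<Sum>x\<in>#{#(f i, e (r i), e i). i \<in># mset_set (S t)#}. h x) =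
          (\<Sum>i\<in>S t. if e i = e k then inv_into {..<m - 1} e (e (r i)) else 0)"
        by (simp add: sum_unfold_sum_mset image_mset.compositionality comp_def h_def)
      also have "\<dots> = (\<Sum>i\<in>S t. if i = k then r k else 0)"
      proof (intro sum.cong refl)
        fix i assume i: "i \<in> S t"
        have "e i = e k \<longleftrightarrow> i = k" using inj_onD[OF e, of i k] S_less[OF t i] True by auto
        then show "(if e i = e k then inv_into {..<m - 1} e (e (r i)) else 0) = (if i = k then r k else 0)"
          using r[of k] i k inv_into_f_f[OF e, of "r k"] by auto
      qed
      finally show ?thesis using fin_S[OF t] by simp
    qed
    have "(\<Sum>t\<in>T. if k \<in> S t then q t k else 0) = (\<Sum>t\<in>T. \<Sum>x\<in>#deco_A (g t). h x)"
    proof (intro sum.cong refl)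
      fix t assume t: "t \<in> T"
      have "deco_A (g t) = {#(fst t ! (us t ! i - 1), e (if i = 0 then 0 else q t i), e i). i \<in># mset_set (S t)#}"
        unfolding b[OF t] by (rule image_mset_cong) (use q[OF t] fin_S[OF t] in simp)
      then show "(if k \<in> S t then q t k else 0) = (\<Sum>x\<in>#deco_A (g t). h x)"
        using h[OF t, of "\<lambda>i. if i = 0 then 0 else q t i" "\<lambda>i. fst t ! (us t ! i - 1)"] q_lt[OF t] k by simp
    qed
    also have "\<dots> = (\<Sum>t\<in>T. \<Sum>x\<in>#deco_A (?can t). h x)"
      using arg_cong[OF A, of "\<lambda>X. \<Sum>x\<in>#X. h x"] by (simp add: image_mset_sum_set sum_mset_sum)
    also have "\<dots> = (\<Sum>t\<in>T. if k \<in> S t then par t k else 0)"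
    proof (intro sum.cong refl)
      fix t assume t: "t \<in> T"
      show "(\<Sum>x\<in>#deco_A (?can t). h x) = (if k \<in> S t then par t k else 0)"
        unfolding can_A[OF t]
        using h[OF t, of "lab t" "\<lambda>i. fst t ! (us t ! i - 1)"] par_lt[OF t] k by (simp add: lab_eq[OF t])
    qed
    finally show ?thesis .
  next
    case False
    then have "k \<notin> S t" if "t \<in> T" for t using S_less[OF that] by blast
    then show ?thesis by simp
  qed
  have same: "take k (map (code (fst t) (snd t)) (us t)) =
      take k (map (code (fst (\<pi> t)) (snd (\<pi> t))) (us (\<pi> t)))"
    if k: "1 \<le> k" "k \<le> m" and Q: "\<And>t i. t \<in> T \<Longrightarrow> i \<in> S t \<Longrightarrow> 0 < i \<Longrightarrow> i < k \<Longrightarrow> q t i = par t i" and t: "t \<in> T" for k t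
  proof -
    let ?f = "\<lambda>t. take k (map (code (fst t) (snd t)) (us t))"
    have "?f t \<le> ?f (\<pi> t)" if "t \<in> T" for t
      using bfs_comparison.word_prefix_le[OF cmp[OF that] can[OF \<pi>T[OF that]] k] Q[OF that]
      by (simp add: S_def par_def)
    from permutes_mono_eq[where f = ?f, OF \<pi> T this t] show ?thesis by (rule sym)
  qed
  have Q: "\<forall>t\<in>T. \<forall>i\<in>S t. 0 < i \<longrightarrow> i < k \<longrightarrow> q t i = par t i" if "k \<le> m" for k
    using that
  proof (induction k)
    case (Suc k)
    show ?case
    proof (cases "k = 0")
      case False
      then have k: "1 \<le> k" "k \<le> m" using Suc.prems by auto
      have IH: "\<And>t i. t \<in> T \<Longrightarrow> i \<in> S t \<Longrightarrow> 0 < i \<Longrightarrow> i < k \<Longrightarrow> q t i = par t i"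
        using Suc by auto
      have le: "(if k \<in> S t then par t k else 0) \<le> (if k \<in> S t then q t k else 0)" if t: "t \<in> T" for t
        using bfs_comparison.par_le[OF cmp[OF t] can[OF \<pi>T[OF t]] k _ same[OF k IH t]] IH[OF t]
        by (auto simp: S_def par_def)
      have "q t k = par t k" if "t \<in> T" "k \<in> S t" for t
        using sum_mono_inv[OF sums[symmetric] le that(1) T] k(1) that(2) by simp
      then show ?thesis using IH by (auto simp: less_Suc_eq)
    qed simp
  qed simp
  have Qm: "\<And>t i. t \<in> T \<Longrightarrow> i \<in> S t \<Longrightarrow> 0 < i \<Longrightarrow> i < m \<Longrightarrow> q t i = par t i" using Q[of m] by blast
  have "tree_iso (fst t, snd t) (fst (\<pi> t), snd (\<pi> t))"
    using bfs_comparison.iso_if_words_eq[OF cmp[OF t] can[OF \<pi>T[OF t]] m order_refl _ same[OF m order_refl Qm t] refl]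
      Qm[OF t] by (simp add: S_def par_def)
  then show ?thesis using noniso[OF t \<pi>T[OF t]] by simp
qed

section \<open>Chains as rows for the operators\<close>

text \<open>The chain with letters \<open>w\<close>: the vertex \<open>v\<close> opens the block \<open>e (v - 1)\<close>, which consists of the
  vertex \<open>v + 1\<close>. The root has the label \<open>e (m - 2)\<close> of the last block, so that no other vertex with
  children has this label.\<close>

definition chain_parent :: "nat \<Rightarrow> nat \<Rightarrow> nat" where
  "chain_parent m = (\<lambda>l\<in>{2..m}. l - 1)"

definition chain_label :: "(nat \<Rightarrow> 'n) \<Rightarrow> nat \<Rightarrow> nat \<Rightarrow> 'n" where
  "chain_label e m = (\<lambda>v\<in>{1..m}. if v = 1 then e (m - 2) else e (v - 2))"

definition chain_deco :: "(nat \<Rightarrow> 'n) \<Rightarrow> nat list \<Rightarrow> 'n deco" where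
  "chain_deco e w = ((w, chain_parent (length w)), chain_label e (length w),
     (\<lambda>v\<in>{1..length w}. if v < length w then {#e (v - 1)#} else {#}))"

lemma chain_parent_mem: "chain_parent m \<in> (\<Pi>\<^sub>E l\<in>{2..m}. {1..<l})"
  by (auto simp: chain_parent_def)

lemma chain_deco_in_decos:
  assumes "length w \<ge> 1"
  shows "chain_deco e w \<in> decos (w, chain_parent (length w)) (e (length w - 2))"
proof -
  let ?m = "length w"
  have "(if v < ?m then {#e (v - 1)#} else {#}) \<in>
      set (blocks (map (chain_label e ?m) (kids ?m (chain_parent ?m) v)))" if v: "v \<in> {1..?m}" for v
  proof -
    have "set (kids ?m (chain_parent ?m) v) = {k\<in>{2..?m}. k - 1 = v}"
      using set_kids[OF chain_parent_mem, of v ?m] v by (auto simp: chain_parent_def)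
    also have "\<dots> = (if v < ?m then {Suc v} else {})" using v by auto
    finally have kids: "set (kids ?m (chain_parent ?m) v) = (if v < ?m then {Suc v} else {})" .
    show ?thesis
    proof (cases "v < ?m")
      case True
      then have "set (map (chain_label e ?m) (kids ?m (chain_parent ?m) v)) = {e (v - 1)}"
        using v kids by (simp add: chain_label_def)
      from singleton_in_blocks[OF this] show ?thesis by (simp only: True if_True)
    next
      case False
      then have "kids ?m (chain_parent ?m) v = []" using kids by simp
      then show ?thesis using False by simp
    qed
  qed
  then show ?thesis
    using assms unfolding chain_deco_def decos_def labelings_def by (auto simp: chain_label_def)
qed

lemma chain_deco_A_mem:
  assumes "(x, k, k') \<in># deco_A (chain_deco e w)"
  shows "\<exists>b<length w - 1. k' = e b \<and> k = (if b = 0 then e (length w - 2) else e (b - 1))"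
proof -
  obtain v where v: "v \<in> {1..length w}" "v < length w" "k' = e (v - 1)" "k = chain_label e (length w) v"
    using assms by (auto simp: chain_deco_def deco_simps set_mset_sum_set split: if_splits)
  then show ?thesis by (intro exI[of _ "v - 1"]) (auto simp: chain_label_def numeral_2_eq_2)
qed

lemma chain_deco_blocks:
  "deco_blocks (chain_deco e w) = {#(w ! b, e b). b \<in># mset_set {..<length w - 1}#}"
proof -
  have "deco_blocks (chain_deco e w) = (\<Sum>v\<in>{1..length w}. if v < length w then {#(w ! (v - 1), e (v - 1))#} else {#})"
    unfolding chain_deco_def deco_simps by (intro sum.cong refl) auto
  also have "\<dots> = (\<Sum>b<length w - 1. {#(w ! b, e b)#})"
    by (rule sum.mono_neutral_cong_right[THEN trans, of _ "{1..<length w}" _ "\<lambda>v. {#(w ! (v - 1), e (v - 1))#}"])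
      (auto intro!: sum.reindex_bij_witness[of _ Suc "\<lambda>v. v - 1"])
  finally show ?thesis by (simp add: sum_singleton_mset)
qed

lemma letters_eq_mset: "{#w ! (v - 1). v \<in># mset_set {1..length w}#} = mset w"
proof -
  have "map (\<lambda>v. w ! (v - 1)) [1..<Suc (length w)] = w"
    by (rule nth_equalityI) (simp_all del: upt_Suc)
  then have "mset w = {#w ! (v - 1). v \<in># mset [1..<Suc (length w)]#}"
    by (metis mset_map)
  then show ?thesis by (simp add: mset_upt atLeastLessThanSuc_atLeastAtMost del: upt_Suc)
qed

text \<open>Each block \<open>e b\<close> is opened by exactly one vertex \<open>vb b\<close>. For
  \<open>b > 0\<close> this vertex has the label \<open>e (b - 1)\<close>, so its parent is
  \<open>vb (b - 1)\<close>, and \<open>vb\<close> is strictly increasing. Since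
  \<open>vb (m - 2)\<close> still has a child, it is at most \<open>m - 1\<close>, which forces
  \<open>vb b = b + 1\<close> for all \<open>b < m - 1\<close>. The block multiset then gives all
  letters but the last, and the label multiset gives the last one.\<close>

lemma chain_deco_unique:
  fixes e :: "nat \<Rightarrow> 'n"
  assumes m: "length w = m" "length w' = m" "m \<ge> 1" and e: "inj_on e {..<m - 1}"
    and p': "p' \<in> (\<Pi>\<^sub>E l\<in>{2..m}. {1..<l})" and g: "g \<in> decos (w', p') (e (m - 2))"
    and labels: "deco_labels g = deco_labels (chain_deco e w)"
    and blocks: "deco_blocks g = deco_blocks (chain_deco e w)"
    and A: "\<And>x k k'. (x, k, k') \<in># deco_A g \<Longrightarrow> \<exists>b<m - 1. k' = e b \<and> k = (if b = 0 then e (m - 2) else e (b - 1))"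
  shows "w' = w"
proof -
  obtain \<phi> B where g_eq: "g = ((w', p'), \<phi>, B)" and \<phi>: "\<phi> \<in> labelings m (e (m - 2))"
    using g m by (auto elim!: decosE)
  have \<phi>1: "\<phi> 1 = e (m - 2)"
    using PiE_mem[OF \<phi>[unfolded labelings_def], of 1] m(3) by simp
  have set_B: "set_mset (B v) = \<phi> ` kidset m p' v" if "v \<in> {1..m}" for v
    using deco_set_blocks[of w' p' \<phi> B] g p' that m(2) by (simp add: g_eq)
  have sum_B: "(\<Sum>v\<in>{1..m}. B v) = mset_set (e ` {..<m - 1})"
  proof -
    have "(\<Sum>v\<in>{1..m}. B v) = image_mset snd (deco_blocks g)"
      by (simp add: g_eq deco_simps m image_mset_sum_set image_mset.compositionality comp_def)
    also have "\<dots> = image_mset e (mset_set {..<m - 1})"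
      by (simp add: blocks chain_deco_blocks m image_mset.compositionality comp_def)
    finally show ?thesis using e by (simp add: image_mset_mset_set)
  qed
  have one: "\<exists>!v. v \<in> {1..m} \<and> e b \<in># B v" if "b < m - 1" for b
  proof -
    have "(\<Sum>v\<in>{1..m}. count (B v) (e b)) = 1"
      using arg_cong[OF sum_B, of "\<lambda>X. count X (e b)"] that by (simp add: count_sum)
    then have "\<exists>v\<in>{1..m}. count (B v) (e b) = 1 \<and> (\<forall>u\<in>{1..m}. v \<noteq> u \<longrightarrow> count (B u) (e b) = 0)"
      by (subst (asm) sum_eq_1_iff) simp_all
    then obtain v where v: "v \<in> {1..m}" "count (B v) (e b) = 1" "\<forall>u\<in>{1..m}. v \<noteq> u \<longrightarrow> count (B u) (e b) = 0"
      by blast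
    show ?thesis
    proof (rule ex1I[of _ v])
      show "v \<in> {1..m} \<and> e b \<in># B v" using v by (simp add: count_greater_zero_iff[symmetric])
      show "u = v" if "u \<in> {1..m} \<and> e b \<in># B u" for u
        using v(3) that by (metis count_eq_zero_iff)
    qed
  qed
  define vb where "vb b = (THE v. v \<in> {1..m} \<and> e b \<in># B v)" for b
  have vb: "vb b \<in> {1..m}" "e b \<in># B (vb b)" if "b < m - 1" for b
    using theI'[OF one[OF that]] by (auto simp: vb_def)
  have vb_unique: "u = vb b" if "b < m - 1" "u \<in> {1..m}" "e b \<in># B u" for b u
    using one[OF that(1)] vb[OF that(1)] that by blast
  have letter: "w' ! (vb b - 1) = w ! b" if b: "b < m - 1" for b
  proof -
    have "(w' ! (vb b - 1), e b) \<in># deco_blocks g"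
      using vb[OF b] by (auto simp: g_eq deco_simps m set_mset_sum_set)
    then obtain b' where "b' < m - 1" "w' ! (vb b - 1) = w ! b'" "e b = e b'"
      by (auto simp: blocks chain_deco_blocks m)
    then show ?thesis using inj_onD[OF e, of b b'] b by simp
  qed
  have step: "vb (b - 1) < vb b" if b: "b < m - 1" "0 < b" for b
  proof -
    have "(w' ! (vb b - 1), \<phi> (vb b), e b) \<in># deco_A g"
      using vb[OF b(1)] by (auto simp: g_eq deco_simps m set_mset_sum_set)
    from A[OF this] obtain b' where b': "b' < m - 1" "e b = e b'" "\<phi> (vb b) = (if b' = 0 then e (m - 2) else e (b' - 1))"
      by blast
    have "b' = b" using inj_onD[OF e b'(2)] b b' by simp
    then have \<phi>b: "\<phi> (vb b) = e (b - 1)" using b' b(2) by simp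
    \<comment> \<open>Here the choice of the root label enters: it differs from
      \<open>e (b - 1)\<close>, so \<open>vb b\<close> has a parent.\<close>
    have "m - 2 \<noteq> b - 1" using b by linarith
    then have "e (m - 2) \<noteq> e (b - 1)" using inj_on_eq_iff[OF e, of "m - 2" "b - 1"] b by simp
    then have "vb b \<noteq> 1" using \<phi>1 \<phi>b by auto
    then have v2: "vb b \<in> {2..m}" using vb(1)[OF b(1)] by auto
    have u: "p' (vb b) \<in> {1..<vb b}" using PiE_mem[OF p' v2] .
    then have um: "p' (vb b) \<in> {1..m}" using v2 by auto
    have "e (b - 1) \<in># B (p' (vb b))"
      using set_B[OF um] \<phi>b v2 by (force simp: kidset_def)
    then have "p' (vb b) = vb (b - 1)" using vb_unique[of "b - 1", OF _ um] b by simp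
    then show ?thesis using u by simp
  qed
  have ge: "b < m - 1 \<Longrightarrow> b + 1 \<le> vb b" for b
  proof (induction b)
    case 0 then show ?case using vb(1)[of 0] by simp
  next
    case (Suc b) then show ?case using step[of "Suc b"] by simp
  qed
  have le: "n < m - 1 \<Longrightarrow> vb (m - 2 - n) \<le> m - 1 - n" for n
  proof (induction n)
    case 0
    then have m2: "m - 2 < m - 1" by linarith
    have "e (m - 2) \<in> \<phi> ` kidset m p' (vb (m - 2))" using vb[OF m2] set_B by blast
    then obtain c where "c \<in> kidset m p' (vb (m - 2))" by blast
    then have c: "c \<in> {2..m}" "p' c = vb (m - 2)" by (auto simp: kidset_def)
    then have "vb (m - 2) < c" "c \<le> m" using PiE_mem[OF p' c(1)] by auto
    then show ?case by simp
  next
    case (Suc n)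
    have "m - 2 - n < m - 1" "0 < m - 2 - n" using Suc.prems by linarith+
    then have "vb (m - 2 - n - 1) < vb (m - 2 - n)" by (rule step)
    moreover have "vb (m - 2 - n) \<le> m - 1 - n" using Suc by simp
    moreover have "m - 2 - n - 1 = m - 2 - Suc n" by simp
    ultimately show ?case by simp
  qed
  have "w' ! b = w ! b" if b: "b < m - 1" for b
  proof -
    have "m - 2 - (m - 2 - b) = b" "m - 1 - (m - 2 - b) = b + 1" "m - 2 - b < m - 1" using b by linarith+
    then have "vb b \<le> b + 1" using le[of "m - 2 - b"] by metis
    then have "vb b = b + 1" using ge[OF b] by simp
    then show ?thesis using letter[OF b] by simp
  qed
  then have take: "take (m - 1) w' = take (m - 1) w"
    by (intro nth_equalityI) (simp_all add: m)
  have "mset w' = image_mset fst (deco_labels g)"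
    by (simp add: g_eq deco_simps sum_singleton_mset image_mset.compositionality comp_def letters_eq_mset[of w'] del: One_nat_def)
  moreover have "mset w = image_mset fst (deco_labels (chain_deco e w))"
    by (simp add: chain_deco_def deco_simps sum_singleton_mset image_mset.compositionality comp_def letters_eq_mset[of w] del: One_nat_def)
  ultimately have mset: "mset w' = mset w" using labels by simp
  have snoc: "v = take (m - 1) v @ [last v]" if "length v = m" for v :: "nat list"
    using that m(3) by (metis append_butlast_last_id butlast_conv_take list.size(3) not_one_le_zero)
  have "mset w' = mset (take (m - 1) w) + {#last w'#}" "mset w = mset (take (m - 1) w) + {#last w#}"
    using arg_cong[OF snoc[OF m(2)], of mset] arg_cong[OF snoc[OF m(1)], of mset] take by simp_all
  then have "last w' = last w" using mset by simp
  then show ?thesis using take snoc[OF m(1)] snoc[OF m(2)] by simp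
qed

section \<open>Linear independence\<close>

lemma tree_iso_refl: "tree_iso \<tau> \<tau>"
  by (cases \<tau>) (auto simp: tree_iso_def intro!: exI[of _ id])

lemma representatives_iso_imp_eq:
  assumes "representatives T R" "\<tau> \<in> R" "\<tau>' \<in> R" "tree_iso \<tau> \<tau>'"
  shows "\<tau> = \<tau>'"
  using assms tree_iso_refl[of \<tau>] unfolding representatives_def by blast

lemma coordinate_smooth: "(\<lambda>x :: real^'n::finite. x $ j) \<in> smooth_functions"
proof -
  have partial: "partial k (\<lambda>x :: real^'n. x $ j) = (\<lambda>x. if k = j then 1 else 0)"
    "partial k (\<lambda>x :: real^'n. c :: real) = (\<lambda>x. 0)" for k c
    unfolding partial_def
    by (intro ext vector_derivative_at; auto simp: axis_def has_real_derivative_iff_has_vector_derivative[symmetric]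
        intro!: derivative_eq_intros)+
  have "iter_partial js (\<lambda>x :: real^'n. x $ j) \<in> insert (\<lambda>x. x $ j) (range (\<lambda>c x. c))" for js
    by (induction js rule: rev_induct) (auto simp: iter_partial_def partial)
  moreover have "f differentiable (at x)" if "f \<in> insert (\<lambda>x. x $ j) (range (\<lambda>c x. c))" for f and x :: "real^'n"
    using that by (auto intro: bounded_linear_imp_differentiable bounded_linear_vec_nth)
  ultimately show ?thesis unfolding smooth_functions_def by blast
qed

context exp_exp_fields
begin

text \<open>Only the component \<open>e 0\<close> on the diagonal is used, \<open>e 0\<close> being
  the root label of all canonical decorations. The representatives ensure that isomorphic trees in
  \<open>T\<close> coincide.\<close>

lemma tree_fields_independent:
  assumes m: "m \<ge> 1" and N: "CARD('n) \<ge> m - 1"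
    and R: "representatives (\<Union>w\<in>words d m. rec_trees w) R"
  shows "lin_indep_family UNIV R (tree_field V)"
  unfolding lin_indep_family_def
proof (intro allI impI ballI)
  fix T c \<tau>
  assume T: "finite T" "T \<subseteq> R" and rel: "\<forall>x\<in>UNIV. (\<Sum>\<tau>\<in>T. c \<tau> *\<^sub>R tree_field V \<tau> x) = 0" and \<tau>: "\<tau> \<in> T"
  obtain e :: "nat \<Rightarrow> 'n" where e: "inj_on e {..<m - 1}"
    using card_le_inj[of "{..<m - 1}" "UNIV :: 'n set"] N by auto
  have word: "fst \<tau> \<in> words d m" "\<tau> \<in> rec_trees (fst \<tau>)" if \<tau>T: "\<tau> \<in> T" for \<tau>
  proof -
    have "\<tau> \<in> (\<Union>w\<in>words d m. rec_trees w)" using \<tau>T T(2) R unfolding representatives_def by blast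
    then obtain w where w: "w \<in> words d m" "\<tau> \<in> rec_trees w" by blast
    moreover have "fst \<tau> = w" using w(2) by (auto simp: rec_trees_def)
    ultimately show "fst \<tau> \<in> words d m" "\<tau> \<in> rec_trees (fst \<tau>)" by simp_all
  qed
  have tree: "length (fst \<tau>) = m \<and> snd \<tau> \<in> (\<Pi>\<^sub>E l\<in>{2..m}. {1..<l})" if "\<tau> \<in> T" for \<tau>
    using word[OF that] by (cases \<tau>) (auto simp: words_def rec_trees_def)
  define us where "us = (\<lambda>\<tau> :: rec_tree. SOME us. canonical (fst \<tau>) (snd \<tau>) us)"
  have us: "canonical (fst \<tau>) (snd \<tau>) (us \<tau>)" if "\<tau> \<in> T" for \<tau>
    unfolding us_def using canonical_exists parent_mapI tree[OF that] m by (metis someI_ex)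
  have full: "full_bfs m (snd \<tau>) (us \<tau>)" if "\<tau> \<in> T" for \<tau>
    using tree[OF that] us[OF that] m parent_mapI by unfold_locales (auto simp: canonical_def)
  have noniso: "\<tau> = \<tau>'" if "\<tau> \<in> T" "\<tau>' \<in> T" "tree_iso \<tau> \<tau>'" for \<tau> \<tau>'
    using representatives_iso_imp_eq[OF R] that T(2) by blast
  show "c \<tau> = 0"
  proof (rule independent_if_unique_deco[OF T(1), where Lab = "\<lambda>\<tau>. decos \<tau> (e 0)" and j = "e 0"
        and can = "\<lambda>\<tau>. canonical_deco e (fst \<tau>) (snd \<tau>) (us \<tau>)"])
    show "\<exists>w p. w \<in> words d m \<and> l \<in> decos (w, p) (e 0)" if "\<tau> \<in> T" "l \<in> decos \<tau> (e 0)" for \<tau> l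
      using word[OF that(1)] that(2) by (metis prod.collapse)
    show "finite (decos \<tau> (e 0))" for \<tau> by (rule finite_decos)
    show "canonical_deco e (fst \<tau>) (snd \<tau>) (us \<tau>) \<in> decos \<tau> (e 0)" if "\<tau> \<in> T" for \<tau>
      using full_bfs.canonical_deco_in_decos[OF full[OF that], of "fst \<tau>" e] tree[OF that] by simp
    show "\<pi> \<tau> = \<tau>" if "\<pi> permutes T" "\<And>\<tau>. \<tau> \<in> T \<Longrightarrow> g \<tau> \<in> decos (\<pi> \<tau>) (e 0)"
      "\<And>\<tau>. \<tau> \<in> T \<Longrightarrow> deco_labels (g \<tau>) = deco_labels (canonical_deco e (fst \<tau>) (snd \<tau>) (us \<tau>)) \<and>
        deco_blocks (g \<tau>) = deco_blocks (canonical_deco e (fst \<tau>) (snd \<tau>) (us \<tau>))"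
      "(\<Sum>\<tau>\<in>T. deco_A (g \<tau>)) = (\<Sum>\<tau>\<in>T. deco_A (canonical_deco e (fst \<tau>) (snd \<tau>) (us \<tau>)))" "\<tau> \<in> T" for \<pi> g \<tau>
      by (rule canonical_decos_unique[OF T(1) m e tree us noniso that])
    show "(\<Sum>\<tau>\<in>T. c \<tau> * (\<Sum>l\<in>decos \<tau> (e 0). deco_coeff l * deco_fun l t)) = 0" for t
    proof -
      have "(\<Sum>\<tau>\<in>T. c \<tau> * (\<Sum>l\<in>decos \<tau> (e 0). deco_coeff l * deco_fun l t)) =
          (\<Sum>\<tau>\<in>T. c \<tau> * tree_field V \<tau> (\<chi> _. t) $ e 0)"
      proof (intro sum.cong refl)
        fix \<tau> assume "\<tau> \<in> T"
        then show "c \<tau> * (\<Sum>l\<in>decos \<tau> (e 0). deco_coeff l * deco_fun l t) = c \<tau> * tree_field V \<tau> (\<chi> _. t) $ e 0"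
          using tree_field_diagonal[of "fst \<tau>" m "snd \<tau>"] word m by simp
      qed
      also have "\<dots> = (\<Sum>\<tau>\<in>T. c \<tau> *\<^sub>R tree_field V \<tau> (\<chi> _. t)) $ e 0" by (simp add: sum_component)
      also have "\<dots> = 0" using rel by simp
      finally show ?thesis .
    qed
  qed (rule \<tau>)
qed

lemma word_ops_independent:
  assumes m: "m \<ge> 1" and N: "CARD('n) \<ge> m - 1"
  shows "lin_indep_family (smooth_functions \<times> UNIV) (words d m) (\<lambda>w (\<phi>, x). word_op V w \<phi> x)"
  unfolding lin_indep_family_def
proof (intro allI impI ballI)
  fix T c w
  assume T: "finite T" "T \<subseteq> words d m" and w: "w \<in> T"
    and rel: "\<forall>x\<in>smooth_functions \<times> UNIV. (\<Sum>w\<in>T. c w *\<^sub>R (case x of (\<phi>, x) \<Rightarrow> word_op V w \<phi> x)) = 0"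
  obtain e :: "nat \<Rightarrow> 'n" where e: "inj_on e {..<m - 1}"
    using card_le_inj[of "{..<m - 1}" "UNIV :: 'n set"] N by auto
  let ?j = "e (m - 2)"
  \<comment> \<open>The entry of a word collects the decorations of all its recursive trees, since
    the operator applied to a coordinate function is the sum of their fields.\<close>
  let ?Lab = "\<lambda>w. \<Union>\<tau>\<in>rec_trees w. decos \<tau> ?j"
  have len: "length w = m" if "w \<in> T" for w using that T(2) by (auto simp: words_def)
  have fin: "finite (rec_trees w)" for w unfolding rec_trees_def by (intro finite_cartesian_product finite_PiE) auto
  show "c w = 0"
  proof (rule independent_if_unique_deco[OF T(1), where Lab = ?Lab and j = ?j and can = "chain_deco e"])
    show "\<exists>w p. w \<in> words d m \<and> l \<in> decos (w, p) ?j" if "w \<in> T" "l \<in> ?Lab w" for w l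
      using that T(2) by (auto simp: rec_trees_def)
    show "finite (?Lab w)" for w using fin finite_decos by blast
    show "chain_deco e w \<in> ?Lab w" if "w \<in> T" for w
      using chain_deco_in_decos[of w e] chain_parent_mem[of m] len[OF that] m by (auto simp: rec_trees_def)
    show "\<pi> w = w" if \<pi>: "\<pi> permutes T" and g: "\<And>w. w \<in> T \<Longrightarrow> g w \<in> ?Lab (\<pi> w)"
      and row: "\<And>w. w \<in> T \<Longrightarrow> deco_labels (g w) = deco_labels (chain_deco e w) \<and> deco_blocks (g w) = deco_blocks (chain_deco e w)"
      and A: "(\<Sum>w\<in>T. deco_A (g w)) = (\<Sum>w\<in>T. deco_A (chain_deco e w))" and w: "w \<in> T" for \<pi> g w
    proof -
      have \<pi>w: "\<pi> w \<in> T" using \<pi> w by (simp add: permutes_in_image)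
      obtain p' where p': "p' \<in> (\<Pi>\<^sub>E l\<in>{2..m}. {1..<l})" "g w \<in> decos (\<pi> w, p') ?j"
        using g[OF w] len[OF \<pi>w] by (auto simp: rec_trees_def)
      show ?thesis
      proof (rule chain_deco_unique[OF len[OF w] len[OF \<pi>w] m e p'])
        show "deco_labels (g w) = deco_labels (chain_deco e w)" "deco_blocks (g w) = deco_blocks (chain_deco e w)"
          using row[OF w] by auto
        fix x k k' assume "(x, k, k') \<in># deco_A (g w)"
        then have "(x, k, k') \<in># (\<Sum>w\<in>T. deco_A (g w))" using w T(1) by (auto simp: set_mset_sum_set)
        then obtain v where v: "v \<in> T" "(x, k, k') \<in># deco_A (chain_deco e v)"
          unfolding A using T(1) by (auto simp: set_mset_sum_set)
        show "\<exists>b<m - 1. k' = e b \<and> k = (if b = 0 then ?j else e (b - 1))"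
          using chain_deco_A_mem[OF v(2)] by (simp only: len[OF v(1)])
      qed
    qed
    show "(\<Sum>w\<in>T. c w * (\<Sum>l\<in>?Lab w. deco_coeff l * deco_fun l t)) = 0" for t
    proof -
      have "(\<Sum>w\<in>T. c w * (\<Sum>l\<in>?Lab w. deco_coeff l * deco_fun l t)) =
          (\<Sum>w\<in>T. c w * word_op V w (\<lambda>x. x $ ?j) (\<chi> _. t))"
      proof (intro sum.cong refl arg_cong2[of _ _ _ _ "(*)"])
        fix w assume "w \<in> T"
        then have w: "w \<in> words d m" using T(2) by auto
        have "(\<Sum>l\<in>?Lab w. deco_coeff l * deco_fun l t) = (\<Sum>\<tau>\<in>rec_trees w. \<Sum>l\<in>decos \<tau> ?j. deco_coeff l * deco_fun l t)"
          using fin by (intro sum.UNION_disjoint) (auto simp: finite_decos elim!: decosE)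
        also have "\<dots> = (\<Sum>\<tau>\<in>rec_trees w. tree_field V \<tau> (\<chi> _. t) $ ?j)"
          using tree_field_diagonal[OF w m] by (intro sum.cong refl) (auto simp: rec_trees_def)
        also have "\<dots> = word_op V w (\<lambda>x. x $ ?j) (\<chi> _. t)" by (simp add: word_op_coordinate[OF w m])
        finally show "(\<Sum>l\<in>?Lab w. deco_coeff l * deco_fun l t) = word_op V w (\<lambda>x. x $ ?j) (\<chi> _. t)" .
      qed
      also have "\<dots> = 0" using rel[rule_format, of "(\<lambda>x. x $ ?j, \<chi> _. t)"] coordinate_smooth[of ?j] by simp
      finally show ?thesis .
    qed
  qed (rule w)
qed

end

theorem mainTheorem3:
  fixes d m :: nat
    and A D :: "nat \<Rightarrow> real^'n::finite^'n"
    and V :: "nat \<Rightarrow> real^'n \<Rightarrow> real^'n"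
  assumes "d \<ge> 1" and "m \<ge> 1" and "CARD('n) \<ge> m - 1"
    and "\<And>i j k. i \<in> {1..d} \<Longrightarrow> j \<noteq> k \<Longrightarrow> D i $ j $ k = 0"
    and "alg_independent
           (({1..d} \<times> (UNIV :: 'n set) \<times> (UNIV :: 'n set)) <+> ({1..d} \<times> (UNIV :: 'n set)))
           (case_sum (\<lambda>(i, j, k). A i $ j $ k) (\<lambda>(i, j). D i $ j $ j))"
    and "\<And>i x. i \<in> {1..d} \<Longrightarrow> V i x = vexp (A i *v vexp (D i *v x))"
  shows "(\<forall>R. representatives (\<Union>w\<in>words d m. rec_trees w) R \<longrightarrow>
            lin_indep_family UNIV R (tree_field V)) \<and>
         lin_indep_family (smooth_functions \<times> UNIV) (words d m) (\<lambda>w (\<phi>, x). word_op V w \<phi> x)"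
proof -
  interpret exp_exp_fields d A D V
    using assms(4-6) by unfold_locales
  show ?thesis
    using tree_fields_independent[OF assms(2,3)] word_ops_independent[OF assms(2,3)] by blast
qed

end
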